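(* Let $\varepsilon>0$, let $\Phi_1,\Phi_2$ be quasi-Young functions of order $r_0\in(0,1]$, let $\omega,v\in\mathscr P_E(\mathbf R^{2d})$ with $v$ submultiplicative be such that $\omega$ is $v$-moderate, and let $\psi\in M^{r_0}_{(v)}(\mathbf R^d)$ have a dual window in $M^{r_0}_{(v)}(\mathbf R^d)$ with respect to $\varepsilon\mathbf Z^{2d}$. Then the synthesis operator $D^\varepsilon_\psi c=\sum_{j,\iota\in\varepsilon\mathbf Z^d}c(j,\iota)e^{i\langle\cdot,\iota\rangle}\psi(\cdot-j)$ is continuous from $\ell^{\Phi_1,\Phi_2}_{(\omega)}(\varepsilon\mathbf Z^{2d})$ into $M^{\Phi_1,\Phi_2}_{(\omega)}(\mathbf R^d)$, and $$\|D^\varepsilon_\psi c\|_{M^{\Phi_1,\Phi_2}_{(\omega)}}\lesssim\|c\|_{\ell^{\Phi_1,\Phi_2}_{(\omega)}},\qquad c\in\ell^{\Phi_1,\Phi_2}_{(\omega)}(\varepsilon\mathbf Z^{2d}).$$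
   Context: Weights: a weight on $\mathbf R^n$ is a positive $\omega\in L^\infty_{loc}$ with $1/\omega\in L^\infty_{loc}$. It is $v$-moderate, for a positive weight $v$, if $\omega(x+y)\lesssim\omega(x)v(y)$; $\mathscr P_E(\mathbf R^n)$ is the set of weights that are $v$-moderate for some $v$. A weight $v$ is submultiplicative if it is even and $v(x+y)\lesssim v(x)v(y)$. $A\lesssim B$ means $A\le cB$ with a constant $c>0$ (independent of the sequence). Young functions: a Young function is a convex $\Phi_0:[0,\infty)\to[0,\infty]$ with $\Phi_0(0)=0$, $\lim_{t\to\infty}\Phi_0(t)=\infty$; a quasi-Young function of order $r_0\in(0,1]$ is $\Phi(t)=\Phi_0(t^{r_0})$ with $\Phi_0$ Young. Orlicz quasi-norms: for a measure $\mu$, $\|f\|_{L^\Phi(\mu)}=\inf\{\lambda>0:\int\Phi(|f|/\lambda)\,d\mu\le1\}$, and $\|F\|_{L^{\Phi_1,\Phi_2}_{(\omega)}(\mu\otimes\mu)}=\big\|\,\xi\mapsto\|F(\cdot,\xi)\omega(\cdot,\xi)\|_{L^{\Phi_1}(\mu)}\big\|_{L^{\Phi_2}(\mu)}$. $L^{\Phi_1,\Phi_2}_{(\omega)}(\mathbf R^{2d})$ uses Lebesgue measure on $\mathbf R^d$; $\ell^{\Phi_1,\Phi_2}_{(\omega)}(\varepsilon\mathbf Z^{2d})$ uses counting measure on $\varepsilon\mathbf Z^d$ (so the weight is $\omega$ evaluated at the lattice points). Pilipović space: $\mathcal H'_\flat(\mathbf R^d)$ is the space of formal Hermite series $\sum_\alpha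 c(\alpha)h_\alpha$ with $|c(\alpha)|\lesssim r^{|\alpha|}\alpha!^{1/2}$ for every $r>0$ ($h_\alpha$ the $L^2$-normalized Hermite functions), dual via the $L^2$-form to the space $\mathcal H_\flat(\mathbf R^d)$ of Hermite series with $|c(\alpha)|\lesssim r^{|\alpha|}\alpha!^{-1/2}$ for some $r>0$. Modulation spaces: with $\phi_0(x)=\pi^{-d/4}e^{-|x|^2/2}$, $M^{\Phi_1,\Phi_2}_{(\omega)}(\mathbf R^d)=\{f\in\mathcal H'_\flat(\mathbf R^d):\|f\|_{M^{\Phi_1,\Phi_2}_{(\omega)}}:=\|V_{\phi_0}f\|_{L^{\Phi_1,\Phi_2}_{(\omega)}}<\infty\}$, and $M^{p}_{(v)}$ is defined in the same way with $L^{p}_{(v)}(\mathbf R^{2d})$. Here $V_\phi f(x,\xi)=\mathscr F(f\,\overline{\phi(\cdot-x)})(\xi)=(2\pi)^{-d/2}(f,e^{i\langle\cdot,\xi\rangle}\phi(\cdot-x))$, where $\mathscr Fg(\xi)=(2\pi)^{-d/2}\int g(y)e^{-i\langle y,\xi\rangle}dy$ and the pairing is the extension of the $L^2$ form. Synthesis operator: $D^\varepsilon_\psi$ is an operator from $\ell^\infty_{(\omega)}(\varepsilon\mathbf Z^{2d})$ to $M^\infty_{(\omega)}(\mathbf R^d)$, the series being understood in the weak$^*$ topology of $M^\infty_{(\omega)}(\mathbf R^d)$. Dual window: $\phi$ is a dual window of $\psi$ with respect to $\varepsilon\mathbf Z^{2d}$ if $\{e^{i\langle\cdot,\iota\rangle}\phi(\cdot-j)\}_{j,\iota\in\varepsilon\mathbf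 Z^d}$ and $\{e^{i\langle\cdot,\iota\rangle}\psi(\cdot-j)\}_{j,\iota\in\varepsilon\mathbf Z^d}$ are dual frames for $L^2(\mathbf R^d)$, normalized so that $f=\sum_{j,\iota}V_\phi f(j,\iota)e^{i\langle\cdot,\iota\rangle}\psi(\cdot-j)$ for $f\in L^2(\mathbf R^d)$. *)

theory Defs
  imports "HOL-Analysis.Analysis"
begin

text \<open>Both \<open>\<omega>\<close> and \<open>1/\<omega>\<close> are locally essentially bounded. Positivity and moderateness are
  pointwise rather than almost everywhere, since weights are evaluated at lattice points.\<close>

definition weight :: "('a::euclidean_space \<Rightarrow> real) \<Rightarrow> bool" where
  "weight \<omega> \<longleftrightarrow> (\<forall>x. 0 < \<omega> x) \<and> \<omega> \<in> borel_measurable lebesgue \<and>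
     (\<forall>K. compact K \<longrightarrow> (\<exists>C. AE x in lebesgue. x \<in> K \<longrightarrow> \<omega> x \<le> C)) \<and>
     (\<forall>K. compact K \<longrightarrow> (\<exists>C. AE x in lebesgue. x \<in> K \<longrightarrow> 1 / \<omega> x \<le> C))"

definition moderate :: "('a::euclidean_space \<Rightarrow> real) \<Rightarrow> ('a \<Rightarrow> real) \<Rightarrow> bool" where
  "moderate \<omega> v \<longleftrightarrow> (\<exists>C>0. \<forall>x y. \<omega> (x + y) \<le> C * (\<omega> x * v y))"

definition moderate_weights :: "('a::euclidean_space \<Rightarrow> real) set" where
  "moderate_weights = {\<omega>. weight \<omega> \<and> (\<exists>v. weight v \<and> moderate \<omega> v)}"

definition submultiplicative :: "('a::euclidean_space \<Rightarrow> real) \<Rightarrow> bool" where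
  "submultiplicative v \<longleftrightarrow>
     weight v \<and> (\<forall>x. v (- x) = v x) \<and> (\<exists>C>0. \<forall>x y. v (x + y) \<le> C * (v x * v y))"

text \<open>Only the values on \<open>[0, \<infinity>)\<close> are relevant.\<close>

definition young_function :: "(real \<Rightarrow> ennreal) \<Rightarrow> bool" where
  "young_function \<Phi> \<longleftrightarrow> \<Phi> 0 = 0 \<and> (\<Phi> \<longlongrightarrow> top) at_top \<and>
     (\<forall>s\<ge>0. \<forall>t\<ge>0. \<forall>u\<in>{0..1}.
        \<Phi> (u * s + (1 - u) * t) \<le> ennreal u * \<Phi> s + ennreal (1 - u) * \<Phi> t)"

definition quasi_young_function :: "real \<Rightarrow> (real \<Rightarrow> ennreal) \<Rightarrow> bool" where
  "quasi_young_function r \<Phi> \<longleftrightarrow> 0 < r \<and> r \<le> 1 \<and>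
     (\<exists>\<Phi>0. young_function \<Phi>0 \<and> (\<forall>t\<ge>0. \<Phi> t = \<Phi>0 (t powr r)))"

text \<open>The extension by the limit at infinity is needed because the inner norm of a
  mixed norm may be infinite.\<close>

definition extend_top :: "(real \<Rightarrow> ennreal) \<Rightarrow> ennreal \<Rightarrow> ennreal" where
  "extend_top \<Phi> t = (if t = top then top else \<Phi> (enn2real t))"

text \<open>The argument \<open>f\<close> is the modulus of the function.\<close>

definition orlicz_norm :: "'a measure \<Rightarrow> (real \<Rightarrow> ennreal) \<Rightarrow> ('a \<Rightarrow> ennreal) \<Rightarrow> ennreal" where
  "orlicz_norm M \<Phi> f =
     Inf {ennreal l |l. 0 < l \<and> (\<integral>\<^sup>+x. extend_top \<Phi> (f x / ennreal l) \<partial>M) \<le> 1}"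

definition mixed_orlicz_norm ::
  "'a measure \<Rightarrow> (real \<Rightarrow> ennreal) \<Rightarrow> (real \<Rightarrow> ennreal) \<Rightarrow> ('a \<times> 'a \<Rightarrow> real)
     \<Rightarrow> ('a \<times> 'a \<Rightarrow> complex) \<Rightarrow> ennreal" where
  "mixed_orlicz_norm M \<Phi>1 \<Phi>2 \<omega> F =
     orlicz_norm M \<Phi>2 (\<lambda>\<xi>. orlicz_norm M \<Phi>1 (\<lambda>x. ennreal (norm (F (x, \<xi>)) * \<omega> (x, \<xi>))))"

definition hermite1 :: "nat \<Rightarrow> real \<Rightarrow> real" where
  "hermite1 n t = pi powr (- 1 / 4) * (- 1) ^ n / sqrt (2 ^ n * fact n) * exp (t\<^sup>2 / 2) *
     (deriv ^^ n) (\<lambda>s. exp (- (s\<^sup>2))) t"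

definition hermite :: "('d::finite \<Rightarrow> nat) \<Rightarrow> real ^ 'd \<Rightarrow> real" where
  "hermite \<alpha> x = (\<Prod>i\<in>UNIV. hermite1 (\<alpha> i) (x $ i))"

text \<open>A formal Hermite series is represented by its family of coefficients. A (sufficiently
  integrable) function corresponds to the series with coefficients \<open>hermite_coeff F\<close>.\<close>

type_synonym 'd hermite_series = "('d \<Rightarrow> nat) \<Rightarrow> complex"

definition hermite_coeff :: "(real ^ 'd::finite \<Rightarrow> complex) \<Rightarrow> 'd hermite_series" where
  "hermite_coeff F \<alpha> = (LINT y|lebesgue. F y * complex_of_real (hermite \<alpha> y))"

definition pilipovic_dual :: "('d::finite) hermite_series set" where
  "pilipovic_dual = {f. \<forall>r>0. \<exists>C. \<forall>\<alpha>.
     norm (f \<alpha>) \<le> C * (r ^ (\<Sum>i\<in>UNIV. \<alpha> i) * sqrt (\<Prod>i\<in>UNIV. fact (\<alpha> i)))}"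

text \<open>The extension of the \<open>L\<^sup>2\<close> form to the pairing between \<open>\<H>\<^sub>\<flat>'\<close> and \<open>\<H>\<^sub>\<flat>\<close>; the series
  converges absolutely there.\<close>

definition hermite_pairing :: "('d::finite) hermite_series \<Rightarrow> 'd hermite_series \<Rightarrow> complex" where
  "hermite_pairing f g = infsum (\<lambda>\<alpha>. f \<alpha> * cnj (g \<alpha>)) UNIV"

definition tf_shift_fun ::
  "real ^ 'd::finite \<Rightarrow> real ^ 'd \<Rightarrow> (real ^ 'd \<Rightarrow> complex) \<Rightarrow> real ^ 'd \<Rightarrow> complex" where
  "tf_shift_fun x \<xi> F y = cis (inner y \<xi>) * F (y - x)"

text \<open>On formal Hermite series, \<open>f \<mapsto> exp (i \<langle>\<cdot>, \<xi>\<rangle>) f (\<cdot> - x)\<close> acts termwise. For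
  \<open>f \<in> \<H>\<^sub>\<flat>'\<close> each coefficient of the result is an absolutely convergent series; this is the
  extension by duality of the shift of functions.\<close>

definition tf_shift ::
  "real ^ 'd::finite \<Rightarrow> real ^ 'd \<Rightarrow> 'd hermite_series \<Rightarrow> 'd hermite_series" where
  "tf_shift x \<xi> f \<alpha> =
     infsum (\<lambda>\<beta>. f \<beta> * hermite_coeff (tf_shift_fun x \<xi> (\<lambda>y. complex_of_real (hermite \<beta> y))) \<alpha>) UNIV"

definition gauss :: "real ^ 'd::finite \<Rightarrow> complex" where
  "gauss x = complex_of_real (pi powr (- real CARD('d) / 4) * exp (- ((norm x)\<^sup>2) / 2))"

definition stft_gauss :: "('d::finite) hermite_series \<Rightarrow> (real ^ 'd) \<times> (real ^ 'd) \<Rightarrow> complex" where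
  "stft_gauss f = (\<lambda>(x, \<xi>). complex_of_real ((2 * pi) powr (- real CARD('d) / 2)) *
     hermite_pairing f (hermite_coeff (tf_shift_fun x \<xi> gauss)))"

definition modulation_norm ::
  "(real \<Rightarrow> ennreal) \<Rightarrow> (real \<Rightarrow> ennreal) \<Rightarrow> ((real ^ 'd::finite) \<times> (real ^ 'd) \<Rightarrow> real)
     \<Rightarrow> 'd hermite_series \<Rightarrow> ennreal" where
  "modulation_norm \<Phi>1 \<Phi>2 \<omega> f = mixed_orlicz_norm lebesgue \<Phi>1 \<Phi>2 \<omega> (stft_gauss f)"

definition modulation_space ::
  "(real \<Rightarrow> ennreal) \<Rightarrow> (real \<Rightarrow> ennreal) \<Rightarrow> ((real ^ 'd::finite) \<times> (real ^ 'd) \<Rightarrow> real)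
     \<Rightarrow> 'd hermite_series set" where
  "modulation_space \<Phi>1 \<Phi>2 \<omega> = {f \<in> pilipovic_dual. modulation_norm \<Phi>1 \<Phi>2 \<omega> f < top}"

definition modulation_space_Lp ::
  "real \<Rightarrow> ((real ^ 'd::finite) \<times> (real ^ 'd) \<Rightarrow> real) \<Rightarrow> 'd hermite_series set" where
  "modulation_space_Lp p v = {f \<in> pilipovic_dual.
     (\<integral>\<^sup>+z. ennreal ((norm (stft_gauss f z) * v z) powr p) \<partial>lebesgue) < top}"

definition modulation_space_Linf ::
  "((real ^ 'd::finite) \<times> (real ^ 'd) \<Rightarrow> real) \<Rightarrow> 'd hermite_series set" where
  "modulation_space_Linf \<omega> = {f \<in> pilipovic_dual.
     \<exists>C. AE z in lebesgue. norm (stft_gauss f z) * \<omega> z \<le> C}"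

text \<open>The extension of the \<open>L\<^sup>2\<close> form to the pairing between \<open>M\<^sup>\<infinity>\<close> with weight \<open>\<omega>\<close> and
  \<open>M\<^sup>1\<close> with weight \<open>1/\<omega>\<close>, by Moyal's identity (the Gaussian window has
  \<open>L\<^sup>2\<close> norm one). It makes the former space the dual of the latter.\<close>

definition modulation_pairing :: "('d::finite) hermite_series \<Rightarrow> 'd hermite_series \<Rightarrow> complex" where
  "modulation_pairing f g = (LINT z|lebesgue. stft_gauss f z * cnj (stft_gauss g z))"

definition weak_star_topology ::
  "((real ^ 'd::finite) \<times> (real ^ 'd) \<Rightarrow> real) \<Rightarrow> 'd hermite_series topology" where
  "weak_star_topology \<omega> =
     (let P = modulation_space_Lp 1 (\<lambda>z. 1 / \<omega> z)
      in pullback_topology (modulation_space_Linf \<omega>)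
           (\<lambda>f. restrict (modulation_pairing f) P) (product_topology (\<lambda>_. euclidean) P))"

definition lattice_pts :: "real \<Rightarrow> (real ^ 'd::finite) set" where
  "lattice_pts \<epsilon> = {x. \<forall>i. \<exists>k::int. x $ i = \<epsilon> * of_int k}"

definition sequence_norm ::
  "real \<Rightarrow> (real \<Rightarrow> ennreal) \<Rightarrow> (real \<Rightarrow> ennreal) \<Rightarrow> ((real ^ 'd::finite) \<times> (real ^ 'd) \<Rightarrow> real)
     \<Rightarrow> ((real ^ 'd) \<times> (real ^ 'd) \<Rightarrow> complex) \<Rightarrow> ennreal" where
  "sequence_norm \<epsilon> \<Phi>1 \<Phi>2 \<omega> c = mixed_orlicz_norm (count_space (lattice_pts \<epsilon>)) \<Phi>1 \<Phi>2 \<omega> c"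

text \<open>A sequence on the lattice is represented by its extension by zero.\<close>

definition sequence_space ::
  "real \<Rightarrow> (real \<Rightarrow> ennreal) \<Rightarrow> (real \<Rightarrow> ennreal) \<Rightarrow> ((real ^ 'd::finite) \<times> (real ^ 'd) \<Rightarrow> real)
     \<Rightarrow> ((real ^ 'd) \<times> (real ^ 'd) \<Rightarrow> complex) set" where
  "sequence_space \<epsilon> \<Phi>1 \<Phi>2 \<omega> = {c. (\<forall>z. z \<notin> lattice_pts \<epsilon> \<times> lattice_pts \<epsilon> \<longrightarrow> c z = 0) \<and>
     sequence_norm \<epsilon> \<Phi>1 \<Phi>2 \<omega> c < top}"

text \<open>The series \<open>\<Sum> c (j, \<iota>) exp (i \<langle>\<cdot>, \<iota>\<rangle>) \<psi> (\<cdot> - j)\<close> converges (unconditionally) to \<open>f\<close>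
  in the weak* topology; in particular \<open>f\<close> belongs to \<open>M\<^sup>\<infinity>\<close> with weight \<open>\<omega>\<close>.\<close>

definition synthesizes ::
  "real \<Rightarrow> ((real ^ 'd::finite) \<times> (real ^ 'd) \<Rightarrow> real) \<Rightarrow> 'd hermite_series
     \<Rightarrow> ((real ^ 'd) \<times> (real ^ 'd) \<Rightarrow> complex) \<Rightarrow> 'd hermite_series \<Rightarrow> bool" where
  "synthesizes \<epsilon> \<omega> \<psi> c f \<longleftrightarrow>
     limitin (weak_star_topology \<omega>) (\<lambda>S \<alpha>. \<Sum>(j, \<iota>)\<in>S. c (j, \<iota>) * tf_shift j \<iota> \<psi> \<alpha>) f
       (finite_subsets_at_top (lattice_pts \<epsilon> \<times> lattice_pts \<epsilon>))"

definition synthesis ::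
  "real \<Rightarrow> ((real ^ 'd::finite) \<times> (real ^ 'd) \<Rightarrow> real) \<Rightarrow> 'd hermite_series
     \<Rightarrow> ((real ^ 'd) \<times> (real ^ 'd) \<Rightarrow> complex) \<Rightarrow> 'd hermite_series" where
  "synthesis \<epsilon> \<omega> \<psi> c = (THE f. synthesizes \<epsilon> \<omega> \<psi> c f)"

definition square_integrable :: "(real ^ 'd::finite \<Rightarrow> complex) \<Rightarrow> bool" where
  "square_integrable F \<longleftrightarrow>
     F \<in> borel_measurable lebesgue \<and> integrable lebesgue (\<lambda>y. (norm (F y))\<^sup>2)"

definition L2_inner :: "(real ^ 'd::finite \<Rightarrow> complex) \<Rightarrow> (real ^ 'd \<Rightarrow> complex) \<Rightarrow> complex" where
  "L2_inner F G = (LINT y|lebesgue. F y * cnj (G y))"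

definition L2_norm :: "(real ^ 'd::finite \<Rightarrow> complex) \<Rightarrow> real" where
  "L2_norm F = sqrt (LINT y|lebesgue. (norm (F y))\<^sup>2)"

definition stft_L2 ::
  "(real ^ 'd::finite \<Rightarrow> complex) \<Rightarrow> (real ^ 'd \<Rightarrow> complex) \<Rightarrow> (real ^ 'd) \<times> (real ^ 'd) \<Rightarrow> complex" where
  "stft_L2 \<phi> F = (\<lambda>(x, \<xi>). complex_of_real ((2 * pi) powr (- real CARD('d) / 2)) *
     L2_inner F (tf_shift_fun x \<xi> \<phi>))"

definition gabor_frame :: "real \<Rightarrow> (real ^ 'd::finite \<Rightarrow> complex) \<Rightarrow> bool" where
  "gabor_frame \<epsilon> \<phi> \<longleftrightarrow> square_integrable \<phi> \<and>
     (\<exists>A>0. \<exists>B>0. \<forall>F. square_integrable F \<longrightarrow>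
        (let S = infsum (\<lambda>(j, \<iota>). ennreal ((norm (L2_inner F (tf_shift_fun j \<iota> \<phi>)))\<^sup>2))
                   (lattice_pts \<epsilon> \<times> lattice_pts \<epsilon>)
         in ennreal (A * (L2_norm F)\<^sup>2) \<le> S \<and> S \<le> ennreal (B * (L2_norm F)\<^sup>2)))"

definition gabor_dual_frames ::
  "real \<Rightarrow> (real ^ 'd::finite \<Rightarrow> complex) \<Rightarrow> (real ^ 'd \<Rightarrow> complex) \<Rightarrow> bool" where
  "gabor_dual_frames \<epsilon> \<phi> \<psi> \<longleftrightarrow> gabor_frame \<epsilon> \<phi> \<and> gabor_frame \<epsilon> \<psi> \<and>
     (\<forall>F. square_integrable F \<longrightarrow>
        ((\<lambda>S. L2_norm (\<lambda>y. F y - (\<Sum>(j, \<iota>)\<in>S. stft_L2 \<phi> F (j, \<iota>) * tf_shift_fun j \<iota> \<psi> y)))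
           \<longlongrightarrow> 0) (finite_subsets_at_top (lattice_pts \<epsilon> \<times> lattice_pts \<epsilon>)))"

text \<open>The series \<open>\<phi>\<close> and \<open>\<psi>\<close> are identified with \<open>L\<^sup>2\<close> functions through their Hermite
  coefficients.\<close>

definition dual_window :: "real \<Rightarrow> ('d::finite) hermite_series \<Rightarrow> 'd hermite_series \<Rightarrow> bool" where
  "dual_window \<epsilon> \<phi> \<psi> \<longleftrightarrow> (\<exists>F G. square_integrable F \<and> hermite_coeff F = \<phi> \<and>
     square_integrable G \<and> hermite_coeff G = \<psi> \<and> gabor_dual_frames \<epsilon> F G)"

definition quasinorm_topology :: "'a::minus set \<Rightarrow> ('a \<Rightarrow> ennreal) \<Rightarrow> 'a topology" where
  "quasinorm_topology X N =
     topology (\<lambda>U. U \<subseteq> X \<and> (\<forall>f\<in>U. \<exists>e>0. \<forall>g\<in>X. N (g - f) < e \<longrightarrow> g \<in> U))"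

lemma openin_quasinorm_topology:
  "openin (quasinorm_topology X N) U \<longleftrightarrow>
     U \<subseteq> X \<and> (\<forall>f\<in>U. \<exists>e>0. \<forall>g\<in>X. N (g - f) < e \<longrightarrow> g \<in> U)"
proof -
  let ?P = "\<lambda>U. U \<subseteq> X \<and> (\<forall>f\<in>U. \<exists>e>0. \<forall>g\<in>X. N (g - f) < e \<longrightarrow> g \<in> U)"
  have "?P (S \<inter> T)" if S: "?P S" and T: "?P T" for S T
  proof (intro conjI ballI)
    show "S \<inter> T \<subseteq> X" using S by blast
    fix f assume f: "f \<in> S \<inter> T"
    obtain e1 where e1: "e1 > 0" "\<forall>g\<in>X. N (g - f) < e1 \<longrightarrow> g \<in> S" using S f by blast
    obtain e2 where e2: "e2 > 0" "\<forall>g\<in>X. N (g - f) < e2 \<longrightarrow> g \<in> T" using T f by blast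
    show "\<exists>e>0. \<forall>g\<in>X. N (g - f) < e \<longrightarrow> g \<in> S \<inter> T"
      using e1 e2 by (intro exI[of _ "min e1 e2"]) auto
  qed
  moreover have "?P (\<Union>K)" if K: "\<forall>S\<in>K. ?P S" for K
  proof (intro conjI ballI)
    show "\<Union>K \<subseteq> X" using K by blast
    fix f assume "f \<in> \<Union>K"
    then obtain S where S: "S \<in> K" "f \<in> S" by blast
    with K obtain e where "e > 0" "\<forall>g\<in>X. N (g - f) < e \<longrightarrow> g \<in> S" by blast
    with S show "\<exists>e>0. \<forall>g\<in>X. N (g - f) < e \<longrightarrow> g \<in> \<Union>K" by blast
  qed
  ultimately have "istopology ?P" unfolding istopology_def by blast
  then show ?thesis unfolding quasinorm_topology_def by (simp add: topology_inverse')
qed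

lemma topspace_quasinorm_topology: "topspace (quasinorm_topology X N) = X"
proof
  show "topspace (quasinorm_topology X N) \<subseteq> X"
    unfolding topspace_def openin_quasinorm_topology by blast
  have "openin (quasinorm_topology X N) X"
    unfolding openin_quasinorm_topology by (auto intro: exI[of _ 1])
  then show "X \<subseteq> topspace (quasinorm_topology X N)" by (rule openin_subset)
qed

end

theory Submission
  imports "HOL-Probability.Characteristic_Functions" Defs
begin

text \<open>Up to a unimodular factor and the Gaussian \<open>exp (- \<bar>z\<bar>\<^sup>2 / 4)\<close>, the transform \<open>V f\<close> of a formal Hermite
  series \<open>f\<close> with respect to the Gaussian window is a power series in \<open>cnj (x + \<i> \<xi>)\<close>. Monomials are
  orthogonal on balls, which gives the coefficients of \<open>f\<close> as ball integrals of \<open>V f\<close>, hence a mean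
  value inequality at the origin. As \<open>\<bar>V f\<bar>\<close> is covariant under time-frequency shifts, it holds
  everywhere, and also for the power \<open>r0\<close>. So \<open>\<psi> \<in> M\<^sup>r\<^sup>0\<close> forces the local suprema of
  \<open>\<bar>V \<psi>\<bar> v\<close> over lattice cells to be \<open>r0\<close>-summable, and \<open>\<bar>V (D c)\<bar>\<^sup>r\<^sup>0\<close> is dominated, cell by cell,
  by a discrete convolution of \<open>\<bar>c \<omega>\<bar>\<^sup>r\<^sup>0\<close> with a summable sequence. Jensen's inequality for the Young
  functions bounds the Orlicz modulars of such a convolution. Hermite functions lie in the predual
  space and separate its points, so the coefficientwise sum is the only candidate for the weak-star
  limit.\<close>

section \<open>Hermite functions and time-frequency shifts\<close>

text \<open>An element of \<open>pilipovic_dual\<close> is known only by its coefficients, so a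
  time-frequency shift acts on it through a matrix. Integration by parts gives recursions for the
  entries, and the generating function of a row turns them into multiplication by a linear factor;
  that is how covariance is proved without functions behind the series. Two obstacles shape the norm
  estimates. For r0 < 1 the triangle inequality is lost and only subadditivity of the power r0
  remains; since a quasi-Young function is a convex function of exactly this power, Jensen's
  inequality can be applied after that step. Moreover a Young function may jump to infinity, so the
  infimum in an Orlicz quasi-norm need not be attained and infinite sums do not pass through the
  function; factors 2 buy the missing room. The weights are only locally essentially bounded.
  \<omega> is never compared on a whole cell: moderateness moves it from z to a lattice point, and
  the price v is paid by the decay of \<psi>.\<close>

primrec hermite_poly :: "nat \<Rightarrow> real poly" where
  "hermite_poly 0 = 1"
| "hermite_poly (Suc n) = pderiv (hermite_poly n) - [:0, 2:] * hermite_poly n"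

lemma deriv_funpow_gauss:
  "(deriv ^^ n) (\<lambda>s. exp (- (s\<^sup>2))) = (\<lambda>t. poly (hermite_poly n) t * exp (- (t\<^sup>2)))"
proof (induction n)
  case (Suc n)
  have "((\<lambda>t. poly (hermite_poly n) t * exp (- (t\<^sup>2))) has_field_derivative
      poly (hermite_poly (Suc n)) t * exp (- (t\<^sup>2))) (at t)" for t :: real
    by (auto intro!: derivative_eq_intros simp: algebra_simps)
  then have "deriv (\<lambda>t. poly (hermite_poly n) t * exp (- (t\<^sup>2))) t =
      poly (hermite_poly (Suc n)) t * exp (- (t\<^sup>2))" for t
    by (rule DERIV_imp_deriv)
  then show ?case unfolding funpow.simps o_def Suc by (simp only: fun_eq_iff simp_thms)
qed simp

lemma pderiv_hermite_poly: "pderiv (hermite_poly (Suc n)) = smult (- 2 * real (Suc n)) (hermite_poly n)"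
proof (induction n)
  case 0
  then show ?case by (simp add: pderiv_diff pderiv_mult pderiv_pCons)
next
  case (Suc n)
  have "pderiv (hermite_poly (Suc (Suc n))) =
      pderiv (pderiv (hermite_poly (Suc n))) - pderiv ([:0, 2:] * hermite_poly (Suc n))"
    by (simp only: hermite_poly.simps pderiv_diff)
  also have "pderiv (pderiv (hermite_poly (Suc n))) = smult (- 2 * real (Suc n)) (pderiv (hermite_poly n))"
    unfolding Suc by (rule pderiv_smult)
  also have "pderiv ([:0, 2:] * hermite_poly (Suc n)) =
      [:0, 2:] * pderiv (hermite_poly (Suc n)) + hermite_poly (Suc n) * [:2:]"
    by (subst pderiv_mult) (simp add: pderiv_pCons)
  also note Suc
  finally show ?case by (simp add: algebra_simps poly_eq_poly_eq_iff[symmetric] fun_eq_iff)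
qed

text \<open>The factor (-1)^n cancels the sign of \<open>hermite_poly n\<close>, which is (-1)^n
  times the physicists' Hermite polynomial.\<close>

definition hermite_const :: "nat \<Rightarrow> real" where
  "hermite_const n = pi powr (- 1 / 4) * (- 1) ^ n / sqrt (2 ^ n * fact n)"

lemma hermite1_altdef: "hermite1 n t = hermite_const n * (poly (hermite_poly n) t * exp (- (t\<^sup>2) / 2))"
proof -
  have "exp (t\<^sup>2 / 2) * exp (- (t\<^sup>2)) = exp (- (t\<^sup>2) / 2)" by (simp flip: exp_add)
  then show ?thesis
    unfolding hermite1_def hermite_const_def deriv_funpow_gauss by (simp add: mult_ac)
qed

lemma hermite_const_Suc: "hermite_const (Suc n) * sqrt (2 * real (Suc n)) = - hermite_const n"
proof -
  have "sqrt (2 ^ Suc n * fact (Suc n)) = sqrt (2 ^ n * fact n) * sqrt (2 * real (Suc n))"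
    unfolding real_sqrt_mult[symmetric] by (simp add: algebra_simps)
  then show ?thesis unfolding hermite_const_def by (simp add: field_simps)
qed

lemma hermite1_0: "hermite1 0 t = pi powr (- 1 / 4) * exp (- (t\<^sup>2) / 2)"
  by (simp add: hermite1_altdef hermite_const_def)

text \<open>The derivative in raising form; the lowering form follows. In the integrations by parts
  below one factor is differentiated in each form, so that the multiples of t cancel up to the shift
  x.\<close>

lemma has_real_derivative_hermite1_creation:
  "(hermite1 n has_real_derivative t * hermite1 n t - sqrt (2 * real (Suc n)) * hermite1 (Suc n) t) (at t)"
proof -
  have 1: "((\<lambda>t. hermite_const n * (poly (hermite_poly n) t * exp (- (t\<^sup>2) / 2))) has_real_derivative
     hermite_const n * (poly (pderiv (hermite_poly n)) t - t * poly (hermite_poly n) t) * exp (- (t\<^sup>2) / 2)) (at t)"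
    by (auto intro!: derivative_eq_intros simp: algebra_simps)
  have "hermite_const n * (poly (pderiv (hermite_poly n)) t - t * poly (hermite_poly n) t) =
     t * hermite_const n * poly (hermite_poly n) t + hermite_const n * poly (hermite_poly (Suc n)) t"
    by (simp add: algebra_simps)
  also have "\<dots> = t * hermite_const n * poly (hermite_poly n) t
     - sqrt (2 * real (Suc n)) * hermite_const (Suc n) * poly (hermite_poly (Suc n)) t"
    using hermite_const_Suc[of n] by (simp add: algebra_simps)
  finally have e: "hermite_const n * (poly (pderiv (hermite_poly n)) t - t * poly (hermite_poly n) t) = \<dots>" .
  have "hermite_const n * (poly (pderiv (hermite_poly n)) t - t * poly (hermite_poly n) t) * exp (- (t\<^sup>2) / 2)
     = t * hermite1 n t - sqrt (2 * real (Suc n)) * hermite1 (Suc n) t"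
    unfolding e by (simp add: hermite1_altdef algebra_simps del: hermite_poly.simps)
  then show ?thesis using 1 by (simp add: hermite1_altdef[abs_def] del: hermite_poly.simps)
qed

text \<open>At n = 0 the truncated index n - 1 = 0 does no harm because its coefficient is sqrt 0.
  The same convention is used in every recursion with k - 1.\<close>

lemma has_real_derivative_hermite1_annihilation:
  "(hermite1 n has_real_derivative sqrt (2 * real n) * hermite1 (n - 1) t - t * hermite1 n t) (at t)"
proof (cases n)
  case 0
  show ?thesis unfolding 0
    by (auto intro!: derivative_eq_intros simp: hermite1_0[abs_def])
next
  case (Suc k)
  have 1: "((\<lambda>t. hermite_const n * (poly (hermite_poly n) t * exp (- (t\<^sup>2) / 2))) has_real_derivative
     hermite_const n * poly (pderiv (hermite_poly n)) t * exp (- (t\<^sup>2) / 2) - t * hermite1 n t) (at t)"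
    by (auto intro!: derivative_eq_intros simp: algebra_simps hermite1_altdef)
  have "hermite_const n * poly (pderiv (hermite_poly n)) t =
      (hermite_const n * sqrt (2 * real n)) * sqrt (2 * real n) * - poly (hermite_poly k) t"
    unfolding Suc pderiv_hermite_poly by (simp add: algebra_simps del: hermite_poly.simps)
  also have "\<dots> = sqrt (2 * real n) * hermite_const k * poly (hermite_poly k) t"
    using hermite_const_Suc[of k] unfolding Suc by (simp add: algebra_simps)
  finally show ?thesis using 1 by (simp add: hermite1_altdef[abs_def] Suc mult.assoc del: hermite_poly.simps)
qed

text \<open>Induction on the degree, for all s at once: the Gaussian is split into two halves, one
  absorbing the new factor t and the other the remaining polynomial.\<close>

lemma poly_times_gauss_bounded:
  fixes p :: "real poly"
  assumes "s > 0"
  shows "\<exists>C. \<forall>t. \<bar>poly p t\<bar> * exp (- s * t\<^sup>2) \<le> C"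
  using assms
proof (induction p arbitrary: s)
  case 0
  then show ?case by auto
next
  case (pCons a p)
  obtain C where C: "\<And>t. \<bar>poly p t\<bar> * exp (- (s/2) * t\<^sup>2) \<le> C"
    using pCons.IH[of "s/2"] pCons.prems by auto
  define K where "K = max 1 (2 / s)"
  have t: "\<bar>t\<bar> * exp (- (s/2) * t\<^sup>2) \<le> K" for t
  proof -
    have "\<bar>t\<bar> \<le> 1 + t\<^sup>2" using sum_squares_bound[of 1 "\<bar>t\<bar>"] by simp
    also have "\<dots> \<le> K * (1 + (s/2) * t\<^sup>2)"
    proof -
      have "1 * t\<^sup>2 \<le> (K * (s/2)) * t\<^sup>2"
        using pCons.prems by (intro mult_right_mono) (auto simp: K_def max_def field_simps)
      moreover have "1 \<le> K" by (simp add: K_def)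
      ultimately show ?thesis by (simp add: algebra_simps)
    qed
    also have "\<dots> \<le> K * exp ((s/2) * t\<^sup>2)"
      by (intro mult_left_mono exp_ge_add_one_self) (simp add: K_def)
    finally show ?thesis by (simp add: exp_minus field_simps)
  qed
  have "\<bar>poly (pCons a p) t\<bar> * exp (- s * t\<^sup>2) \<le> \<bar>a\<bar> + K * \<bar>C\<bar>" for t
  proof -
    have e: "exp (- s * t\<^sup>2) = exp (- (s/2) * t\<^sup>2) * exp (- (s/2) * t\<^sup>2)"
      by (simp flip: exp_add)
    have "\<bar>poly (pCons a p) t\<bar> * exp (- s * t\<^sup>2) \<le> (\<bar>a\<bar> + \<bar>t\<bar> * \<bar>poly p t\<bar>) * exp (- s * t\<^sup>2)"
      by (intro mult_right_mono) (auto simp: abs_mult[symmetric] intro: abs_triangle_ineq)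
    also have "\<dots> = \<bar>a\<bar> * exp (- s * t\<^sup>2) +
        (\<bar>t\<bar> * exp (- (s/2) * t\<^sup>2)) * (\<bar>poly p t\<bar> * exp (- (s/2) * t\<^sup>2))"
      unfolding e by (simp add: algebra_simps)
    also have "\<dots> \<le> \<bar>a\<bar> * 1 + K * \<bar>C\<bar>"
      using pCons.prems t[of t] C[of t] by (intro add_mono mult_mono) (auto simp: K_def)
    finally show ?thesis by simp
  qed
  then show ?case by blast
qed

lemma hermite1_bound: "\<exists>C\<ge>0. \<forall>t. \<bar>hermite1 n t\<bar> \<le> C * exp (- (t\<^sup>2) / 4)"
proof -
  obtain C where C: "\<And>t. \<bar>poly (hermite_poly n) t\<bar> * exp (- (1/4) * t\<^sup>2) \<le> C"
    using poly_times_gauss_bounded[of "1/4"] by auto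
  have "\<bar>hermite1 n t\<bar> \<le> (\<bar>hermite_const n\<bar> * C) * exp (- (t\<^sup>2) / 4)" for t
  proof -
    have "exp (- (t\<^sup>2) / 2) = exp (- (1/4) * t\<^sup>2) * exp (- (t\<^sup>2) / 4)" by (simp flip: exp_add)
    then have "\<bar>hermite1 n t\<bar> = \<bar>hermite_const n\<bar> * (\<bar>poly (hermite_poly n) t\<bar> * exp (- (1/4) * t\<^sup>2)) * exp (- (t\<^sup>2) / 4)"
      by (simp add: hermite1_altdef abs_mult)
    also have "\<dots> \<le> (\<bar>hermite_const n\<bar> * C) * exp (- (t\<^sup>2) / 4)"
      using C by (intro mult_right_mono mult_left_mono) auto
    finally show ?thesis .
  qed
  moreover have "0 \<le> C" using order.trans[OF _ C[of 0]] by simp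
  ultimately show ?thesis by (intro exI[of _ "\<bar>hermite_const n\<bar> * C"]) auto
qed

lemma continuous_on_hermite1 [continuous_intros]:
  "continuous_on A f \<Longrightarrow> continuous_on A (\<lambda>x. hermite1 n (f x))"
  unfolding hermite1_altdef by (intro continuous_intros) auto

lemma borel_measurable_hermite1 [measurable]: "hermite1 n \<in> borel_measurable borel"
  by (intro borel_measurable_continuous_onI continuous_intros)

lemma integrable_gauss_real:
  assumes "s > 0" shows "integrable lborel (\<lambda>t::real. exp (- s * t\<^sup>2))"
proof -
  define \<sigma> where "\<sigma> = 1 / sqrt (2 * s)"
  have \<sigma>: "\<sigma> > 0" "2 * \<sigma>\<^sup>2 = 1 / s" using assms by (auto simp: \<sigma>_def power_divide)
  have "integrable lborel (\<lambda>t. sqrt (2 * pi * \<sigma>\<^sup>2) * normal_density 0 \<sigma> t)"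
    using integrable_normal_moment[OF \<sigma>(1), of 0 0] by simp
  moreover have "sqrt (2 * pi * \<sigma>\<^sup>2) * normal_density 0 \<sigma> t = exp (- s * t\<^sup>2)" for t
    using \<sigma> assms by (simp add: normal_density_def mult_ac)
  ultimately show ?thesis by simp
qed

section \<open>Matrix entries of one-dimensional time-frequency shifts\<close>

lemma integrable_cis_hermite1_mult:
  "integrable lborel (\<lambda>t. cis (t * \<xi>) * complex_of_real (hermite1 n (t - x)) * complex_of_real (hermite1 k t))"
proof -
  obtain C where C: "C \<ge> 0" "\<And>t. \<bar>hermite1 n t\<bar> \<le> C * exp (- (t\<^sup>2) / 4)" using hermite1_bound by blast
  obtain D where D: "D \<ge> 0" "\<And>t. \<bar>hermite1 k t\<bar> \<le> D * exp (- (t\<^sup>2) / 4)" using hermite1_bound by blast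
  have C': "\<bar>hermite1 n t\<bar> \<le> C" for t
    by (rule order.trans[OF C(2)]) (use C(1) in \<open>simp add: mult_left_le\<close>)
  have "integrable lborel (\<lambda>t. C * D * exp (- (1/4) * t\<^sup>2))"
    by (intro integrable_mult_right integrable_gauss_real) simp
  moreover have "(\<lambda>t. cis (t * \<xi>) * complex_of_real (hermite1 n (t - x)) * complex_of_real (hermite1 k t))
       \<in> borel_measurable lborel"
    unfolding measurable_lborel2 by (intro borel_measurable_continuous_onI continuous_intros)
  moreover have "norm (cis (t * \<xi>) * complex_of_real (hermite1 n (t - x)) * complex_of_real (hermite1 k t))
       \<le> norm (C * D * exp (- (1/4) * t\<^sup>2))" for t
    using mult_mono[OF C'[of "t - x"] D(2)[of t]] C(1) D(1) by (simp add: norm_mult abs_mult)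
  ultimately show ?thesis by (rule Bochner_Integration.integrable_bound[OF _ _ AE_I2])
qed

text \<open>The entry of the shift by (x, \<xi>) from the n-th to the k-th Hermite function. Hermite
  functions are real, so no conjugate appears.\<close>

definition hermite_matrix :: "nat \<Rightarrow> nat \<Rightarrow> real \<Rightarrow> real \<Rightarrow> complex" where
  "hermite_matrix n k x \<xi> =
     (LINT t|lborel. cis (t * \<xi>) * complex_of_real (hermite1 n (t - x)) * complex_of_real (hermite1 k t))"

lemma integral_derivative_real_line_0:
  fixes F F' :: "real \<Rightarrow> complex"
  assumes "\<And>t. (F has_vector_derivative F' t) (at t)" "integrable lborel F'" "\<And>t. isCont F' t"
    "(F \<longlongrightarrow> 0) at_top" "(F \<longlongrightarrow> 0) at_bot"
  shows "(LINT t|lborel. F' t) = 0"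
proof -
  have "(LBINT t=-\<infinity>..\<infinity>. F' t) = 0 - 0"
    using assms
    by (intro interval_integral_FTC_integrable[where F=F])
       (auto simp: set_integrable_def einterval_def comp_def at_left_PInf at_right_MInf filterlim_filtermap)
  then show ?thesis by (simp add: interval_lebesgue_integral_def set_lebesgue_integral_def einterval_def)
qed

text \<open>The integrand is the derivative of a product that decays at both ends. The derivatives a
  and b are parameters, so that either the raising or the lowering form can be inserted.\<close>

lemma integral_derivative_cis_hermite1_mult:
  assumes "\<And>t. (hermite1 n has_real_derivative a t) (at t)"
    and "\<And>t. (hermite1 k has_real_derivative b t) (at t)"
    and "continuous_on UNIV a" "continuous_on UNIV b"
    and int: "integrable lborel (\<lambda>t. \<i> * complex_of_real \<xi> * cis (t * \<xi>) * hermite1 n (t - x) * hermite1 k t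
       + cis (t * \<xi>) * a (t - x) * hermite1 k t + cis (t * \<xi>) * hermite1 n (t - x) * b t)" (is "integrable _ ?F'")
  shows "(LINT t|lborel. \<i> * complex_of_real \<xi> * cis (t * \<xi>) * hermite1 n (t - x) * hermite1 k t
       + cis (t * \<xi>) * a (t - x) * hermite1 k t + cis (t * \<xi>) * hermite1 n (t - x) * b t) = 0"
proof -
  let ?F = "\<lambda>t. cis (t * \<xi>) * complex_of_real (hermite1 n (t - x)) * complex_of_real (hermite1 k t)"
  have dcis: "((\<lambda>t. cis (t * \<xi>)) has_vector_derivative \<i> * complex_of_real \<xi> * cis (t * \<xi>)) (at t)" for t
    unfolding cis_conv_exp
    by (auto intro!: derivative_eq_intros has_vector_derivative_real_field simp: mult_ac)
  have shift: "((\<lambda>t. hermite1 n (t - x)) has_real_derivative a (t - x)) (at t)" for t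
  proof -
    have "((\<lambda>t. t - x) has_real_derivative 1) (at t)" by (auto intro!: derivative_eq_intros)
    then have "((\<lambda>t. hermite1 n (t - x)) has_real_derivative a (t - x) * 1) (at t)"
      by (rule DERIV_chain2[where f = "hermite1 n" and g = "\<lambda>t. t - x", OF assms(1)])
    then show ?thesis by (simp only: mult_1_right)
  qed
  have "(?F has_vector_derivative ?F' t) (at t)" for t
  proof -
    have h: "((\<lambda>t. complex_of_real (hermite1 n (t - x))) has_vector_derivative complex_of_real (a (t - x))) (at t)"
      by (intro has_vector_derivative_of_real shift)
    have k: "((\<lambda>t. complex_of_real (hermite1 k t)) has_vector_derivative complex_of_real (b t)) (at t)"
      by (intro has_vector_derivative_of_real assms(2))
    from has_vector_derivative_mult[OF has_vector_derivative_mult[OF dcis h] k] show ?thesis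
      by (simp add: algebra_simps)
  qed
  moreover have "isCont ?F' t" for t
    by (rule continuous_on_interior[of UNIV])
       (auto intro!: continuous_intros continuous_on_compose2[OF assms(3)] continuous_on_compose2[OF assms(4)])
  moreover obtain C where C: "C \<ge> 0" "\<And>t. \<bar>hermite1 n t\<bar> \<le> C * exp (- (t\<^sup>2) / 4)" using hermite1_bound by blast
  obtain D where D: "D \<ge> 0" "\<And>t. \<bar>hermite1 k t\<bar> \<le> D * exp (- (t\<^sup>2) / 4)" using hermite1_bound by blast
  have C': "\<bar>hermite1 n t\<bar> \<le> C" for t
    by (rule order.trans[OF C(2)]) (use C(1) in \<open>simp add: mult_left_le\<close>)
  have bound: "norm (?F t) \<le> C * D * exp (- (t\<^sup>2) / 4)" for t
    using mult_mono[OF C'[of "t - x"] D(2)[of t]] C(1) D(1) by (simp add: norm_mult abs_mult)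
  have "((\<lambda>t::real. C * D * exp (- (t\<^sup>2) / 4)) \<longlongrightarrow> 0) at_top" by real_asymp
  then have "(?F \<longlongrightarrow> 0) at_top"
    by (rule Lim_null_comparison[OF always_eventually[OF allI[OF bound]]])
  moreover have "((\<lambda>t::real. C * D * exp (- (t\<^sup>2) / 4)) \<longlongrightarrow> 0) at_bot" by real_asymp
  then have "(?F \<longlongrightarrow> 0) at_bot"
    by (rule Lim_null_comparison[OF always_eventually[OF allI[OF bound]]])
  ultimately show ?thesis using int
    by (intro integral_derivative_real_line_0[where F="?F"])
qed

lemma hermite_matrix_Suc:
  "complex_of_real (sqrt (2 * real (Suc n))) * hermite_matrix (Suc n) k x \<xi> =
     complex_of_real (sqrt (2 * real k)) * hermite_matrix n (k - 1) x \<xi> + (\<i> * \<xi> - x) * hermite_matrix n k x \<xi>"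
proof -
  let ?a = "\<lambda>t. t * hermite1 n t - sqrt (2 * real (Suc n)) * hermite1 (Suc n) t"
  let ?b = "\<lambda>t. sqrt (2 * real k) * hermite1 (k - 1) t - t * hermite1 k t"
  let ?I = "\<lambda>n k t. cis (t * \<xi>) * complex_of_real (hermite1 n (t - x)) * complex_of_real (hermite1 k t)"
  have eq: "\<i> * complex_of_real \<xi> * cis (t * \<xi>) * hermite1 n (t - x) * hermite1 k t
       + cis (t * \<xi>) * ?a (t - x) * hermite1 k t + cis (t * \<xi>) * hermite1 n (t - x) * ?b t =
     (\<i> * \<xi> - x) * ?I n k t - complex_of_real (sqrt (2 * real (Suc n))) * ?I (Suc n) k t
       + complex_of_real (sqrt (2 * real k)) * ?I n (k - 1) t" for t
    by (simp add: algebra_simps)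
  have "(LINT t|lborel. \<i> * complex_of_real \<xi> * cis (t * \<xi>) * hermite1 n (t - x) * hermite1 k t
       + cis (t * \<xi>) * ?a (t - x) * hermite1 k t + cis (t * \<xi>) * hermite1 n (t - x) * ?b t) = 0"
    by (intro integral_derivative_cis_hermite1_mult has_real_derivative_hermite1_creation
          has_real_derivative_hermite1_annihilation continuous_intros)
       (unfold eq, intro Bochner_Integration.integrable_add Bochner_Integration.integrable_diff
          integrable_mult_right integrable_cis_hermite1_mult)
  also have "(LINT t|lborel. \<i> * complex_of_real \<xi> * cis (t * \<xi>) * hermite1 n (t - x) * hermite1 k t
       + cis (t * \<xi>) * ?a (t - x) * hermite1 k t + cis (t * \<xi>) * hermite1 n (t - x) * ?b t) =
     (\<i> * \<xi> - x) * hermite_matrix n k x \<xi> - complex_of_real (sqrt (2 * real (Suc n))) * hermite_matrix (Suc n) k x \<xi>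
       + complex_of_real (sqrt (2 * real k)) * hermite_matrix n (k - 1) x \<xi>"
    unfolding eq hermite_matrix_def
    by (simp add: integrable_cis_hermite1_mult del: of_nat_Suc of_real_sqrt)
  finally show ?thesis by (simp add: algebra_simps)
qed

text \<open>The roles of the two forms are exchanged here: the lowering form of the ground state has
  no lower term, which leaves a two-term recursion and hence a closed formula for the row n =
  0.\<close>

lemma hermite_matrix_0_Suc:
  "complex_of_real (sqrt (2 * real (Suc k))) * hermite_matrix 0 (Suc k) x \<xi> =
     (x + \<i> * \<xi>) * hermite_matrix 0 k x \<xi>"
proof -
  let ?a = "\<lambda>t. - t * hermite1 0 t"
  let ?b = "\<lambda>t. t * hermite1 k t - sqrt (2 * real (Suc k)) * hermite1 (Suc k) t"
  let ?I = "\<lambda>n k t. cis (t * \<xi>) * complex_of_real (hermite1 n (t - x)) * complex_of_real (hermite1 k t)"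
  have eq: "\<i> * complex_of_real \<xi> * cis (t * \<xi>) * hermite1 0 (t - x) * hermite1 k t
       + cis (t * \<xi>) * ?a (t - x) * hermite1 k t + cis (t * \<xi>) * hermite1 0 (t - x) * ?b t =
     (x + \<i> * \<xi>) * ?I 0 k t - complex_of_real (sqrt (2 * real (Suc k))) * ?I 0 (Suc k) t" for t
    by (simp add: algebra_simps)
  have da: "(hermite1 0 has_real_derivative ?a t) (at t)" for t
    using has_real_derivative_hermite1_annihilation[of 0 t] by simp
  have "(LINT t|lborel. \<i> * complex_of_real \<xi> * cis (t * \<xi>) * hermite1 0 (t - x) * hermite1 k t
       + cis (t * \<xi>) * ?a (t - x) * hermite1 k t + cis (t * \<xi>) * hermite1 0 (t - x) * ?b t) = 0"
    by (intro integral_derivative_cis_hermite1_mult has_real_derivative_hermite1_creation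
          da continuous_intros)
       (unfold eq, intro Bochner_Integration.integrable_add Bochner_Integration.integrable_diff
          integrable_mult_right integrable_cis_hermite1_mult)
  also have "(LINT t|lborel. \<i> * complex_of_real \<xi> * cis (t * \<xi>) * hermite1 0 (t - x) * hermite1 k t
       + cis (t * \<xi>) * ?a (t - x) * hermite1 k t + cis (t * \<xi>) * hermite1 0 (t - x) * ?b t) =
     (x + \<i> * \<xi>) * hermite_matrix 0 k x \<xi> - complex_of_real (sqrt (2 * real (Suc k))) * hermite_matrix 0 (Suc k) x \<xi>"
    unfolding eq hermite_matrix_def
    by (simp add: integrable_cis_hermite1_mult del: of_nat_Suc of_real_sqrt)
  finally show ?thesis by (simp add: algebra_simps)
qed

text \<open>The overlap of the one-dimensional Gaussian with its own shift, as
  \<open>hermite_matrix_0_0\<close> shows; the phase comes from recentring the product of the two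
  Gaussians at x/2.\<close>

definition coherent0 :: "real \<Rightarrow> real \<Rightarrow> complex" where
  "coherent0 x \<xi> = exp (complex_of_real (- (x\<^sup>2 + \<xi>\<^sup>2) / 4) + \<i> * complex_of_real (x * \<xi> / 2))"

lemma hermite_matrix_0_0: "hermite_matrix 0 0 x \<xi> = coherent0 x \<xi>"
proof -
  let ?c = "pi powr (- 1 / 4)"
  have cc: "?c * ?c = 1 / sqrt pi"
    by (simp flip: powr_add add: powr_minus powr_half_sqrt field_simps)
  have eq: "cis (t * \<xi>) * complex_of_real (hermite1 0 (t - x)) * complex_of_real (hermite1 0 t) =
     cis (t * \<xi>) * complex_of_real (exp (- (x\<^sup>2) / 4) / sqrt pi * exp (- ((t - x/2)\<^sup>2)))" for t
  proof -
    have "exp (- ((t-x)\<^sup>2) / 2) * exp (- (t\<^sup>2) / 2) = exp (- (x\<^sup>2) / 4) * exp (- ((t - x/2)\<^sup>2))"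
      by (simp add: power2_eq_square field_simps flip: exp_add)
    then have "hermite1 0 (t - x) * hermite1 0 t = exp (- (x\<^sup>2) / 4) / sqrt pi * exp (- ((t - x/2)\<^sup>2))"
    proof -
      assume *: "exp (- ((t-x)\<^sup>2) / 2) * exp (- (t\<^sup>2) / 2) = exp (- (x\<^sup>2) / 4) * exp (- ((t - x/2)\<^sup>2))"
      have "hermite1 0 (t - x) * hermite1 0 t = (?c * ?c) * (exp (- ((t-x)\<^sup>2) / 2) * exp (- (t\<^sup>2) / 2))"
        unfolding hermite1_0 by (simp only: mult_ac)
      then show ?thesis unfolding * cc by simp
    qed
    then show ?thesis by (simp flip: of_real_mult add: mult.assoc)
  qed
  have "hermite_matrix 0 0 x \<xi> = (LINT t|lborel. cis (t * \<xi>) *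
       complex_of_real (exp (- (x\<^sup>2) / 4) / sqrt pi * exp (- ((t - x/2)\<^sup>2))))"
    unfolding hermite_matrix_def eq ..
  \<comment> \<open>The substitution t = x/2 + s / sqrt 2 produces the standard normal density; what
    is left is its characteristic function at \<xi> / sqrt 2.\<close>
  also have "\<dots> = \<bar>1 / sqrt 2\<bar> *\<^sub>R (LINT s|lborel. cis ((x/2 + (1 / sqrt 2) * s) * \<xi>) *
       complex_of_real (exp (- (x\<^sup>2) / 4) / sqrt pi * exp (- ((x/2 + (1 / sqrt 2) * s - x/2)\<^sup>2))))"
    by (rule lborel_integral_real_affine) simp
  also have "(\<lambda>s. cis ((x/2 + (1 / sqrt 2) * s) * \<xi>) *
       complex_of_real (exp (- (x\<^sup>2) / 4) / sqrt pi * exp (- ((x/2 + (1 / sqrt 2) * s - x/2)\<^sup>2)))) =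
      (\<lambda>s. (cis (x * \<xi> / 2) * complex_of_real (exp (- (x\<^sup>2) / 4) * sqrt 2)) *
         (std_normal_density s *\<^sub>R iexp (\<xi> / sqrt 2 * s)))"
  proof
    fix s :: real
    have "iexp (\<xi> / sqrt 2 * s) = cis (\<xi> / sqrt 2 * s)" by (simp only: cis_conv_exp)
    then have 1: "cis ((x/2 + (1 / sqrt 2) * s) * \<xi>) = cis (x * \<xi> / 2) * iexp (\<xi> / sqrt 2 * s)"
      by (simp add: cis_mult algebra_simps)
    have 2: "((x/2 + (1 / sqrt 2) * s - x/2)\<^sup>2) = s\<^sup>2 / 2" by (simp add: power_divide)
    have 3: "exp (- (x\<^sup>2) / 4) / sqrt pi * exp (- (s\<^sup>2 / 2)) = exp (- (x\<^sup>2) / 4) * sqrt 2 * std_normal_density s"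
      by (simp add: std_normal_density_def real_sqrt_mult)
    show "cis ((x/2 + (1 / sqrt 2) * s) * \<xi>) *
       complex_of_real (exp (- (x\<^sup>2) / 4) / sqrt pi * exp (- ((x/2 + (1 / sqrt 2) * s - x/2)\<^sup>2))) =
       (cis (x * \<xi> / 2) * complex_of_real (exp (- (x\<^sup>2) / 4) * sqrt 2)) *
         (std_normal_density s *\<^sub>R iexp (\<xi> / sqrt 2 * s))"
      unfolding 1 2 3 by (simp add: scaleR_conv_of_real mult_ac)
  qed
  also have "(LINT s|lborel. (cis (x * \<xi> / 2) * complex_of_real (exp (- (x\<^sup>2) / 4) * sqrt 2)) *
         (std_normal_density s *\<^sub>R iexp (\<xi> / sqrt 2 * s))) =
     (cis (x * \<xi> / 2) * complex_of_real (exp (- (x\<^sup>2) / 4) * sqrt 2)) * char std_normal_distribution (\<xi> / sqrt 2)"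
  proof -
    have "char std_normal_distribution (\<xi> / sqrt 2) = (LINT s|lborel. std_normal_density s *\<^sub>R iexp (\<xi> / sqrt 2 * s))"
      unfolding char_def by (subst integral_density) auto
    then show ?thesis by (simp only: integral_mult_right_zero)
  qed
  also have "char std_normal_distribution (\<xi> / sqrt 2) = complex_of_real (exp (- (\<xi>\<^sup>2) / 4))"
    by (simp add: char_std_normal_distribution power_divide)
  finally have "hermite_matrix 0 0 x \<xi> = cis (x * \<xi> / 2) * complex_of_real (exp (- (x\<^sup>2) / 4) * exp (- (\<xi>\<^sup>2) / 4))"
    by (simp add: scaleR_conv_of_real)
  also have "exp (- (x\<^sup>2) / 4) * exp (- (\<xi>\<^sup>2) / 4) = exp (- (x\<^sup>2 + \<xi>\<^sup>2) / 4)"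
    by (simp add: add_divide_distrib flip: exp_add)
  finally show ?thesis
    unfolding coherent0_def exp_add cis_conv_exp by (simp flip: exp_of_real)
qed

text \<open>Fubini for products of one-variable functions. Lebesgue measure is the image of a
  product measure indexed by \<open>Basis\<close>, so coordinates are renamed along i to
  \<open>axis i 1\<close>.\<close>

lemma
  fixes f :: "'d::finite \<Rightarrow> real \<Rightarrow> 'b::{real_normed_field,banach,second_countable_topology}"
  assumes "\<And>i. integrable lborel (f i)"
  shows integral_lborel_vec_prod:
      "(LINT y|lborel. (\<Prod>i\<in>UNIV. f i ((y :: real ^ 'd) $ i))) = (\<Prod>i\<in>UNIV. (LINT t|lborel. f i t))"
    and integrable_lborel_vec_prod: "integrable lborel (\<lambda>y :: real ^ 'd. \<Prod>i\<in>UNIV. f i (y $ i))"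
proof -
  interpret product_sigma_finite "\<lambda>b :: real ^ 'd. lborel :: real measure" by standard
  have B: "(Basis :: (real ^ 'd) set) = range (\<lambda>i. axis i 1)" by (auto simp: Basis_vec_def)
  have inj: "inj (\<lambda>i::'d. axis i (1::real))" by (auto simp: inj_on_def axis_eq_axis)
  let ?T = "\<lambda>g. \<Sum>b\<in>Basis. g b *\<^sub>R b :: real ^ 'd"
  have T: "?T g $ i = g (axis i 1)" for g i
  proof -
    have "?T g $ i = ?T g \<bullet> axis i 1" by (simp add: inner_axis)
    also have "\<dots> = g (axis i 1)" by (rule inner_sum_left_Basis) (simp add: B)
    finally show ?thesis .
  qed
  have [measurable]: "f i \<in> borel_measurable borel" for i using assms[of i] by auto
  have eq: "(\<Prod>i\<in>UNIV. f i (?T g $ i)) = (\<Prod>b\<in>Basis. f (axis_index b) (g b))" for g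
    unfolding T by (simp add: B prod.reindex[OF inj])
  have Tm: "?T \<in> measurable (\<Pi>\<^sub>M b\<in>Basis. lborel) borel" by measurable
  have "(LINT y|lborel. (\<Prod>i\<in>UNIV. f i ((y :: real ^ 'd) $ i))) =
      (LINT g|(\<Pi>\<^sub>M b\<in>(Basis :: (real ^ 'd) set). lborel). (\<Prod>i\<in>UNIV. f i (?T g $ i)))"
    by (subst lborel_eq, rule integral_distr[OF Tm]) measurable
  also have "\<dots> = (\<Prod>b\<in>(Basis :: (real ^ 'd) set). (LINT t|lborel. f (axis_index b) t))"
    unfolding eq by (rule product_integral_prod) (use assms in auto)
  also have "\<dots> = (\<Prod>i\<in>UNIV. (LINT t|lborel. f i t))"
    unfolding B by (subst prod.reindex[OF inj]) simp
  finally show "(LINT y|lborel. (\<Prod>i\<in>UNIV. f i ((y :: real ^ 'd) $ i))) = (\<Prod>i\<in>UNIV. (LINT t|lborel. f i t))" .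
  have "integrable (\<Pi>\<^sub>M b\<in>(Basis :: (real ^ 'd) set). lborel) (\<lambda>g. \<Prod>i\<in>UNIV. f i (?T g $ i))"
    unfolding eq by (rule product_integrable_prod) (use assms in auto)
  then show "integrable lborel (\<lambda>y :: real ^ 'd. \<Prod>i\<in>UNIV. f i (y $ i))"
    by (subst lborel_eq, subst integrable_distr_eq[OF Tm]) measurable
qed

lemma hermite_coeff_tf_shift_hermite:
  fixes x \<xi> :: "real ^ 'd::finite"
  shows "hermite_coeff (tf_shift_fun x \<xi> (\<lambda>y. complex_of_real (hermite \<beta> y))) \<alpha> =
     (\<Prod>i\<in>UNIV. hermite_matrix (\<beta> i) (\<alpha> i) (x $ i) (\<xi> $ i))"
proof -
  let ?f = "\<lambda>i t. cis (t * \<xi> $ i) * complex_of_real (hermite1 (\<beta> i) (t - x $ i)) * complex_of_real (hermite1 (\<alpha> i) t)"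
  have cis: "cis (y \<bullet> \<xi>) = (\<Prod>i\<in>UNIV. cis (y $ i * \<xi> $ i))" for y :: "real ^ 'd"
    unfolding cis_conv_exp by (simp add: inner_vec_def exp_sum[symmetric] sum_distrib_left)
  have eq: "tf_shift_fun x \<xi> (\<lambda>y. complex_of_real (hermite \<beta> y)) y * complex_of_real (hermite \<alpha> y) =
      (\<Prod>i\<in>UNIV. ?f i (y $ i))" for y
    by (simp add: tf_shift_fun_def hermite_def cis prod.distrib)
  have "hermite_coeff (tf_shift_fun x \<xi> (\<lambda>y. complex_of_real (hermite \<beta> y))) \<alpha> =
      (LINT y|lborel. (\<Prod>i\<in>UNIV. ?f i (y $ i)))"
    unfolding hermite_coeff_def eq
    by (rule integral_completion)
       (use integrable_lborel_vec_prod[of ?f, OF integrable_cis_hermite1_mult] in auto)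
  also have "\<dots> = (\<Prod>i\<in>UNIV. (LINT t|lborel. ?f i t))"
    by (intro integral_lborel_vec_prod integrable_cis_hermite1_mult)
  finally show ?thesis by (simp add: hermite_matrix_def)
qed

lemma gauss_eq_hermite: "gauss = (\<lambda>y :: real ^ 'd::finite. complex_of_real (hermite (\<lambda>_. 0) y))"
proof
  fix y :: "real ^ 'd"
  have "hermite (\<lambda>_. 0) y = (pi powr (- 1 / 4)) ^ CARD('d) * exp (\<Sum>i\<in>UNIV. - ((y $ i)\<^sup>2) / 2)"
    by (simp add: hermite_def hermite1_0 prod.distrib exp_sum)
  also have "(\<Sum>i\<in>UNIV. - ((y $ i)\<^sup>2) / 2) = - ((norm y)\<^sup>2) / 2"
    unfolding power2_norm_eq_inner by (simp add: inner_vec_def power2_eq_square sum_divide_distrib sum_negf)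
  also have "(pi powr (- 1 / 4)) ^ CARD('d) = pi powr (- real CARD('d) / 4)"
    by (simp add: powr_realpow[symmetric] powr_powr)
  finally show "gauss y = complex_of_real (hermite (\<lambda>_. 0) y)" by (simp add: gauss_def)
qed

text \<open>Stated over a general field because it is applied both to \<open>hermite_matrix\<close> and to its real majorant.\<close>

lemma weyl_recursion_sums:
  fixes m :: "nat \<Rightarrow> nat \<Rightarrow> 'a::{real_normed_field, banach}"
  assumes 0: "\<And>k. m 0 k = \<kappa> * w ^ k / of_real (sqrt (fact k))"
    and Suc: "\<And>n k. of_real (sqrt (Suc n)) * m (Suc n) k = of_real (sqrt k) * m n (k - 1) + u * m n k"
  shows "(\<lambda>k. m n k * s ^ k / of_real (sqrt (fact k))) sums
    (\<kappa> * exp (w * s) * (s + u) ^ n / of_real (sqrt (fact n)))"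
proof (induction n)
  case 0
  have "(\<lambda>k. \<kappa> * ((w * s) ^ k /\<^sub>R fact k)) sums (\<kappa> * exp (w * s))"
    by (intro sums_mult exp_converges)
  moreover have "m 0 k * s ^ k / of_real (sqrt (fact k)) = \<kappa> * ((w * s) ^ k /\<^sub>R fact k)" for k
  proof -
    have "of_real (sqrt (fact k)) * of_real (sqrt (fact k)) = (of_real (fact k) :: 'a)"
      by (simp flip: of_real_mult)
    then show ?thesis
      unfolding assms(1) by (simp add: power_mult_distrib scaleR_conv_of_real divide_inverse mult_ac flip: inverse_mult_distrib)
  qed
  ultimately show ?case by simp
next
  case (Suc n)
  let ?t = "\<lambda>n k. m n k * s ^ k / of_real (sqrt (fact k))"
  let ?S = "\<kappa> * exp (w * s) * (s + u) ^ n / of_real (sqrt (fact n))"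
  \<comment> \<open>The term k = 0 vanishes because of sqrt k, so an index shift extracts one factor
    s. Together with the second term of the recursion this multiplies the sum by s + u.\<close>
  have s1: "(\<lambda>k. of_real (sqrt k) * m n (k - 1) * s ^ k / of_real (sqrt (fact k))) sums (s * ?S)" (is "?g sums _")
  proof -
    have "?g (Suc j) = s * ?t n j" for j
    proof -
      have "sqrt (fact (Suc j)) = sqrt (Suc j) * sqrt (fact j)" by (simp add: real_sqrt_mult[symmetric])
      then show ?thesis by (simp add: field_simps del: of_nat_Suc fact_Suc)
    qed
    then have "(\<lambda>j. ?g (Suc j)) sums (s * ?S)" using sums_mult[OF Suc, of s] by simp
    then show ?thesis using sums_Suc_iff[of ?g "s * ?S"] by simp
  qed
  have "(\<lambda>k. (?g k + u * ?t n k) / of_real (sqrt (Suc n))) sums ((s * ?S + u * ?S) / of_real (sqrt (Suc n)))"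
    by (intro sums_divide sums_add s1 sums_mult Suc)
  moreover have "(?g k + u * ?t n k) / of_real (sqrt (Suc n)) = ?t (Suc n) k" for k
  proof -
    have "?g k + u * ?t n k = (of_real (sqrt k) * m n (k - 1) + u * m n k) * s ^ k / of_real (sqrt (fact k))"
      by (simp add: algebra_simps add_divide_distrib)
    also have "\<dots> = of_real (sqrt (Suc n)) * ?t (Suc n) k"
      unfolding assms(2)[symmetric] by simp
    finally show ?thesis by simp
  qed
  moreover have "(s * ?S + u * ?S) / of_real (sqrt (Suc n)) =
     \<kappa> * exp (w * s) * (s + u) ^ Suc n / of_real (sqrt (fact (Suc n)))"
  proof -
    have "sqrt (fact (Suc n)) = sqrt (Suc n) * sqrt (fact n)" by (simp add: real_sqrt_mult[symmetric])
    then show ?thesis by (simp add: field_simps del: of_nat_Suc fact_Suc)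
  qed
  ultimately show ?case by simp
qed

text \<open>The Bargmann normalization: with w the phase point, \<open>coherent0\<close> has modulus
  exp (- \<bar>w\<bar>^2 / 2).\<close>

definition phase_point :: "real \<Rightarrow> real \<Rightarrow> complex" where
  "phase_point x \<xi> = Complex x \<xi> / complex_of_real (sqrt 2)"

lemma hermite_matrix_0: "hermite_matrix 0 k x \<xi> = coherent0 x \<xi> * phase_point x \<xi> ^ k / complex_of_real (sqrt (fact k))"
proof (induction k)
  case (Suc k)
  have "sqrt (2 * real (Suc k)) = sqrt 2 * sqrt (Suc k)" by (simp add: real_sqrt_mult[symmetric])
  then have "hermite_matrix 0 (Suc k) x \<xi> =
     (x + \<i> * \<xi>) / complex_of_real (sqrt 2) * hermite_matrix 0 k x \<xi> / complex_of_real (sqrt (Suc k))"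
    using hermite_matrix_0_Suc[of k x \<xi>] by (simp add: field_simps del: of_nat_Suc)
  also have "(x + \<i> * \<xi>) / complex_of_real (sqrt 2) = phase_point x \<xi>"
    by (simp add: phase_point_def complex_eq_iff)
  finally have "hermite_matrix 0 (Suc k) x \<xi> = phase_point x \<xi> * hermite_matrix 0 k x \<xi> / complex_of_real (sqrt (Suc k))" .
  moreover have "sqrt (fact (Suc k)) = sqrt (Suc k) * sqrt (fact k)" by (simp add: real_sqrt_mult[symmetric])
  ultimately show ?case using Suc by (simp add: mult_ac del: of_nat_Suc fact_Suc)
qed (simp add: hermite_matrix_0_0)

lemma hermite_matrix_recursion:
  "complex_of_real (sqrt (Suc n)) * hermite_matrix (Suc n) k x \<xi> =
     complex_of_real (sqrt k) * hermite_matrix n (k - 1) x \<xi> + (- cnj (phase_point x \<xi>)) * hermite_matrix n k x \<xi>"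
proof -
  have 1: "complex_of_real (sqrt (2 * real j)) = complex_of_real (sqrt 2) * complex_of_real (sqrt j)" for j
    by (simp add: real_sqrt_mult flip: of_real_mult)
  have "\<i> * \<xi> - x = complex_of_real (sqrt 2) * (- cnj (phase_point x \<xi>))"
    by (simp add: phase_point_def complex_eq_iff)
  then have "complex_of_real (sqrt 2) * (complex_of_real (sqrt (Suc n)) * hermite_matrix (Suc n) k x \<xi>) =
    complex_of_real (sqrt 2) * (complex_of_real (sqrt k) * hermite_matrix n (k - 1) x \<xi> + (- cnj (phase_point x \<xi>)) * hermite_matrix n k x \<xi>)"
    using hermite_matrix_Suc[of n k x \<xi>] unfolding 1 by (simp only: distrib_left mult.assoc)
  then show ?thesis by (simp del: of_nat_Suc)
qed

text \<open>The recursion of \<open>hermite_matrix\<close> with all signs made positive.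
  \<open>weyl_recursion_sums\<close> evaluates its generating function as well, which yields
  absolute convergence with an explicit bound and no estimate of single entries.\<close>

primrec hermite_majorant :: "real \<Rightarrow> real \<Rightarrow> nat \<Rightarrow> nat \<Rightarrow> real" where
  "hermite_majorant \<kappa> w 0 = (\<lambda>k. \<kappa> * w ^ k / sqrt (fact k))"
| "hermite_majorant \<kappa> w (Suc n) =
    (\<lambda>k. (sqrt k * hermite_majorant \<kappa> w n (k - 1) + w * hermite_majorant \<kappa> w n k) / sqrt (Suc n))"

lemma norm_hermite_matrix_le:
  "norm (hermite_matrix n k x \<xi>) \<le> hermite_majorant (norm (coherent0 x \<xi>)) (norm (phase_point x \<xi>)) n k"
proof (induction n arbitrary: k)
  case 0
  then show ?case by (simp add: hermite_matrix_0 norm_mult norm_divide norm_power)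
next
  case (Suc n)
  let ?h = "hermite_majorant (norm (coherent0 x \<xi>)) (norm (phase_point x \<xi>))"
  have "norm (complex_of_real (sqrt (Suc n)) * hermite_matrix (Suc n) k x \<xi>) \<le>
     sqrt k * norm (hermite_matrix n (k - 1) x \<xi>) + norm (phase_point x \<xi>) * norm (hermite_matrix n k x \<xi>)"
    unfolding hermite_matrix_recursion by (rule order.trans[OF norm_triangle_ineq]) (simp add: norm_mult)
  also have "\<dots> \<le> sqrt k * ?h n (k - 1) + norm (phase_point x \<xi>) * ?h n k"
    by (intro add_mono mult_left_mono Suc) auto
  finally show ?case by (simp add: norm_mult field_simps del: of_nat_Suc)
qed

lemma hermite_matrix_abs_sum:
  assumes "S \<ge> 0"
  shows "(\<lambda>k. norm (hermite_matrix n k x \<xi>) * S ^ k / sqrt (fact k)) summable_on UNIV"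
    and "(\<Sum>\<^sub>\<infinity>k. norm (hermite_matrix n k x \<xi>) * S ^ k / sqrt (fact k)) \<le>
      norm (coherent0 x \<xi>) * exp (norm (phase_point x \<xi>) * S) * (S + norm (phase_point x \<xi>)) ^ n / sqrt (fact n)"
proof -
  let ?h = "hermite_majorant (norm (coherent0 x \<xi>)) (norm (phase_point x \<xi>))"
  let ?R = "norm (coherent0 x \<xi>) * exp (norm (phase_point x \<xi>) * S) * (S + norm (phase_point x \<xi>)) ^ n / sqrt (fact n)"
  have "(\<lambda>k. ?h n k * S ^ k / of_real (sqrt (fact k))) sums
    (norm (coherent0 x \<xi>) * exp (norm (phase_point x \<xi>) * S) * (S + norm (phase_point x \<xi>)) ^ n / of_real (sqrt (fact n)))"
    by (rule weyl_recursion_sums) auto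
  then have s: "(\<lambda>k. ?h n k * S ^ k / sqrt (fact k)) sums ?R" by simp
  have le: "norm (hermite_matrix n k x \<xi>) * S ^ k / sqrt (fact k) \<le> ?h n k * S ^ k / sqrt (fact k)" for k
    using assms by (intro divide_right_mono mult_right_mono norm_hermite_matrix_le) auto
  have "?h n k * S ^ k / sqrt (fact k) \<ge> 0" for k
    by (rule order.trans[OF _ le]) (use assms in simp)
  then have hs: "((\<lambda>k. ?h n k * S ^ k / sqrt (fact k)) has_sum ?R) UNIV"
    by (intro sums_nonneg_imp_has_sum s)
  show 1: "(\<lambda>k. norm (hermite_matrix n k x \<xi>) * S ^ k / sqrt (fact k)) summable_on UNIV"
    by (rule summable_on_comparison_test[OF has_sum_imp_summable[OF hs]]) (use le assms in auto)
  show "(\<Sum>\<^sub>\<infinity>k. norm (hermite_matrix n k x \<xi>) * S ^ k / sqrt (fact k)) \<le> ?R"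
    using infsum_mono[OF 1 has_sum_imp_summable[OF hs] le] hs by (simp add: infsumI)
qed

text \<open>At s the conjugate of a phase point this is the shift tested against a coherent state:
  the factor s - cnj w is the conjugate of a difference of phase points, the source of
  covariance.\<close>

lemma hermite_matrix_infsum:
  "(\<Sum>\<^sub>\<infinity>k. hermite_matrix n k x \<xi> * s ^ k / complex_of_real (sqrt (fact k))) =
     coherent0 x \<xi> * exp (phase_point x \<xi> * s) * (s - cnj (phase_point x \<xi>)) ^ n / complex_of_real (sqrt (fact n))"
proof (rule infsumI, rule norm_summable_imp_has_sum)
  have "(\<lambda>k. hermite_matrix n k x \<xi> * s ^ k / of_real (sqrt (fact k))) sums
     (coherent0 x \<xi> * exp (phase_point x \<xi> * s) * (s + (- cnj (phase_point x \<xi>))) ^ n / of_real (sqrt (fact n)))"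
    by (rule weyl_recursion_sums) (simp_all add: hermite_matrix_0 hermite_matrix_recursion del: of_nat_Suc)
  then show "(\<lambda>k. hermite_matrix n k x \<xi> * s ^ k / complex_of_real (sqrt (fact k))) sums
     (coherent0 x \<xi> * exp (phase_point x \<xi> * s) * (s - cnj (phase_point x \<xi>)) ^ n / complex_of_real (sqrt (fact n)))"
    by simp
  show "summable (\<lambda>k. norm (hermite_matrix n k x \<xi> * s ^ k / complex_of_real (sqrt (fact k))))"
    using hermite_matrix_abs_sum(1)[of "norm s" n x \<xi>, THEN summable_on_imp_summable]
    by (simp add: norm_mult norm_divide norm_power)
qed

lemma
  fixes f :: "'d::finite \<Rightarrow> nat \<Rightarrow> 'b::{real_normed_field,banach,second_countable_topology}"
  assumes "\<And>i. (\<lambda>k. norm (f i k)) summable_on UNIV"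
  shows summable_on_prod_multi_index: "(\<lambda>\<alpha>. norm (\<Prod>i\<in>UNIV. f i (\<alpha> i))) summable_on UNIV"
    and infsum_prod_multi_index: "(\<Sum>\<^sub>\<infinity>\<alpha>. \<Prod>i\<in>UNIV. f i (\<alpha> i)) = (\<Prod>i\<in>UNIV. \<Sum>\<^sub>\<infinity>k. f i k)"
proof -
  have U: "PiE UNIV (\<lambda>_. UNIV) = (UNIV :: ('d \<Rightarrow> nat) set)" by (auto simp: PiE_def)
  show "(\<Sum>\<^sub>\<infinity>\<alpha>. \<Prod>i\<in>UNIV. f i (\<alpha> i)) = (\<Prod>i\<in>UNIV. \<Sum>\<^sub>\<infinity>k. f i k)"
    using infsum_prod_PiE_abs[of "UNIV :: 'd set" f "\<lambda>_. UNIV"] assms by (simp add: U)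
  have "Infinite_Set_Sum.abs_summable_on (\<lambda>g. \<Prod>x\<in>UNIV. f x (g x)) (PiE UNIV (\<lambda>_. UNIV))"
    by (rule Infinite_Set_Sum.abs_summable_on_prod_PiE) (use assms in \<open>auto simp flip: abs_summable_equivalent\<close>)
  then show "(\<lambda>\<alpha>. norm (\<Prod>i\<in>UNIV. f i (\<alpha> i))) summable_on UNIV"
    unfolding U abs_summable_equivalent[symmetric] .
qed

section \<open>Formal Hermite series and their Gaussian transform\<close>

lemma sqrt_prod: "sqrt (\<Prod>i\<in>A. f i) = (\<Prod>i\<in>A. sqrt (f i))"
  by (induction A rule: infinite_finite_induct) (auto simp: real_sqrt_mult)

text \<open>With s = 1/r, the reciprocal of the growth allowed in \<open>pilipovic_dual\<close>:
  membership means boundedness against \<open>monomial_weight s\<close> for every s > 0. It also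
  dominates the coherent state coefficients on the ball of radius s.\<close>

definition monomial_weight :: "real \<Rightarrow> ('d::finite \<Rightarrow> nat) \<Rightarrow> real" where
  "monomial_weight s \<alpha> = (\<Prod>i\<in>UNIV. s ^ \<alpha> i / sqrt (fact (\<alpha> i)))"

lemma monomial_weight_nonneg: "s \<ge> 0 \<Longrightarrow> monomial_weight s \<alpha> \<ge> 0"
  unfolding monomial_weight_def by (intro prod_nonneg) auto

lemma monomial_weight_pos: "s > 0 \<Longrightarrow> monomial_weight s \<alpha> > 0"
  unfolding monomial_weight_def by (intro prod_pos) auto

lemma monomial_weight_mono: "0 \<le> s \<Longrightarrow> s \<le> t \<Longrightarrow> monomial_weight s \<alpha> \<le> monomial_weight t \<alpha>"
  unfolding monomial_weight_def by (intro prod_mono) (auto intro!: divide_right_mono power_mono)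

lemma monomial_weight_altdef:
  "monomial_weight s \<alpha> = s ^ (\<Sum>i\<in>UNIV. \<alpha> i) / sqrt (\<Prod>i\<in>UNIV. fact (\<alpha> i))"
  by (simp add: monomial_weight_def prod_dividef power_sum sqrt_prod)

lemma pilipovic_dual_iff:
  "f \<in> pilipovic_dual \<longleftrightarrow> (\<forall>s>0. \<exists>C. \<forall>\<alpha>. norm (f \<alpha>) * monomial_weight s \<alpha> \<le> C)"
proof -
  have 1: "norm (f \<alpha>) \<le> C * (r ^ (\<Sum>i\<in>UNIV. \<alpha> i) * sqrt (\<Prod>i\<in>UNIV. fact (\<alpha> i))) \<longleftrightarrow>
      norm (f \<alpha>) * monomial_weight (1 / r) \<alpha> \<le> C" if "r > 0" for r C \<alpha>
    using that by (simp add: monomial_weight_altdef field_simps prod_pos power_one_over)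
  have "f \<in> pilipovic_dual \<longleftrightarrow> (\<forall>r>0. \<exists>C. \<forall>\<alpha>. norm (f \<alpha>) * monomial_weight (1 / r) \<alpha> \<le> C)"
    unfolding pilipovic_dual_def using 1 by simp
  also have "\<dots> \<longleftrightarrow> (\<forall>s>0. \<exists>C. \<forall>\<alpha>. norm (f \<alpha>) * monomial_weight s \<alpha> \<le> C)"
  proof safe
    fix s :: real assume s: "s > 0" and *: "\<forall>r>0. \<exists>C. \<forall>\<alpha>. norm (f \<alpha>) * monomial_weight (1 / r) \<alpha> \<le> C"
    from *[rule_format, of "1 / s"] s show "\<exists>C. \<forall>\<alpha>. norm (f \<alpha>) * monomial_weight s \<alpha> \<le> C" by simp
  qed simp
  finally show ?thesis .
qed

text \<open>Boundedness at a parameter t with s \<le> t / 2 leaves a factor 2^(-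
  \<bar>\<alpha>\<bar>), which is summable over multi-indices. The summand 1 in t keeps t positive
  at s = 0.\<close>

lemma pilipovic_dual_summable:
  assumes "f \<in> pilipovic_dual" "s \<ge> 0"
  shows "(\<lambda>\<alpha>. norm (f \<alpha>) * monomial_weight s \<alpha>) summable_on UNIV"
proof -
  define t where "t = 2 * s + 1"
  have t: "t > 0" "s \<le> t / 2" using assms(2) by (auto simp: t_def)
  obtain C where C: "\<And>\<alpha>. norm (f \<alpha>) * monomial_weight t \<alpha> \<le> C"
    using assms(1) t(1) unfolding pilipovic_dual_iff by blast
  have geom: "(\<lambda>\<alpha>. norm (\<Prod>i\<in>UNIV. (1/2::real) ^ \<alpha> i)) summable_on (UNIV :: ('a \<Rightarrow> nat) set)"
    by (rule summable_on_prod_multi_index) (simp add: summable_on_UNIV_nonneg_real_iff summable_geometric)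
  then have "(\<lambda>\<alpha>. C * norm (\<Prod>i\<in>UNIV. (1/2::real) ^ \<alpha> i)) summable_on (UNIV :: ('a \<Rightarrow> nat) set)"
    by (rule summable_on_cmult_right)
  then show ?thesis
  proof (rule summable_on_comparison_test)
    fix \<alpha> :: "'a \<Rightarrow> nat"
    have "monomial_weight s \<alpha> \<le> monomial_weight (t / 2) \<alpha>" by (rule monomial_weight_mono) (use assms t in auto)
    also have "monomial_weight (t / 2) \<alpha> = monomial_weight t \<alpha> * (\<Prod>i\<in>UNIV. (1/2) ^ \<alpha> i)"
      unfolding monomial_weight_def prod.distrib[symmetric] by (simp add: power_divide mult.commute)
    finally have "norm (f \<alpha>) * monomial_weight s \<alpha> \<le> (norm (f \<alpha>) * monomial_weight t \<alpha>) * (\<Prod>i\<in>UNIV. (1/2) ^ \<alpha> i)"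
      by (simp add: mult.assoc mult_left_mono)
    also have "\<dots> \<le> C * norm (\<Prod>i\<in>UNIV. (1/2::real) ^ \<alpha> i)"
      using C by (intro mult_mono) (auto intro!: prod_nonneg order.trans[OF _ C[of \<alpha>]] monomial_weight_nonneg less_imp_le[OF t(1)] mult_nonneg_nonneg)
    finally show "norm (f \<alpha>) * monomial_weight s \<alpha> \<le> C * norm (\<Prod>i\<in>UNIV. (1/2::real) ^ \<alpha> i)" .
  next
    fix \<alpha> :: "'a \<Rightarrow> nat"
    show "0 \<le> norm (f \<alpha>) * monomial_weight s \<alpha>"
      by (intro mult_nonneg_nonneg norm_ge_zero monomial_weight_nonneg assms(2))
  qed
qed

section \<open>Coherent states and the series of the Gaussian transform\<close>

lemma norm_coherent0: "norm (coherent0 x \<xi>) = exp (- (x\<^sup>2 + \<xi>\<^sup>2) / 4)"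
  unfolding coherent0_def norm_exp_eq_Re by simp

lemma norm_phase_point_power2: "(norm (phase_point x \<xi>))\<^sup>2 = (x\<^sup>2 + \<xi>\<^sup>2) / 2"
  by (simp add: phase_point_def norm_divide power_divide cmod_power2)

lemma norm_phase_point_le:
  fixes z :: "(real ^ 'd::finite) \<times> (real ^ 'd)"
  shows "norm (phase_point (fst z $ i) (snd z $ i)) \<le> norm z / sqrt 2"
proof (rule power2_le_imp_le)
  have "(fst z $ i)\<^sup>2 \<le> (norm (fst z))\<^sup>2" "(snd z $ i)\<^sup>2 \<le> (norm (snd z))\<^sup>2"
    using component_le_norm_cart[of "fst z" i] component_le_norm_cart[of "snd z" i]
    by (auto simp: abs_le_square_iff[symmetric])
  then show "(norm (phase_point (fst z $ i) (snd z $ i)))\<^sup>2 \<le> (norm z / sqrt 2)\<^sup>2"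
    unfolding norm_phase_point_power2 by (simp add: norm_prod_def power_divide)
qed simp

lemma norm_phase_point_le':
  fixes z :: "(real ^ 'd::finite) \<times> (real ^ 'd)"
  shows "norm (phase_point (fst z $ i) (snd z $ i)) \<le> norm z"
  by (rule order.trans[OF norm_phase_point_le]) (simp add: divide_le_eq mult_le_cancel_left1)

text \<open>The Hermite coefficients of the coherent state at z, that is, of the Gaussian shifted by
  z: a Gaussian factor times the normalized monomial in the phase points.\<close>

definition coherent_coeff :: "('d::finite \<Rightarrow> nat) \<Rightarrow> (real ^ 'd) \<times> (real ^ 'd) \<Rightarrow> complex" where
  "coherent_coeff \<alpha> z = (\<Prod>i\<in>UNIV. hermite_matrix 0 (\<alpha> i) (fst z $ i) (snd z $ i))"

lemma hermite_coeff_tf_shift_gauss: "hermite_coeff (tf_shift_fun x \<xi> gauss) \<alpha> = coherent_coeff \<alpha> (x, \<xi>)"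
  unfolding gauss_eq_hermite hermite_coeff_tf_shift_hermite by (simp add: coherent_coeff_def)

lemma coherent_coeff_altdef:
  "coherent_coeff \<alpha> z = (\<Prod>i\<in>UNIV. coherent0 (fst z $ i) (snd z $ i) *
     phase_point (fst z $ i) (snd z $ i) ^ \<alpha> i / complex_of_real (sqrt (fact (\<alpha> i))))"
  unfolding coherent_coeff_def hermite_matrix_0 ..

lemma norm_coherent_coeff_le:
  assumes "norm z \<le> R"
  shows "norm (coherent_coeff \<alpha> z) \<le> monomial_weight R \<alpha>"
  unfolding coherent_coeff_altdef monomial_weight_def prod_norm[symmetric]
proof (intro prod_mono conjI norm_ge_zero)
  fix i
  have "norm (coherent0 (fst z $ i) (snd z $ i)) * norm (phase_point (fst z $ i) (snd z $ i)) ^ \<alpha> i \<le> 1 * R ^ \<alpha> i"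
    using norm_phase_point_le'[of z i] assms by (intro mult_mono power_mono) (auto simp: norm_coherent0)
  then show "norm (coherent0 (fst z $ i) (snd z $ i) *
     phase_point (fst z $ i) (snd z $ i) ^ \<alpha> i / complex_of_real (sqrt (fact (\<alpha> i)))) \<le> R ^ \<alpha> i / sqrt (fact (\<alpha> i))"
    by (simp add: norm_mult norm_divide norm_power divide_right_mono)
qed

abbreviation stft_const :: "'d::finite itself \<Rightarrow> real" where
  "stft_const t \<equiv> (2 * pi) powr (- real CARD('d) / 2)"

lemma stft_gauss_altdef:
  fixes f :: "'d::finite hermite_series"
  shows "stft_gauss f z = complex_of_real (stft_const TYPE('d)) * (\<Sum>\<^sub>\<infinity>\<alpha>. f \<alpha> * cnj (coherent_coeff \<alpha> z))"
  by (cases z) (simp add: stft_gauss_def hermite_pairing_def hermite_coeff_tf_shift_gauss)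

lemma summable_on_stft:
  assumes "f \<in> pilipovic_dual"
  shows "(\<lambda>\<alpha>. norm (f \<alpha> * cnj (coherent_coeff \<alpha> z))) summable_on UNIV"
  by (rule summable_on_comparison_test[OF pilipovic_dual_summable[OF assms norm_ge_zero[of z]]])
     (auto simp: norm_mult intro!: mult_left_mono norm_coherent_coeff_le)

section \<open>Covariance under time-frequency shifts\<close>

definition weyl_matrix ::
  "('d::finite \<Rightarrow> nat) \<Rightarrow> ('d \<Rightarrow> nat) \<Rightarrow> (real ^ 'd) \<times> (real ^ 'd) \<Rightarrow> complex" where
  "weyl_matrix \<beta> \<alpha> z = (\<Prod>i\<in>UNIV. hermite_matrix (\<beta> i) (\<alpha> i) (fst z $ i) (snd z $ i))"

lemma tf_shift_altdef: "tf_shift x \<xi> f \<alpha> = (\<Sum>\<^sub>\<infinity>\<beta>. f \<beta> * weyl_matrix \<beta> \<alpha> (x, \<xi>))"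
  by (simp add: tf_shift_def hermite_coeff_tf_shift_hermite weyl_matrix_def)

text \<open>A shift by z only enlarges the weight parameter from s to s + norm z, up to a constant.
  As \<open>pilipovic_dual\<close> allows every parameter, it is invariant under shifts.\<close>

lemma weyl_matrix_abs_sum:
  fixes z :: "(real ^ 'd::finite) \<times> (real ^ 'd)"
  assumes "s \<ge> 0"
  shows "(\<lambda>\<alpha>. norm (weyl_matrix \<beta> \<alpha> z) * monomial_weight s \<alpha>) summable_on UNIV"
    and "(\<Sum>\<^sub>\<infinity>\<alpha>. norm (weyl_matrix \<beta> \<alpha> z) * monomial_weight s \<alpha>) \<le>
      exp (norm z * s) ^ CARD('d) * monomial_weight (s + norm z) \<beta>"
proof -
  let ?g = "\<lambda>i k. norm (hermite_matrix (\<beta> i) k (fst z $ i) (snd z $ i)) * s ^ k / sqrt (fact k)"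
  have eq: "norm (weyl_matrix \<beta> \<alpha> z) * monomial_weight s \<alpha> = (\<Prod>i\<in>UNIV. ?g i (\<alpha> i))" for \<alpha>
    unfolding weyl_matrix_def monomial_weight_def prod_norm[symmetric] prod.distrib[symmetric] by simp
  have nn: "?g i k \<ge> 0" for i k using assms by simp
  have sm: "(\<lambda>k. norm (?g i k)) summable_on UNIV" for i
    unfolding real_norm_def abs_of_nonneg[OF nn] by (rule hermite_matrix_abs_sum(1)[OF assms])
  show "(\<lambda>\<alpha>. norm (weyl_matrix \<beta> \<alpha> z) * monomial_weight s \<alpha>) summable_on UNIV"
  proof -
    have "norm (\<Prod>i\<in>UNIV. ?g i (\<alpha> i)) = (\<Prod>i\<in>UNIV. ?g i (\<alpha> i))" for \<alpha>
      unfolding real_norm_def by (intro abs_of_nonneg prod_nonneg nn)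
    then show ?thesis
      using summable_on_prod_multi_index[of ?g, OF sm] unfolding eq by (simp only:)
  qed
  have "(\<Sum>\<^sub>\<infinity>\<alpha>. norm (weyl_matrix \<beta> \<alpha> z) * monomial_weight s \<alpha>) = (\<Prod>i\<in>UNIV. \<Sum>\<^sub>\<infinity>k. ?g i k)"
    unfolding eq by (rule infsum_prod_multi_index[of ?g, OF sm])
  also have "\<dots> \<le> (\<Prod>i\<in>(UNIV::'d set). exp (norm z * s) * ((s + norm z) ^ \<beta> i / sqrt (fact (\<beta> i))))"
  proof (intro prod_mono conjI infsum_nonneg nn)
    fix i
    let ?w = "norm (phase_point (fst z $ i) (snd z $ i))"
    have "(\<Sum>\<^sub>\<infinity>k. ?g i k) \<le> norm (coherent0 (fst z $ i) (snd z $ i)) * exp (?w * s) * (s + ?w) ^ \<beta> i / sqrt (fact (\<beta> i))"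
      by (rule hermite_matrix_abs_sum(2)[OF assms])
    also have "\<dots> \<le> 1 * exp (norm z * s) * (s + norm z) ^ \<beta> i / sqrt (fact (\<beta> i))"
      using norm_phase_point_le'[of z i] assms
      by (intro divide_right_mono mult_mono power_mono) (auto simp: norm_coherent0 intro!: mult_right_mono)
    finally show "(\<Sum>\<^sub>\<infinity>k. ?g i k) \<le> exp (norm z * s) * ((s + norm z) ^ \<beta> i / sqrt (fact (\<beta> i)))" by simp
  qed
  also have "\<dots> = exp (norm z * s) ^ CARD('d) * monomial_weight (s + norm z) \<beta>"
    by (subst prod.distrib) (simp add: monomial_weight_def)
  finally show "(\<Sum>\<^sub>\<infinity>\<alpha>. norm (weyl_matrix \<beta> \<alpha> z) * monomial_weight s \<alpha>) \<le>
      exp (norm z * s) ^ CARD('d) * monomial_weight (s + norm z) \<beta>" .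
qed

text \<open>The cocycle of the projective representation by time-frequency shifts, written as the
  quotient that the generating functions produce. That it is unimodular is not visible from this
  form and is proved next.\<close>

definition weyl_phase :: "(real ^ 'd::finite) \<times> (real ^ 'd) \<Rightarrow> (real ^ 'd) \<times> (real ^ 'd) \<Rightarrow> complex" where
  "weyl_phase \<zeta> z = (\<Prod>i\<in>UNIV. cnj (coherent0 (fst z $ i) (snd z $ i)) * coherent0 (fst \<zeta> $ i) (snd \<zeta> $ i) *
     exp (phase_point (fst \<zeta> $ i) (snd \<zeta> $ i) * cnj (phase_point (fst z $ i) (snd z $ i))) /
     cnj (coherent0 (fst (z - \<zeta>) $ i) (snd (z - \<zeta>) $ i)))"

lemma norm_weyl_phase: "norm (weyl_phase \<zeta> z) = 1"
proof -
  have "norm (cnj (coherent0 a b) * coherent0 c d * exp (phase_point c d * cnj (phase_point a b)) /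
     cnj (coherent0 (a - c) (b - d))) = 1" for a b c d
  proof -
    have "norm (exp (phase_point c d * cnj (phase_point a b))) = exp ((a * c + b * d) / 2)"
      unfolding norm_exp_eq_Re by (simp add: phase_point_def algebra_simps add_divide_distrib)
    then show ?thesis
      by (simp add: norm_mult norm_divide norm_coherent0 diff_divide_distrib add_divide_distrib flip: exp_add exp_diff)
         (simp add: power2_eq_square algebra_simps diff_divide_distrib add_divide_distrib)
  qed
  then show ?thesis unfolding weyl_phase_def prod_norm[symmetric] by simp
qed

lemma coherent0_nonzero [simp]: "coherent0 x \<xi> \<noteq> 0" by (simp add: coherent0_def)

lemma phase_point_diff: "phase_point (a - c) (b - d) = phase_point a b - phase_point c d"
  by (simp add: phase_point_def complex_eq_iff diff_divide_distrib)

text \<open>The composition law of shifts, in matrix form: the row generating functions are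
  evaluated at the conjugate phase points of z, coordinate by coordinate.\<close>

lemma weyl_matrix_infsum:
  "(\<Sum>\<^sub>\<infinity>\<alpha>. weyl_matrix \<beta> \<alpha> \<zeta> * cnj (coherent_coeff \<alpha> z)) = weyl_phase \<zeta> z * cnj (coherent_coeff \<beta> (z - \<zeta>))"
proof -
  define s where "s i = cnj (phase_point (fst z $ i) (snd z $ i))" for i
  let ?h = "\<lambda>i k. hermite_matrix (\<beta> i) k (fst \<zeta> $ i) (snd \<zeta> $ i) * s i ^ k / complex_of_real (sqrt (fact k))"
  let ?g = "\<lambda>i k. cnj (coherent0 (fst z $ i) (snd z $ i)) * ?h i k"
  have eq: "weyl_matrix \<beta> \<alpha> \<zeta> * cnj (coherent_coeff \<alpha> z) = (\<Prod>i\<in>UNIV. ?g i (\<alpha> i))" for \<alpha>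
    unfolding weyl_matrix_def coherent_coeff_altdef cnj_prod prod.distrib[symmetric] s_def
    by (intro prod.cong) simp_all
  have "(\<lambda>k. norm (?h i k)) summable_on UNIV" for i
    using hermite_matrix_abs_sum(1)[of "norm (s i)" "\<beta> i" "fst \<zeta> $ i" "snd \<zeta> $ i"]
    by (simp add: norm_mult norm_divide norm_power)
  then have sm: "(\<lambda>k. norm (?g i k)) summable_on UNIV" for i
    unfolding norm_mult[of "cnj _"] by (intro summable_on_cmult_right)
  have "(\<Sum>\<^sub>\<infinity>\<alpha>. weyl_matrix \<beta> \<alpha> \<zeta> * cnj (coherent_coeff \<alpha> z)) = (\<Prod>i\<in>UNIV. \<Sum>\<^sub>\<infinity>k. ?g i k)"
    unfolding eq by (rule infsum_prod_multi_index[of ?g, OF sm])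
  also have "\<dots> = weyl_phase \<zeta> z * cnj (coherent_coeff \<beta> (z - \<zeta>))"
    unfolding weyl_phase_def coherent_coeff_altdef cnj_prod prod.distrib[symmetric]
  proof (intro prod.cong refl)
    fix i
    have "(\<Sum>\<^sub>\<infinity>k. ?g i k) = cnj (coherent0 (fst z $ i) (snd z $ i)) * (\<Sum>\<^sub>\<infinity>k. ?h i k)"
      by (rule infsum_cmult_right')
    also note hermite_matrix_infsum
    finally show "(\<Sum>\<^sub>\<infinity>k. ?g i k) = cnj (coherent0 (fst z $ i) (snd z $ i)) * coherent0 (fst \<zeta> $ i) (snd \<zeta> $ i) *
        exp (phase_point (fst \<zeta> $ i) (snd \<zeta> $ i) * cnj (phase_point (fst z $ i) (snd z $ i))) /
        cnj (coherent0 (fst (z - \<zeta>) $ i) (snd (z - \<zeta>) $ i)) *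
        cnj (coherent0 (fst (z - \<zeta>) $ i) (snd (z - \<zeta>) $ i) *
          phase_point (fst (z - \<zeta>) $ i) (snd (z - \<zeta>) $ i) ^ \<beta> i / complex_of_real (sqrt (fact (\<beta> i))))"
      by (simp add: s_def phase_point_diff)
  qed
  finally show ?thesis .
qed

text \<open>Absolute convergence of the double series, which licenses the exchange of the two sums
  in the proof of covariance.\<close>

lemma summable_on_weyl_double:
  assumes f: "f \<in> pilipovic_dual" and s: "s \<ge> 0" and \<kappa>: "\<And>\<alpha>. norm (\<kappa> \<alpha>) \<le> monomial_weight s \<alpha>"
  shows "(\<lambda>(\<beta>, \<alpha>). norm (f \<beta> * weyl_matrix \<beta> \<alpha> \<zeta> * \<kappa> \<alpha>)) summable_on UNIV \<times> UNIV"
proof -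
  let ?g = "\<lambda>\<beta> \<alpha>. norm (f \<beta>) * (norm (weyl_matrix \<beta> \<alpha> \<zeta>) * monomial_weight s \<alpha>)"
  let ?K = "exp (norm \<zeta> * s) ^ CARD('a)"
  have nn: "?g \<beta> \<alpha> \<ge> 0" for \<alpha> \<beta>
    by (intro mult_nonneg_nonneg norm_ge_zero monomial_weight_nonneg s)
  have inner: "?g \<beta> summable_on UNIV" for \<beta>
    by (intro summable_on_cmult_right weyl_matrix_abs_sum(1) s)
  have "(\<lambda>\<beta>. \<Sum>\<^sub>\<infinity>\<alpha>. ?g \<beta> \<alpha>) summable_on UNIV"
  proof (rule summable_on_comparison_test)
    show "(\<lambda>\<beta>. ?K * (norm (f \<beta>) * monomial_weight (s + norm \<zeta>) \<beta>)) summable_on UNIV"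
      by (intro summable_on_cmult_right pilipovic_dual_summable f) (use s in simp)
    show "(\<Sum>\<^sub>\<infinity>\<alpha>. ?g \<beta> \<alpha>) \<le> ?K * (norm (f \<beta>) * monomial_weight (s + norm \<zeta>) \<beta>)" for \<beta>
      using mult_left_mono[OF weyl_matrix_abs_sum(2)[OF s, of \<beta> \<zeta>], of "norm (f \<beta>)"]
      unfolding infsum_cmult_right' by (simp add: mult_ac)
    show "0 \<le> (\<Sum>\<^sub>\<infinity>\<alpha>. ?g \<beta> \<alpha>)" for \<beta> by (intro infsum_nonneg nn)
  qed
  then have "(\<lambda>(\<beta>, \<alpha>). ?g \<beta> \<alpha>) summable_on UNIV \<times> UNIV"
    by (intro summable_on_SigmaI[where g = "\<lambda>\<beta>. \<Sum>\<^sub>\<infinity>\<alpha>. ?g \<beta> \<alpha>"])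
       (simp_all only: prod.case has_sum_infsum inner nn split: prod.split)
  then show ?thesis
    by (rule summable_on_comparison_test)
       (auto simp: norm_mult mult.assoc intro!: mult_left_mono \<kappa>)
qed

lemma tf_shift_pilipovic_dual:
  assumes f: "f \<in> pilipovic_dual"
  shows "tf_shift x \<xi> f \<in> pilipovic_dual"
  unfolding pilipovic_dual_iff
proof safe
  fix s :: real assume s: "s > 0"
  let ?\<zeta> = "(x, \<xi>)"
  have "norm (tf_shift x \<xi> f \<alpha>) * monomial_weight s \<alpha> \<le>
     (\<Sum>\<^sub>\<infinity>\<beta>. exp (norm ?\<zeta> * s) ^ CARD('a) * (norm (f \<beta>) * monomial_weight (s + norm ?\<zeta>) \<beta>))" for \<alpha>
  proof -
    have le: "norm (f \<beta> * weyl_matrix \<beta> \<alpha> ?\<zeta> * complex_of_real (monomial_weight s \<alpha>)) \<le>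
        exp (norm ?\<zeta> * s) ^ CARD('a) * (norm (f \<beta>) * monomial_weight (s + norm ?\<zeta>) \<beta>)" for \<beta>
    proof -
      \<comment> \<open>A single weighted entry is at most the sum of its whole row, for which a
        bound is known.\<close>
      have "norm (weyl_matrix \<beta> \<alpha> ?\<zeta>) * monomial_weight s \<alpha> =
          (\<Sum>\<^sub>\<infinity>\<alpha>\<in>{\<alpha>}. norm (weyl_matrix \<beta> \<alpha> ?\<zeta>) * monomial_weight s \<alpha>)" by simp
      also have "\<dots> \<le> (\<Sum>\<^sub>\<infinity>\<alpha>. norm (weyl_matrix \<beta> \<alpha> ?\<zeta>) * monomial_weight s \<alpha>)"
        using weyl_matrix_abs_sum(1)[of s \<beta> ?\<zeta>] s
        by (intro infsum_mono_neutral) (auto intro!: mult_nonneg_nonneg monomial_weight_nonneg)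
      also have "\<dots> \<le> exp (norm ?\<zeta> * s) ^ CARD('a) * monomial_weight (s + norm ?\<zeta>) \<beta>"
        using s by (intro weyl_matrix_abs_sum(2)) simp
      finally have "norm (weyl_matrix \<beta> \<alpha> ?\<zeta>) * monomial_weight s \<alpha> \<le> \<dots>" .
      from mult_left_mono[OF this norm_ge_zero[of "f \<beta>"]] show ?thesis
        using monomial_weight_pos[OF s, of \<alpha>] by (simp add: norm_mult mult_ac)
    qed
    have sm: "(\<lambda>\<beta>. exp (norm ?\<zeta> * s) ^ CARD('a) * (norm (f \<beta>) * monomial_weight (s + norm ?\<zeta>) \<beta>)) summable_on UNIV"
      by (intro summable_on_cmult_right pilipovic_dual_summable f) (use s in simp)
    have sm2: "(\<lambda>\<beta>. norm (f \<beta> * weyl_matrix \<beta> \<alpha> ?\<zeta> * complex_of_real (monomial_weight s \<alpha>))) summable_on UNIV"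
      by (rule summable_on_comparison_test[OF sm]) (use le in auto)
    have "norm (tf_shift x \<xi> f \<alpha>) * monomial_weight s \<alpha> = norm (\<Sum>\<^sub>\<infinity>\<beta>. f \<beta> * weyl_matrix \<beta> \<alpha> ?\<zeta> * complex_of_real (monomial_weight s \<alpha>))"
      using monomial_weight_pos[OF s, of \<alpha>] by (simp add: tf_shift_altdef infsum_cmult_left' norm_mult)
    also have "\<dots> \<le> (\<Sum>\<^sub>\<infinity>\<beta>. norm (f \<beta> * weyl_matrix \<beta> \<alpha> ?\<zeta> * complex_of_real (monomial_weight s \<alpha>)))"
      by (rule norm_infsum_bound[OF sm2])
    also have "\<dots> \<le> (\<Sum>\<^sub>\<infinity>\<beta>. exp (norm ?\<zeta> * s) ^ CARD('a) * (norm (f \<beta>) * monomial_weight (s + norm ?\<zeta>) \<beta>))"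
      by (rule infsum_mono[OF sm2 sm le])
    finally show ?thesis .
  qed
  then show "\<exists>C. \<forall>\<alpha>. norm (tf_shift x \<xi> f \<alpha>) * monomial_weight s \<alpha> \<le> C" by blast
qed

lemma stft_gauss_tf_shift:
  assumes f: "f \<in> pilipovic_dual"
  shows "stft_gauss (tf_shift x \<xi> f) z = weyl_phase (x, \<xi>) z * stft_gauss f (z - (x, \<xi>))"
proof -
  let ?\<zeta> = "(x, \<xi>)"
  let ?t = "\<lambda>\<beta> \<alpha>. f \<beta> * weyl_matrix \<beta> \<alpha> ?\<zeta> * cnj (coherent_coeff \<alpha> z)"
  have "(\<lambda>(\<beta>, \<alpha>). norm (?t \<beta> \<alpha>)) summable_on UNIV \<times> UNIV"
    by (rule summable_on_weyl_double[OF f norm_ge_zero[of z]]) (simp add: norm_coherent_coeff_le)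
  then have sm: "(\<lambda>(\<beta>, \<alpha>). ?t \<beta> \<alpha>) summable_on UNIV \<times> UNIV"
    by - (rule abs_summable_summable, simp only: case_prod_unfold)
  have "(\<Sum>\<^sub>\<infinity>\<alpha>. tf_shift x \<xi> f \<alpha> * cnj (coherent_coeff \<alpha> z)) = (\<Sum>\<^sub>\<infinity>\<alpha>. \<Sum>\<^sub>\<infinity>\<beta>. ?t \<beta> \<alpha>)"
    unfolding tf_shift_altdef infsum_cmult_left' ..
  also have "\<dots> = (\<Sum>\<^sub>\<infinity>\<beta>. \<Sum>\<^sub>\<infinity>\<alpha>. ?t \<beta> \<alpha>)"
    by (rule infsum_swap_banach[OF sm, symmetric])
  also have "\<dots> = (\<Sum>\<^sub>\<infinity>\<beta>. f \<beta> * (weyl_phase ?\<zeta> z * cnj (coherent_coeff \<beta> (z - ?\<zeta>))))"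
    unfolding mult.assoc infsum_cmult_right' weyl_matrix_infsum ..
  also have "\<dots> = weyl_phase ?\<zeta> z * (\<Sum>\<^sub>\<infinity>\<beta>. f \<beta> * cnj (coherent_coeff \<beta> (z - ?\<zeta>)))"
    unfolding infsum_cmult_right'[symmetric] by (simp only: mult.left_commute)
  finally show ?thesis unfolding stft_gauss_altdef by simp
qed

lemma norm_stft_gauss_tf_shift:
  "f \<in> pilipovic_dual \<Longrightarrow> norm (stft_gauss (tf_shift x \<xi> f) z) = norm (stft_gauss f (z - (x, \<xi>)))"
  by (simp add: stft_gauss_tf_shift norm_mult norm_weyl_phase)

section \<open>Coefficient extraction on balls\<close>

text \<open>An enumeration of the index set turns an absolutely convergent unordered sum into a
  series over the naturals, to which measurability and termwise integration apply.\<close>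

lemma infsum_eq_suminf_reindex:
  fixes f :: "'i \<Rightarrow> 'b::banach"
  assumes "bij_betw e UNIV I" "(\<lambda>i. norm (f i)) summable_on I"
  shows "infsum f I = (\<Sum>n. f (e (n::nat)))" and "summable (\<lambda>n. norm (f (e n)))"
proof -
  have s: "(\<lambda>n. norm (f (e n))) summable_on UNIV"
    using assms(2) summable_on_reindex_bij_betw[OF assms(1), of "\<lambda>i. norm (f i)"] by simp
  then show "summable (\<lambda>n. norm (f (e n)))" by (rule summable_on_imp_summable)
  have "infsum f I = infsum (\<lambda>n. f (e n)) UNIV"
    using infsum_reindex_bij_betw[OF assms(1), of f] by simp
  also have "\<dots> = (\<Sum>n. f (e n))"
    using has_sum_imp_sums[OF has_sum_infsum[OF abs_summable_summable[OF s]]] by (simp add: sums_iff)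
  finally show "infsum f I = (\<Sum>n. f (e n))" .
qed

lemma borel_measurable_infsum:
  fixes f :: "'i \<Rightarrow> 'a \<Rightarrow> 'b::{banach, second_countable_topology}"
  assumes I: "countable I" and m: "\<And>i. i \<in> I \<Longrightarrow> f i \<in> borel_measurable M"
    and s: "\<And>x. x \<in> space M \<Longrightarrow> (\<lambda>i. norm (f i x)) summable_on I"
  shows "(\<lambda>x. \<Sum>\<^sub>\<infinity>i\<in>I. f i x) \<in> borel_measurable M"
proof (cases "finite I")
  case True
  then show ?thesis using m by simp
next
  case False
  note e = bij_betw_from_nat_into[OF I False]
  have [measurable]: "f (from_nat_into I n) \<in> borel_measurable M" for n
    using m bij_betwE[OF e] by simp
  have "(\<lambda>x. \<Sum>n. f (from_nat_into I n) x) \<in> borel_measurable M" by measurable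
  then show ?thesis
    by (rule measurable_cong[THEN iffD2, rotated]) (rule infsum_eq_suminf_reindex(1)[OF e s])
qed

lemma has_sum_integral:
  fixes f :: "'i \<Rightarrow> 'a \<Rightarrow> 'b::{banach, second_countable_topology}"
  assumes I: "countable I" and int: "\<And>i. i \<in> I \<Longrightarrow> integrable M (f i)"
    and s: "\<And>x. x \<in> space M \<Longrightarrow> (\<lambda>i. norm (f i x)) summable_on I"
    and s': "(\<lambda>i. LINT x|M. norm (f i x)) summable_on I"
  shows "((\<lambda>i. LINT x|M. f i x) has_sum (LINT x|M. (\<Sum>\<^sub>\<infinity>i\<in>I. f i x))) I"
proof (cases "finite I")
  case True
  then show ?thesis using int by (auto simp: has_sum_finite_iff Bochner_Integration.integral_sum)
next
  case False
  note e = bij_betw_from_nat_into[OF I False]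
  let ?e = "from_nat_into I"
  have eI: "?e n \<in> I" for n using bij_betwE[OF e] by simp
  have int': "integrable M (f (?e n))" for n using int eI by simp
  have sx: "AE x in M. summable (\<lambda>n. norm (f (?e n) x))"
    using infsum_eq_suminf_reindex(2)[OF e s] by auto
  have si: "(\<lambda>n. LINT x|M. norm (f (?e n) x)) summable_on UNIV"
    using s' summable_on_reindex_bij_betw[OF e, of "\<lambda>i. LINT x|M. norm (f i x)"] by simp
  then have si': "summable (\<lambda>n. LINT x|M. norm (f (?e n) x))" by (rule summable_on_imp_summable)
  have cong: "(LINT x|M. (\<Sum>\<^sub>\<infinity>i\<in>I. f i x)) = (LINT x|M. (\<Sum>n. f (?e n) x))"
    using infsum_eq_suminf_reindex(1)[OF e s] by (auto cong: Bochner_Integration.integral_cong)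
  have sums: "(\<lambda>n. LINT x|M. f (?e n) x) sums (LINT x|M. (\<Sum>n. f (?e n) x))"
    by (rule sums_integral[OF int' sx si'])
  have "summable (\<lambda>n. norm (LINT x|M. f (?e n) x))"
    by (rule summable_comparison_test'[OF si', of 0]) (auto intro: integral_norm_bound)
  then have "((\<lambda>n. LINT x|M. f (?e n) x) has_sum (LINT x|M. (\<Sum>n. f (?e n) x))) UNIV"
    by (rule norm_summable_imp_has_sum[OF _ sums])
  then show ?thesis
    unfolding cong using has_sum_reindex_bij_betw[OF e, of "\<lambda>i. LINT x|M. f i x"] by simp
qed

lemma borel_measurable_cnj [measurable (raw)]:
  assumes "f \<in> borel_measurable M" shows "(\<lambda>x. cnj (f x)) \<in> borel_measurable M"
  by (rule measurable_compose[OF assms]) (intro borel_measurable_continuous_onI continuous_intros)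

section \<open>Rotation invariance of Lebesgue measure in a coordinate plane\<close>

lemma nn_integral_lborel_translate:
  fixes h :: "'a::euclidean_space \<Rightarrow> ennreal"
  assumes [measurable]: "h \<in> borel_measurable borel"
  shows "(\<integral>\<^sup>+x. h (c + x) \<partial>lborel) = (\<integral>\<^sup>+x. h x \<partial>lborel)"
proof -
  have "(\<integral>\<^sup>+x. h x \<partial>lborel) = (\<integral>\<^sup>+x. h x \<partial>distr lborel borel ((+) c))"
    by (simp add: lborel_distr_plus)
  also have "\<dots> = (\<integral>\<^sup>+x. h (c + x) \<partial>lborel)" by (rule nn_integral_distr) auto
  finally show ?thesis by simp
qed

text \<open>For each fixed second component a shear is a translation, so Tonelli reduces the claim
  to translation invariance.\<close>

lemma distr_lborel_shear_fst:
  fixes g :: "'b::euclidean_space \<Rightarrow> 'a::euclidean_space"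
  assumes [measurable]: "g \<in> borel_measurable borel"
  shows "distr lborel borel (\<lambda>z. (fst z + g (snd z), snd z)) = lborel"
proof (rule measure_eqI)
  fix A :: "('a \<times> 'b) set" assume "A \<in> sets (distr lborel borel (\<lambda>z. (fst z + g (snd z), snd z)))"
  then have A [measurable]: "A \<in> sets borel" by simp
  have [measurable]: "(\<lambda>z :: 'a \<times> 'b. (fst z + g (snd z), snd z)) \<in> borel_measurable borel"
    unfolding borel_prod[symmetric] by measurable
  have [measurable]: "A \<in> sets (borel \<Otimes>\<^sub>M borel)" unfolding borel_prod by (rule A)
  have "emeasure (distr lborel borel (\<lambda>z. (fst z + g (snd z), snd z))) A =
      (\<integral>\<^sup>+z. indicator A z \<partial>distr lborel borel (\<lambda>z. (fst z + g (snd z), snd z)))"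
    by simp
  also have "\<dots> = (\<integral>\<^sup>+z. indicator A (fst z + g (snd z), snd z) \<partial>lborel)"
    by (rule nn_integral_distr) auto
  also have "\<dots> = (\<integral>\<^sup>+y. \<integral>\<^sup>+x. indicator A (x + g y, y) \<partial>lborel \<partial>lborel)"
    unfolding lborel_prod[symmetric] by (subst lborel_pair.nn_integral_snd[symmetric]) auto
  also have "\<dots> = (\<integral>\<^sup>+y. \<integral>\<^sup>+x. indicator A (x, y) \<partial>lborel \<partial>lborel)"
  proof (rule nn_integral_cong)
    fix y
    have "(\<lambda>x. indicator A (x, y) :: ennreal) \<in> borel_measurable borel" by measurable
    from nn_integral_lborel_translate[OF this, of "g y"]
    show "(\<integral>\<^sup>+x. indicator A (x + g y, y) \<partial>lborel) = (\<integral>\<^sup>+x. indicator A (x, y) \<partial>lborel)"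
      by (simp add: add.commute)
  qed
  also have "\<dots> = (\<integral>\<^sup>+z. indicator A z \<partial>lborel)"
    unfolding lborel_prod[symmetric] by (subst lborel_pair.nn_integral_snd[symmetric]) auto
  finally show "emeasure (distr lborel borel (\<lambda>z. (fst z + g (snd z), snd z))) A = emeasure lborel A"
    by simp
qed simp

lemma distr_lborel_shear_snd:
  fixes g :: "'a::euclidean_space \<Rightarrow> 'b::euclidean_space"
  assumes [measurable]: "g \<in> borel_measurable borel"
  shows "distr lborel borel (\<lambda>z. (fst z, snd z + g (fst z))) = lborel"
proof (rule measure_eqI)
  fix A :: "('a \<times> 'b) set" assume "A \<in> sets (distr lborel borel (\<lambda>z. (fst z, snd z + g (fst z))))"
  then have A [measurable]: "A \<in> sets borel" by simp
  have [measurable]: "(\<lambda>z :: 'a \<times> 'b. (fst z, snd z + g (fst z))) \<in> borel_measurable borel"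
    unfolding borel_prod[symmetric] by measurable
  have [measurable]: "A \<in> sets (borel \<Otimes>\<^sub>M borel)" unfolding borel_prod by (rule A)
  have "emeasure (distr lborel borel (\<lambda>z. (fst z, snd z + g (fst z)))) A =
      (\<integral>\<^sup>+z. indicator A z \<partial>distr lborel borel (\<lambda>z. (fst z, snd z + g (fst z))))"
    by simp
  also have "\<dots> = (\<integral>\<^sup>+z. indicator A (fst z, snd z + g (fst z)) \<partial>lborel)"
    by (rule nn_integral_distr) auto
  also have "\<dots> = (\<integral>\<^sup>+x. \<integral>\<^sup>+y. indicator A (x, y + g x) \<partial>lborel \<partial>lborel)"
    unfolding lborel_prod[symmetric] by (subst lborel.nn_integral_fst[symmetric]) auto
  also have "\<dots> = (\<integral>\<^sup>+x. \<integral>\<^sup>+y. indicator A (x, y) \<partial>lborel \<partial>lborel)"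
  proof (rule nn_integral_cong)
    fix x
    have "(\<lambda>y. indicator A (x, y) :: ennreal) \<in> borel_measurable borel" by measurable
    from nn_integral_lborel_translate[OF this, of "g x"]
    show "(\<integral>\<^sup>+y. indicator A (x, y + g x) \<partial>lborel) = (\<integral>\<^sup>+y. indicator A (x, y) \<partial>lborel)"
      by (simp add: add.commute)
  qed
  also have "\<dots> = (\<integral>\<^sup>+z. indicator A z \<partial>lborel)"
    unfolding lborel_prod[symmetric] by (subst lborel.nn_integral_fst[symmetric]) auto
  finally show "emeasure (distr lborel borel (\<lambda>z. (fst z, snd z + g (fst z)))) A = emeasure lborel A"
    by simp
qed simp

text \<open>Rotates the pair of i-th position and i-th frequency and fixes the rest. Writing it as
  the identity plus a correction along \<open>axis i\<close> makes the comparison with shears a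
  matter of adding axis vectors.\<close>

definition coord_rotation ::
  "'d::finite \<Rightarrow> real \<Rightarrow> real \<Rightarrow> (real ^ 'd) \<times> (real ^ 'd) \<Rightarrow> (real ^ 'd) \<times> (real ^ 'd)" where
  "coord_rotation i c s z =
     (fst z + axis i ((c - 1) * fst z $ i - s * snd z $ i), snd z + axis i (s * fst z $ i + (c - 1) * snd z $ i))"

lemma continuous_on_axis [continuous_intros]:
  "continuous_on A f \<Longrightarrow> continuous_on A (\<lambda>x. axis i (f x) :: real ^ 'd::finite)"
  unfolding axis_def
proof (rule continuous_on_vec_lambda)
  fix j assume "continuous_on A f"
  then show "continuous_on A (\<lambda>x. if j = i then f x else 0)" by (cases "j = i") auto
qed

text \<open>A rotation by an angle other than \<open>pi\<close> is a product of three shears.\<close>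

lemma distr_lborel_coord_rotation:
  assumes "c\<^sup>2 + s\<^sup>2 = 1" "c \<noteq> - 1"
  shows "distr lborel borel (coord_rotation i c s) = lborel"
proof -
  \<comment> \<open>For c and s the cosine and sine of an angle, a is the tangent of half the angle;
    the shear coefficients are - a, s and - a.\<close>
  define a where "a = s / (1 + c)"
  have "1 + c \<noteq> 0" using assms(2) by auto
  then have ab: "a * (1 + c) = s" by (simp add: a_def)
  have "a * s * (1 + c) = (1 - c) * (1 + c)"
  proof -
    have "a * s * (1 + c) = s\<^sup>2" using ab by (simp add: power2_eq_square mult_ac)
    also have "\<dots> = 1 - c\<^sup>2" using assms(1) by simp
    finally show ?thesis by (simp add: power2_eq_square algebra_simps)
  qed
  then have as: "a * s = 1 - c" using \<open>1 + c \<noteq> 0\<close> by simp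
  let ?X = "\<lambda>z :: (real ^ 'a) \<times> (real ^ 'a). (fst z + axis i (- a * snd z $ i), snd z)"
  let ?Y = "\<lambda>z :: (real ^ 'a) \<times> (real ^ 'a). (fst z, snd z + axis i (s * fst z $ i))"
  have [measurable]: "(\<lambda>x :: real ^ 'a. axis i (t * x $ i) :: real ^ 'a) \<in> borel_measurable borel" for t
    by (intro borel_measurable_continuous_onI continuous_intros)
  have X: "distr lborel borel ?X = lborel" and Y: "distr lborel borel ?Y = lborel"
    by (rule distr_lborel_shear_fst distr_lborel_shear_snd, measurable)+
  have m: "?X \<in> measurable borel borel" "?Y \<in> measurable borel borel"
    by (intro borel_measurable_continuous_onI continuous_intros)+
  have eq: "coord_rotation i c s = ?X \<circ> (?Y \<circ> ?X)"
  proof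
    fix z :: "(real ^ 'a) \<times> (real ^ 'a)"
    have 1: "(c - 1) * x - s * y = - a * y - a * (y + s * (x - a * y))" for x y
    proof -
      have "- a * y - a * (y + s * (x - a * y)) = - (a * s) * x - (2 * a - (a * s) * a) * y"
        by (simp add: algebra_simps)
      also have "\<dots> = (c - 1) * x - (a * (1 + c)) * y" unfolding as by (simp add: algebra_simps)
      also have "\<dots> = (c - 1) * x - s * y" unfolding ab ..
      finally show ?thesis by simp
    qed
    have 2: "s * x + (c - 1) * y = s * (x - a * y)" for x y
    proof -
      have "s * (x - a * y) = s * x - (a * s) * y" by (simp add: algebra_simps)
      then show ?thesis unfolding as by (simp add: algebra_simps)
    qed
    show "coord_rotation i c s z = (?X \<circ> (?Y \<circ> ?X)) z"
      unfolding coord_rotation_def o_def 1 2 by (auto simp: vec_eq_iff axis_def prod_eq_iff algebra_simps)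
  qed
  have "distr lborel borel (?X \<circ> (?Y \<circ> ?X)) = distr (distr (distr lborel borel ?X) borel ?Y) borel ?X"
    using m by (simp add: distr_distr o_assoc)
  then show ?thesis unfolding eq X Y by simp
qed

lemma norm_prod_vec_power2:
  fixes z :: "(real ^ 'd::finite) \<times> (real ^ 'd)"
  shows "(norm z)\<^sup>2 = (\<Sum>i\<in>UNIV. (fst z $ i)\<^sup>2 + (snd z $ i)\<^sup>2)"
  by (simp add: norm_prod_def norm_vec_def L2_set_def sum_nonneg sum.distrib)

lemma coord_rotation_components:
  "fst (coord_rotation i c s z) $ j = (if j = i then c * fst z $ i - s * snd z $ i else fst z $ j)"
  "snd (coord_rotation i c s z) $ j = (if j = i then s * fst z $ i + c * snd z $ i else snd z $ j)"
  by (auto simp: coord_rotation_def axis_def algebra_simps)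

lemma coord_rotation_sum_squares:
  assumes "c\<^sup>2 + s\<^sup>2 = 1"
  shows "(fst (coord_rotation i c s z) $ j)\<^sup>2 + (snd (coord_rotation i c s z) $ j)\<^sup>2 = (fst z $ j)\<^sup>2 + (snd z $ j)\<^sup>2"
proof -
  have "(c * x - s * y)\<^sup>2 + (s * x + c * y)\<^sup>2 = (c\<^sup>2 + s\<^sup>2) * (x\<^sup>2 + y\<^sup>2)" for x y :: real
    by (simp add: power2_eq_square algebra_simps)
  then show ?thesis by (simp add: coord_rotation_components assms)
qed

lemma norm_coord_rotation:
  assumes "c\<^sup>2 + s\<^sup>2 = 1"
  shows "norm (coord_rotation i c s z) = norm z"
proof (rule power2_eq_imp_eq)
  show "(norm (coord_rotation i c s z))\<^sup>2 = (norm z)\<^sup>2"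
    unfolding norm_prod_vec_power2 coord_rotation_sum_squares[OF assms] ..
qed auto

section \<open>Orthogonality of coherent state coefficients on balls\<close>

lemma coherent_coeff_mult_cnj:
  "coherent_coeff \<alpha> z * cnj (coherent_coeff \<beta> z) =
     (\<Prod>i\<in>UNIV. complex_of_real (exp (- ((fst z $ i)\<^sup>2 + (snd z $ i)\<^sup>2) / 2) / (sqrt (fact (\<alpha> i)) * sqrt (fact (\<beta> i)))) *
        (phase_point (fst z $ i) (snd z $ i) ^ \<alpha> i * cnj (phase_point (fst z $ i) (snd z $ i)) ^ \<beta> i))"
proof -
  have "coherent0 a b * cnj (coherent0 a b) = complex_of_real (exp (- (a\<^sup>2 + b\<^sup>2) / 2))" for a b
    unfolding complex_norm_square[symmetric] norm_coherent0 power2_eq_square by (simp flip: exp_add of_real_mult)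
  then show ?thesis
    unfolding coherent_coeff_altdef cnj_prod prod.distrib[symmetric]
    by (intro prod.cong refl) (simp add: mult_ac times_divide_eq_left)
qed

lemma continuous_on_coherent_coeff: "continuous_on A (coherent_coeff \<alpha>)"
  unfolding coherent_coeff_altdef[abs_def] coherent0_def phase_point_def complex_eq
  by (intro continuous_intros) auto

lemma borel_measurable_coherent_coeff [measurable]: "coherent_coeff \<alpha> \<in> borel_measurable borel"
  by (intro borel_measurable_continuous_onI continuous_on_coherent_coeff)

text \<open>Rotating the \<open>i\<close>-th coordinate pair by \<open>\<theta>\<close> multiplies the integrand by
  \<open>cis (\<theta> (\<alpha> i - \<beta> i))\<close>, which is not \<open>1\<close> for \<open>\<theta> = pi / (2 \<bar>\<alpha> i - \<beta> i\<bar>)\<close>.\<close>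

lemma coherent_coeff_orthogonal:
  assumes "\<alpha> \<noteq> \<beta>"
  shows "(LINT z|lborel. indicator (ball 0 R) z *\<^sub>R (coherent_coeff \<alpha> z * cnj (coherent_coeff \<beta> z))) = 0"
proof -
  obtain i where i: "\<alpha> i \<noteq> \<beta> i" using assms by auto
  define m where "m = \<bar>int (\<alpha> i) - int (\<beta> i)\<bar>"
  have m: "m \<ge> 1" using i by (simp add: m_def)
  define \<theta> where "\<theta> = pi / (2 * m)"
  let ?u = "cis \<theta>"
  have \<theta>: "0 < \<theta>" "\<theta> \<le> pi / 2" using m by (auto simp: \<theta>_def field_simps)
  have cs: "(cos \<theta>)\<^sup>2 + (sin \<theta>)\<^sup>2 = 1" by simp
  have c: "cos \<theta> \<noteq> - 1" using cos_ge_zero[of \<theta>] \<theta> by auto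
  have u: "?u ^ \<alpha> i * cnj ?u ^ \<beta> i \<noteq> 1"
  proof -
    have eq: "?u ^ \<alpha> i * cnj ?u ^ \<beta> i = cis (\<theta> * (real (\<alpha> i) - real (\<beta> i)))"
      unfolding cis_cnj Complex.DeMoivre cis_mult by (intro arg_cong[where f = cis]) (simp add: algebra_simps)
    have "real (\<alpha> i) - real (\<beta> i) = m \<or> real (\<alpha> i) - real (\<beta> i) = - m" by (auto simp: m_def)
    then have "\<theta> * (real (\<alpha> i) - real (\<beta> i)) = pi / 2 \<or> \<theta> * (real (\<alpha> i) - real (\<beta> i)) = - (pi / 2)"
    proof -
      have "\<theta> * m = pi / 2" using m by (simp add: \<theta>_def)
      moreover assume "real (\<alpha> i) - real (\<beta> i) = m \<or> real (\<alpha> i) - real (\<beta> i) = - m"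
      ultimately show ?thesis by fastforce
    qed
    then have "cis (\<theta> * (real (\<alpha> i) - real (\<beta> i))) = \<i> \<or> cis (\<theta> * (real (\<alpha> i) - real (\<beta> i))) = - \<i>"
      by (elim disjE) (simp_all only: cis_pi_half cis_minus_pi_half simp_thms)
    then show ?thesis unfolding eq by (elim disjE) (simp_all only: complex_eq_iff; simp)+
  qed
  let ?\<rho> = "coord_rotation i (cos \<theta>) (sin \<theta>)"
  let ?H = "\<lambda>z. indicator (ball 0 R) z *\<^sub>R (coherent_coeff \<alpha> z * cnj (coherent_coeff \<beta> z))"
  have pp: "phase_point (fst (?\<rho> z) $ j) (snd (?\<rho> z) $ j) = (if j = i then ?u else 1) * phase_point (fst z $ j) (snd z $ j)" for z j
    by (simp add: coord_rotation_components phase_point_def complex_eq_iff algebra_simps diff_divide_distrib add_divide_distrib)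
  have rot: "?H (?\<rho> z) = (?u ^ \<alpha> i * cnj ?u ^ \<beta> i) * ?H z" for z
  proof -
    have "coherent_coeff \<alpha> (?\<rho> z) * cnj (coherent_coeff \<beta> (?\<rho> z)) =
       (\<Prod>j\<in>UNIV. if j = i then ?u ^ \<alpha> j * cnj ?u ^ \<beta> j else 1) * (coherent_coeff \<alpha> z * cnj (coherent_coeff \<beta> z))"
      unfolding coherent_coeff_mult_cnj coord_rotation_sum_squares[OF cs] pp prod.distrib[symmetric]
      by (intro prod.cong refl) (auto simp: power_mult_distrib mult_ac)
    moreover have "indicator (ball 0 R) (?\<rho> z) = (indicator (ball 0 R) z :: real)"
      by (simp add: indicator_def norm_coord_rotation[OF cs])
    ultimately show ?thesis by (simp add: mult_ac)
  qed
  have [measurable]: "?\<rho> \<in> measurable lborel borel"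
    unfolding coord_rotation_def[abs_def] measurable_lborel2 by (intro borel_measurable_continuous_onI continuous_intros)
  have "(LINT z|lborel. ?H z) = (LINT z|distr lborel borel ?\<rho>. ?H z)"
    by (simp add: distr_lborel_coord_rotation[OF cs c])
  also have "\<dots> = (LINT z|lborel. ?H (?\<rho> z))"
    by (rule integral_distr[OF \<open>?\<rho> \<in> measurable lborel borel\<close>])
       (rule borel_measurable_scaleR[OF borel_measurable_indicator
          borel_measurable_times[OF borel_measurable_coherent_coeff
            borel_measurable_cnj[OF borel_measurable_coherent_coeff]]], simp)
  also have "\<dots> = (?u ^ \<alpha> i * cnj ?u ^ \<beta> i) * (LINT z|lborel. ?H z)"
    unfolding rot by (rule integral_mult_right_zero)
  finally have "(1 - ?u ^ \<alpha> i * cnj ?u ^ \<beta> i) * (LINT z|lborel. ?H z) = 0"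
    unfolding left_diff_distrib mult_1_left by (simp only: right_minus_eq)
  moreover have "1 - ?u ^ \<alpha> i * cnj ?u ^ \<beta> i \<noteq> 0" using u by (metis right_minus_eq)
  ultimately show ?thesis by (simp only: mult_eq_0_iff simp_thms)
qed

section \<open>Coefficients as ball integrals\<close>

lemma borel_measurable_stft_gauss [measurable]:
  assumes "f \<in> pilipovic_dual" shows "stft_gauss f \<in> borel_measurable borel"
proof -
  have "(\<lambda>z. \<Sum>\<^sub>\<infinity>\<alpha>. f \<alpha> * cnj (coherent_coeff \<alpha> z)) \<in> borel_measurable borel"
    by (rule borel_measurable_infsum) (simp_all add: summable_on_stft[OF assms])
  then show ?thesis unfolding stft_gauss_altdef[abs_def] by measurable
qed

lemma stft_gauss_bounded:
  assumes "f \<in> pilipovic_dual"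
  shows "\<exists>M\<ge>0. \<forall>z. norm z \<le> R \<longrightarrow> norm (stft_gauss f z) \<le> M"
proof (cases "R \<ge> 0")
  case True
  let ?M = "\<Sum>\<^sub>\<infinity>\<alpha>. norm (f \<alpha>) * monomial_weight R \<alpha>"
  have "norm (stft_gauss f z) \<le> stft_const TYPE('a) * ?M" if "norm z \<le> R" for z
  proof -
    have "norm (\<Sum>\<^sub>\<infinity>\<alpha>. f \<alpha> * cnj (coherent_coeff \<alpha> z)) \<le> (\<Sum>\<^sub>\<infinity>\<alpha>. norm (f \<alpha> * cnj (coherent_coeff \<alpha> z)))"
      by (rule norm_infsum_bound[OF summable_on_stft[OF assms]])
    also have "\<dots> \<le> ?M"
      by (rule infsum_mono[OF summable_on_stft[OF assms] pilipovic_dual_summable[OF assms True]])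
         (simp add: norm_mult mult_left_mono norm_coherent_coeff_le that)
    finally show ?thesis unfolding stft_gauss_altdef by (simp add: norm_mult mult_left_mono)
  qed
  moreover have "0 \<le> ?M" by (intro infsum_nonneg mult_nonneg_nonneg monomial_weight_nonneg True) auto
  ultimately show ?thesis by (intro exI[of _ "stft_const TYPE('a) * ?M"]) auto
next
  case False
  then have "\<not> norm z \<le> R" for z :: "(real ^ 'a) \<times> (real ^ 'a)" using norm_ge_zero[of z] by linarith
  then show ?thesis by auto
qed

lemma integrable_ball_bounded:
  fixes h :: "'a::euclidean_space \<Rightarrow> 'b::{banach, second_countable_topology}"
  assumes [measurable]: "h \<in> borel_measurable borel" and b: "\<And>z. z \<in> ball w R \<Longrightarrow> norm (h z) \<le> M"
  shows "integrable lborel (\<lambda>z. indicator (ball w R) z *\<^sub>R h z)"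
proof (rule Bochner_Integration.integrable_bound)
  show "integrable lborel (\<lambda>z. M * indicator (ball w R) z :: real)"
    using emeasure_bounded_finite[OF bounded_ball, of w R]
    by (intro integrable_mult_right integrable_real_indicator) auto
  show "AE z in lborel. norm (indicator (ball w R) z *\<^sub>R h z) \<le> norm (M * indicator (ball w R) z :: real)"
    using b by (intro AE_I2) (auto simp: indicator_def intro: order.trans abs_ge_self)
  show "(\<lambda>z. indicator (ball w R) z *\<^sub>R h z) \<in> borel_measurable lborel"
    by (rule borel_measurable_scaleR[OF borel_measurable_indicator]) (simp_all add: assms(1))
qed

lemma integral_indicator_ball: "(LINT z|lborel. K * indicator (ball w R) z) = K * measure lborel (ball w R)"
  by simp

text \<open>A squared norm: that of \<open>coherent_coeff \<alpha>\<close> in L2 of the ball. The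
  radius is kept finite because the transform is controlled only on bounded sets.\<close>

definition coherent_norm :: "real \<Rightarrow> ('d::finite \<Rightarrow> nat) \<Rightarrow> real" where
  "coherent_norm R \<alpha> = (LINT z|lborel. indicator (ball 0 R) z *\<^sub>R (norm (coherent_coeff \<alpha> z))\<^sup>2)"

text \<open>On the ball the series of the transform is dominated by the summable \<open>?b\<close>
  and may be integrated term by term; orthogonality leaves the index \<alpha> alone.\<close>

lemma stft_gauss_extraction:
  fixes f :: "'d::finite hermite_series"
  assumes f: "f \<in> pilipovic_dual" and R: "R > 0"
  shows "(LINT z|lborel. indicator (ball 0 R) z *\<^sub>R (stft_gauss f z * coherent_coeff \<alpha> z)) =
     complex_of_real (stft_const TYPE('d)) * f \<alpha> * complex_of_real (coherent_norm R \<alpha>)"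
proof -
  let ?c = "complex_of_real (stft_const TYPE('d))"
  let ?B = "ball (0 :: (real ^ 'd) \<times> (real ^ 'd)) R"
  let ?g = "\<lambda>\<beta> z. indicator ?B z *\<^sub>R (?c * f \<beta> * (coherent_coeff \<alpha> z * cnj (coherent_coeff \<beta> z)))"
  let ?b = "\<lambda>\<beta>. stft_const TYPE('d) * monomial_weight R \<alpha> * (norm (f \<beta>) * monomial_weight R \<beta>)"
  have mw: "monomial_weight R \<beta> \<ge> 0" for \<beta> :: "'d \<Rightarrow> nat" using R by (simp add: monomial_weight_nonneg)
  have b: "norm (?c * f \<beta> * (coherent_coeff \<alpha> z * cnj (coherent_coeff \<beta> z))) \<le> ?b \<beta>" if "z \<in> ?B" for \<beta> z
  proof -
    have "norm (coherent_coeff \<alpha> z) * norm (coherent_coeff \<beta> z) \<le> monomial_weight R \<alpha> * monomial_weight R \<beta>"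
      using that mw by (intro mult_mono norm_coherent_coeff_le) auto
    then have "stft_const TYPE('d) * norm (f \<beta>) * (norm (coherent_coeff \<alpha> z) * norm (coherent_coeff \<beta> z)) \<le>
        stft_const TYPE('d) * norm (f \<beta>) * (monomial_weight R \<alpha> * monomial_weight R \<beta>)"
      by (intro mult_left_mono) auto
    then show ?thesis by (simp add: norm_mult mult_ac)
  qed
  have bs: "?b summable_on UNIV"
    using R by (intro summable_on_cmult_right pilipovic_dual_summable f) auto
  have int: "integrable lborel (?g \<beta>)" for \<beta>
    by (rule integrable_ball_bounded[where M = "?b \<beta>"]) (use b in auto)
  have nb: "norm (?g \<beta> z) \<le> ?b \<beta> * indicator ?B z" for \<beta> z
    using b[of z \<beta>] mw by (auto simp: indicator_def)
  have bnn: "?b \<beta> \<ge> 0" for \<beta> using mw by (intro mult_nonneg_nonneg) auto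
  have "((\<lambda>\<beta>. LINT z|lborel. ?g \<beta> z) has_sum (LINT z|lborel. (\<Sum>\<^sub>\<infinity>\<beta>. ?g \<beta> z))) UNIV"
  proof (rule has_sum_integral[OF _ int])
    show "(\<lambda>\<beta>. norm (?g \<beta> z)) summable_on UNIV" for z
      by (rule summable_on_comparison_test[OF bs]) (use nb[where z = z] bnn in \<open>auto simp: indicator_def split: if_splits\<close>)
    show "(\<lambda>\<beta>. LINT z|lborel. norm (?g \<beta> z)) summable_on UNIV"
    proof (rule summable_on_comparison_test)
      show "(\<lambda>\<beta>. ?b \<beta> * measure lborel ?B) summable_on UNIV"
        by (intro summable_on_cmult_left bs)
      fix \<beta>
      have "(LINT z|lborel. norm (?g \<beta> z)) \<le> (LINT z|lborel. ?b \<beta> * indicator ?B z)"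
        by (intro integral_mono integrable_norm int nb)
           (use emeasure_bounded_finite[OF bounded_ball, of 0 R] in \<open>auto intro!: integrable_mult_right integrable_real_indicator\<close>)
      also have "\<dots> = ?b \<beta> * measure lborel ?B" by (rule integral_indicator_ball)
      finally show "(LINT z|lborel. norm (?g \<beta> z)) \<le> ?b \<beta> * measure lborel ?B" .
    qed auto
  qed auto
  moreover have "(LINT z|lborel. ?g \<beta> z) = (if \<beta> = \<alpha> then ?c * f \<alpha> * complex_of_real (coherent_norm R \<alpha>) else 0)" for \<beta>
  proof -
    have "(LINT z|lborel. ?g \<beta> z) = (LINT z|lborel. ?c * f \<beta> * (indicator ?B z *\<^sub>R (coherent_coeff \<alpha> z * cnj (coherent_coeff \<beta> z))))"
      by simp
    also have "\<dots> = ?c * f \<beta> * (LINT z|lborel. indicator ?B z *\<^sub>R (coherent_coeff \<alpha> z * cnj (coherent_coeff \<beta> z)))"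
      by (rule integral_mult_right_zero)
    also have "\<dots> = (if \<beta> = \<alpha> then ?c * f \<alpha> * complex_of_real (coherent_norm R \<alpha>) else 0)"
    proof (cases "\<beta> = \<alpha>")
      case True
      have "(LINT z|lborel. indicator ?B z *\<^sub>R (coherent_coeff \<alpha> z * cnj (coherent_coeff \<alpha> z))) =
          (LINT z|lborel. complex_of_real (indicator ?B z *\<^sub>R (norm (coherent_coeff \<alpha> z))\<^sup>2))"
        by (intro Bochner_Integration.integral_cong refl) (simp add: complex_norm_square[symmetric] scaleR_conv_of_real)
      also have "\<dots> = complex_of_real (coherent_norm R \<alpha>)"
        unfolding coherent_norm_def by (rule integral_complex_of_real)
      finally show ?thesis using True by simp
    qed (simp add: coherent_coeff_orthogonal)
    finally show ?thesis .
  qed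
  moreover have "(\<Sum>\<^sub>\<infinity>\<beta>. ?g \<beta> z) = indicator ?B z *\<^sub>R (stft_gauss f z * coherent_coeff \<alpha> z)" for z
  proof -
    have "(\<Sum>\<^sub>\<infinity>\<beta>. ?g \<beta> z) = (\<Sum>\<^sub>\<infinity>\<beta>. (indicator ?B z *\<^sub>R ?c * coherent_coeff \<alpha> z) * (f \<beta> * cnj (coherent_coeff \<beta> z)))"
      by (intro infsum_cong) (simp add: mult_ac)
    also have "\<dots> = (indicator ?B z *\<^sub>R ?c * coherent_coeff \<alpha> z) * (\<Sum>\<^sub>\<infinity>\<beta>. f \<beta> * cnj (coherent_coeff \<beta> z))"
      by (rule infsum_cmult_right')
    finally show ?thesis unfolding stft_gauss_altdef by (simp add: mult_ac)
  qed
  ultimately have "((\<lambda>\<beta>. if \<beta> = \<alpha> then ?c * f \<alpha> * complex_of_real (coherent_norm R \<alpha>) else 0) has_sum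
      (LINT z|lborel. indicator ?B z *\<^sub>R (stft_gauss f z * coherent_coeff \<alpha> z))) UNIV" by simp
  moreover have "((\<lambda>\<beta>. if \<beta> = \<alpha> then ?c * f \<alpha> * complex_of_real (coherent_norm R \<alpha>) else 0) has_sum
      (?c * f \<alpha> * complex_of_real (coherent_norm R \<alpha>))) UNIV"
    by (rule has_sum_finite_neutralI[of "{\<alpha>}"]) auto
  ultimately show ?thesis by (rule has_sum_unique)
qed

lemma coherent_norm_ge:
  fixes \<alpha> :: "'d::finite \<Rightarrow> nat"
  assumes S: "S \<subseteq> ball 0 R" "S \<in> sets borel" and a: "a \<ge> 0" "\<And>z. z \<in> S \<Longrightarrow> a \<le> norm (coherent_coeff \<alpha> z)" and R: "R > 0"
  shows "coherent_norm R \<alpha> \<ge> a\<^sup>2 * measure lborel S"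
proof -
  have fin: "emeasure lborel S < \<infinity>" using S(1) by (meson bounded_ball bounded_subset emeasure_bounded_finite)
  have "a\<^sup>2 * measure lborel S = (LINT z|lborel. a\<^sup>2 * indicator S z)" by simp
  also have "\<dots> \<le> coherent_norm R \<alpha>"
    unfolding coherent_norm_def
  proof (rule integral_mono)
    show "integrable lborel (\<lambda>z. a\<^sup>2 * indicator S z)"
      using fin S by (intro integrable_mult_right integrable_real_indicator) auto
    show "integrable lborel (\<lambda>z. indicator (ball 0 R) z *\<^sub>R (norm (coherent_coeff \<alpha> z))\<^sup>2)"
    proof (rule integrable_ball_bounded[where M = "(monomial_weight R \<alpha>)\<^sup>2"])
      show "norm ((norm (coherent_coeff \<alpha> z))\<^sup>2) \<le> (monomial_weight R \<alpha>)\<^sup>2" if "z \<in> ball 0 R" for z :: "(real ^ 'd) \<times> (real ^ 'd)"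
        using that by (auto intro!: power_mono norm_coherent_coeff_le)
    qed measurable
    show "a\<^sup>2 * indicator S z \<le> indicator (ball 0 R) z *\<^sub>R (norm (coherent_coeff \<alpha> z))\<^sup>2" for z
      using S a by (auto simp: indicator_def intro: power_mono)
  qed
  finally show ?thesis .
qed

lemma norm_coherent_coeff:
  fixes z :: "(real ^ 'd::finite) \<times> (real ^ 'd)"
  shows "norm (coherent_coeff \<alpha> z) = exp (- (norm z)\<^sup>2 / 4) *
    (\<Prod>i\<in>UNIV. norm (phase_point (fst z $ i) (snd z $ i)) ^ \<alpha> i / sqrt (fact (\<alpha> i)))"
proof -
  have "exp (- (norm z)\<^sup>2 / 4) = (\<Prod>i\<in>UNIV. exp (- ((fst z $ i)\<^sup>2 + (snd z $ i)\<^sup>2) / 4))"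
  proof -
    have "- (norm z)\<^sup>2 / 4 = (\<Sum>i\<in>UNIV. - ((fst z $ i)\<^sup>2 + (snd z $ i)\<^sup>2) / 4)"
      unfolding norm_prod_vec_power2 by (simp only: sum_negf[symmetric] sum_divide_distrib)
    then show ?thesis by (simp only: exp_sum finite)
  qed
  then show ?thesis
    unfolding coherent_coeff_altdef prod_norm[symmetric]
    by (simp only: prod.distrib[symmetric]) (simp add: norm_mult norm_divide norm_power norm_coherent0)
qed

lemma stft_gauss_extraction_bound:
  fixes f :: "'d::finite hermite_series"
  assumes f: "f \<in> pilipovic_dual" and R: "R > 0"
  shows "stft_const TYPE('d) * norm (f \<alpha>) * coherent_norm R \<alpha> \<le>
     monomial_weight R \<alpha> * (LINT z|lborel. indicator (ball 0 R) z *\<^sub>R norm (stft_gauss f z))"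
proof -
  let ?B = "ball (0 :: (real ^ 'd) \<times> (real ^ 'd)) R"
  have [measurable]: "stft_gauss f \<in> borel_measurable borel" by (rule borel_measurable_stft_gauss[OF f])
  obtain M where M: "M \<ge> 0" "\<And>z. norm z \<le> R \<Longrightarrow> norm (stft_gauss f z) \<le> M"
    using stft_gauss_bounded[OF f, of R] by blast
  have mw: "monomial_weight R \<alpha> \<ge> 0" using R by (simp add: monomial_weight_nonneg)
  have cn: "coherent_norm R \<alpha> \<ge> 0" unfolding coherent_norm_def by (intro integral_nonneg_AE AE_I2) auto
  have "stft_const TYPE('d) * norm (f \<alpha>) * coherent_norm R \<alpha> =
      norm (LINT z|lborel. indicator ?B z *\<^sub>R (stft_gauss f z * coherent_coeff \<alpha> z))"
    unfolding stft_gauss_extraction[OF f R] using cn by (simp add: norm_mult)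
  also have "\<dots> \<le> (LINT z|lborel. norm (indicator ?B z *\<^sub>R (stft_gauss f z * coherent_coeff \<alpha> z)))"
    by (rule integral_norm_bound)
  also have "\<dots> \<le> (LINT z|lborel. monomial_weight R \<alpha> * (indicator ?B z *\<^sub>R norm (stft_gauss f z)))"
  proof (rule integral_mono)
    show "integrable lborel (\<lambda>z. norm (indicator ?B z *\<^sub>R (stft_gauss f z * coherent_coeff \<alpha> z)))"
      by (intro integrable_norm integrable_ball_bounded[where M = "M * monomial_weight R \<alpha>"])
         (auto simp: norm_mult intro!: mult_mono M norm_coherent_coeff_le)
    show "integrable lborel (\<lambda>z. monomial_weight R \<alpha> * (indicator ?B z *\<^sub>R norm (stft_gauss f z)))"
      by (intro integrable_mult_right integrable_ball_bounded[where M = M]) (auto intro!: M)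
    show "norm (indicator ?B z *\<^sub>R (stft_gauss f z * coherent_coeff \<alpha> z)) \<le>
      monomial_weight R \<alpha> * (indicator ?B z *\<^sub>R norm (stft_gauss f z))" for z
    proof (cases "z \<in> ?B")
      case True
      then have "norm (coherent_coeff \<alpha> z) \<le> monomial_weight R \<alpha>" by (intro norm_coherent_coeff_le) simp
      from mult_right_mono[OF this norm_ge_zero[of "stft_gauss f z"]] True show ?thesis
        by (simp add: norm_mult mult.commute)
    qed simp
  qed
  also have "\<dots> = monomial_weight R \<alpha> * (LINT z|lborel. indicator ?B z *\<^sub>R norm (stft_gauss f z))"
    by (rule integral_mult_right_zero)
  finally show ?thesis .
qed

text \<open>A Cauchy estimate: a bound for the transform on one ball controls all coefficients
  against a prescribed weight. It converts dominated families of transforms into dominated families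
  of coefficients. The point is a lower bound of \<open>coherent_norm R \<alpha>\<close> with the
  right growth in \<alpha>.\<close>

lemma hermite_coefficient_bound:
  assumes "s > 0"
  shows "\<exists>C\<ge>0. \<exists>R>0. \<forall>f \<in> (pilipovic_dual :: 'd::finite hermite_series set). \<forall>M\<ge>0.
     (\<forall>z. norm z < R \<longrightarrow> norm (stft_gauss f z) \<le> M) \<longrightarrow> (\<forall>\<alpha>. norm (f \<alpha>) * monomial_weight s \<alpha> \<le> C * M)"
proof -
  let ?d = "real CARD('d)"
  \<comment> \<open>Both constants are fixed by what follows. On a small ball inside the ball of
    radius R all phase points have modulus at least \<kappa> R. The extraction then loses the
    quotient of \<open>monomial_weight R\<close> by the square of
    \<open>monomial_weight (\<kappa> * R)\<close>, which is the reciprocal of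
    \<open>monomial_weight s\<close> exactly when s R = (\<kappa> R)^2.\<close>
  define \<kappa> where "\<kappa> = 1 / (4 * sqrt 2 * ?d)"
  have \<kappa>: "\<kappa> > 0" by (simp add: \<kappa>_def)
  define R where "R = s / \<kappa>\<^sup>2"
  have R: "R > 0" using assms \<kappa> by (simp add: R_def)
  have s: "s * R = (\<kappa> * R)\<^sup>2" using \<kappa> by (simp add: R_def power2_eq_square)
  \<comment> \<open>The point with all positions t has norm at most d t = R / 2. Within t / 2 of it
    every position is at least t / 2, and t / (2 sqrt 2) = \<kappa> R.\<close>
  define t where "t = R / (2 * ?d)"
  have t: "t > 0" "?d * t = R / 2" "t / 2 \<le> R / 4" using R by (auto simp: t_def field_simps)
  define p where "p = ((\<chi> i. t) :: real ^ 'd, 0 :: real ^ 'd)"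
  have "norm p \<le> R / 2"
    using norm_le_l1_cart[of "(\<chi> i. t) :: real ^ 'd"] t by (simp add: p_def norm_prod_def)
  then have "norm z < R" if "dist p z < t / 2" for z
    using norm_triangle_ineq2[of z p] t R that by (simp add: dist_norm norm_minus_commute)
  then have sub: "ball p (t / 2) \<subseteq> ball 0 R" by auto
  define V where "V = measure lborel (ball p (t / 2))"
  have V: "V > 0" unfolding V_def using t by (simp add: content_ball_pos)
  define C where "C = measure lborel (ball (0 :: (real ^ 'd) \<times> (real ^ 'd)) R) / (stft_const TYPE('d) * (exp (- R\<^sup>2 / 4))\<^sup>2 * V)"
  have "C \<ge> 0" unfolding C_def using V by simp
  moreover have "norm (f \<alpha>) * monomial_weight s \<alpha> \<le> C * M"
    if f: "f \<in> pilipovic_dual" and M: "M \<ge> 0" "\<And>z. norm z < R \<Longrightarrow> norm (stft_gauss f z) \<le> M" for f M and \<alpha> :: "'d \<Rightarrow> nat"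
  proof -
    let ?B = "ball (0 :: (real ^ 'd) \<times> (real ^ 'd)) R"
    have [measurable]: "stft_gauss f \<in> borel_measurable borel" by (rule borel_measurable_stft_gauss[OF f])
    have le: "exp (- R\<^sup>2 / 4) * monomial_weight (\<kappa> * R) \<alpha> \<le> norm (coherent_coeff \<alpha> z)" if z: "z \<in> ball p (t / 2)" for z
    proof -
      have "norm z < R" using sub z by auto
      then have "(norm z)\<^sup>2 \<le> R\<^sup>2" by (intro power_mono) auto
      moreover have "\<kappa> * R \<le> norm (phase_point (fst z $ i) (snd z $ i))" for i
      proof -
        have "\<bar>(fst p - fst z) $ i\<bar> \<le> norm (fst p - fst z)" by (rule component_le_norm_cart)
        also have "\<dots> \<le> norm (p - z)" by (simp add: norm_prod_def)
        also have "\<dots> < t / 2" using z by (simp add: dist_norm)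
        finally have "t / 2 \<le> fst z $ i" by (simp add: p_def abs_if split: if_splits)
        then have "t / 2 / sqrt 2 \<le> \<bar>Re (phase_point (fst z $ i) (snd z $ i))\<bar>"
          using t divide_right_mono[of "t / 2" "fst z $ i" "sqrt 2"] by (simp add: phase_point_def)
        also have "\<dots> \<le> norm (phase_point (fst z $ i) (snd z $ i))" by (rule abs_Re_le_cmod)
        also have "t / 2 / sqrt 2 = \<kappa> * R" by (simp add: t_def \<kappa>_def)
        finally show ?thesis .
      qed
      ultimately show ?thesis
        unfolding norm_coherent_coeff monomial_weight_def using \<kappa> R
        by (intro mult_mono prod_mono conjI divide_right_mono power_mono) (auto intro!: prod_nonneg)
    qed
    have mw: "monomial_weight (\<kappa> * R) \<alpha> > 0" "monomial_weight R \<alpha> > 0" using \<kappa> R by (auto intro!: monomial_weight_pos)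
    have cn: "(exp (- R\<^sup>2 / 4) * monomial_weight (\<kappa> * R) \<alpha>)\<^sup>2 * V \<le> coherent_norm R \<alpha>"
      unfolding V_def by (rule coherent_norm_ge[OF sub]) (use le mw R in auto)
    have prod: "monomial_weight s \<alpha> * monomial_weight R \<alpha> = (monomial_weight (\<kappa> * R) \<alpha>)\<^sup>2"
    proof -
      have "s ^ a * R ^ a = (\<kappa> * R) ^ a * (\<kappa> * R) ^ a" for a
        unfolding power_mult_distrib[symmetric, of s] s by (simp add: power_mult_distrib power2_eq_square mult_ac)
      then show ?thesis
        unfolding monomial_weight_def power2_eq_square prod.distrib[symmetric] times_divide_times_eq by simp
    qed
    let ?c = "stft_const TYPE('d)"
    have "?c * norm (f \<alpha>) * ((exp (- R\<^sup>2 / 4) * monomial_weight (\<kappa> * R) \<alpha>)\<^sup>2 * V) \<le> ?c * norm (f \<alpha>) * coherent_norm R \<alpha>"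
      by (intro mult_left_mono cn) auto
    also have "\<dots> \<le> monomial_weight R \<alpha> * (LINT z|lborel. indicator ?B z *\<^sub>R norm (stft_gauss f z))"
      by (rule stft_gauss_extraction_bound[OF f R])
    also have "\<dots> \<le> monomial_weight R \<alpha> * (LINT z|lborel. M * indicator ?B z)"
    proof (intro mult_left_mono integral_mono)
      show "integrable lborel (\<lambda>z. indicator ?B z *\<^sub>R norm (stft_gauss f z))"
        by (intro integrable_ball_bounded[where M = M]) (auto intro!: M)
      show "integrable lborel (\<lambda>z. M * indicator ?B z)"
        using emeasure_bounded_finite[OF bounded_ball, of 0 R] by (intro integrable_mult_right integrable_real_indicator) auto
    qed (use M mw in \<open>auto simp: indicator_def\<close>)
    also have "\<dots> = monomial_weight R \<alpha> * (M * measure lborel ?B)" by simp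
    finally have "monomial_weight R \<alpha> * (?c * norm (f \<alpha>) * ((exp (- R\<^sup>2 / 4))\<^sup>2 * monomial_weight s \<alpha> * V)) \<le>
       monomial_weight R \<alpha> * (M * measure lborel ?B)"
      unfolding power_mult_distrib prod[symmetric] by (simp add: mult_ac)
    then have "?c * norm (f \<alpha>) * ((exp (- R\<^sup>2 / 4))\<^sup>2 * monomial_weight s \<alpha> * V) \<le> M * measure lborel ?B"
      using mw by simp
    then show ?thesis unfolding C_def using V by (simp add: field_simps)
  qed
  ultimately show ?thesis using R by blast
qed

section \<open>Mean value inequalities\<close>

lemma coherent_coeff_0: "coherent_coeff \<alpha> 0 = (if \<alpha> = (\<lambda>_. 0) then 1 else 0)"
proof (cases "\<alpha> = (\<lambda>_. 0)")
  case True
  then show ?thesis by (simp add: coherent_coeff_altdef coherent0_def)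
next
  case False
  then obtain i where "\<alpha> i \<noteq> 0" by auto
  then have "coherent_coeff \<alpha> 0 = 0"
    unfolding coherent_coeff_altdef by (intro prod_zero) (auto intro!: exI[of _ i] simp: phase_point_def complex_eq_iff)
  then show ?thesis using False by simp
qed

lemma stft_gauss_0:
  fixes f :: "'d::finite hermite_series"
  shows "stft_gauss f 0 = complex_of_real (stft_const TYPE('d)) * f (\<lambda>_. 0)"
proof -
  have "(\<Sum>\<^sub>\<infinity>\<alpha>. f \<alpha> * cnj (coherent_coeff \<alpha> 0)) = f (\<lambda>_. 0)"
    by (rule infsumI, rule has_sum_finite_neutralI[of "{\<lambda>_. 0}"]) (auto simp: coherent_coeff_0)
  then show ?thesis by (simp add: stft_gauss_altdef)
qed

text \<open>The value at 0 is the coefficient of index 0 up to a constant, and the coherent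
  coefficient of that index is a pure Gaussian. On a ball of radius at most 1 its modulus is at
  least exp (- 1/4), whose square accounts for exp (1/2).\<close>

lemma stft_gauss_mean_value_0:
  fixes f :: "'d::finite hermite_series"
  assumes f: "f \<in> pilipovic_dual" and \<delta>: "0 < \<delta>" "\<delta> \<le> 1"
  shows "norm (stft_gauss f 0) * measure lborel (ball (0 :: (real ^ 'd) \<times> (real ^ 'd)) \<delta>) \<le>
     exp (1/2) * (LINT z|lborel. indicator (ball 0 \<delta>) z *\<^sub>R norm (stft_gauss f z))"
proof -
  let ?B = "ball (0 :: (real ^ 'd) \<times> (real ^ 'd)) \<delta>"
  let ?I = "LINT z|lborel. indicator ?B z *\<^sub>R norm (stft_gauss f z)"
  have "(exp (- 1/4))\<^sup>2 * measure lborel ?B \<le> coherent_norm \<delta> (\<lambda>_ :: 'd. 0)"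
  proof (rule coherent_norm_ge)
    fix z assume "z \<in> ?B"
    then have "(norm z)\<^sup>2 \<le> 1" using \<delta> by (simp add: abs_square_le_1)
    then show "exp (- 1/4) \<le> norm (coherent_coeff (\<lambda>_ :: 'd. 0) z)"
      unfolding norm_coherent_coeff by simp
  qed (use \<delta> in auto)
  then have "stft_const TYPE('d) * norm (f (\<lambda>_. 0)) * ((exp (- 1/4))\<^sup>2 * measure lborel ?B) \<le>
      stft_const TYPE('d) * norm (f (\<lambda>_. 0)) * coherent_norm \<delta> (\<lambda>_ :: 'd. 0)"
    by (intro mult_left_mono) auto
  also have "\<dots> \<le> ?I"
    using stft_gauss_extraction_bound[OF f \<delta>(1), of "\<lambda>_. 0"] by (simp add: monomial_weight_def)
  finally have "norm (stft_gauss f 0) * (exp (- 1/2) * measure lborel ?B) \<le> ?I"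
    by (simp add: stft_gauss_0 norm_mult power2_eq_square flip: exp_add)
  then have "exp (1/2) * (norm (stft_gauss f 0) * (exp (- 1/2) * measure lborel ?B)) \<le> exp (1/2) * ?I"
    by (intro mult_left_mono) auto
  then show ?thesis by (simp add: mult_ac exp_minus)
qed

lemma integral_lborel_translate:
  fixes h :: "'a::euclidean_space \<Rightarrow> real"
  assumes [measurable]: "h \<in> borel_measurable borel"
  shows "(LINT x|lborel. h (c + x)) = (LINT x|lborel. h x)"
proof -
  have "(LINT x|lborel. h x) = (LINT x|distr lborel borel ((+) c). h x)"
    by (simp add: lborel_distr_plus)
  also have "\<dots> = (LINT x|lborel. h (c + x))" by (rule integral_distr) auto
  finally show ?thesis by simp
qed

lemma stft_gauss_mean_value:
  fixes f :: "'d::finite hermite_series"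
  assumes f: "f \<in> pilipovic_dual" and \<delta>: "0 < \<delta>" "\<delta> \<le> 1"
  shows "norm (stft_gauss f w) * measure lborel (ball (0 :: (real ^ 'd) \<times> (real ^ 'd)) \<delta>) \<le>
     exp (1/2) * (LINT z|lborel. indicator (ball w \<delta>) z *\<^sub>R norm (stft_gauss f z))"
proof -
  define g where "g = tf_shift (fst (- w)) (snd (- w)) f"
  have g: "g \<in> pilipovic_dual" unfolding g_def by (rule tf_shift_pilipovic_dual[OF f])
  have gz: "norm (stft_gauss g z) = norm (stft_gauss f (w + z))" for z
    unfolding g_def norm_stft_gauss_tf_shift[OF f] prod.collapse by (simp add: add.commute)
  have [measurable]: "stft_gauss f \<in> borel_measurable borel" by (rule borel_measurable_stft_gauss[OF f])
  have m: "(\<lambda>z. indicator (ball w \<delta>) z *\<^sub>R norm (stft_gauss f z)) \<in> borel_measurable borel"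
    by (rule borel_measurable_scaleR[OF borel_measurable_indicator]) simp_all
  have "(LINT z|lborel. indicator (ball 0 \<delta>) z *\<^sub>R norm (stft_gauss g z)) =
      (LINT z|lborel. indicator (ball w \<delta>) (w + z) *\<^sub>R norm (stft_gauss f (w + z)))"
    unfolding gz by (intro Bochner_Integration.integral_cong refl) (simp add: indicator_def dist_norm)
  also have "\<dots> = (LINT z|lborel. indicator (ball w \<delta>) z *\<^sub>R norm (stft_gauss f z))"
    by (rule integral_lborel_translate[OF m])
  finally show ?thesis using stft_gauss_mean_value_0[OF g \<delta>] by (simp add: gz)
qed

text \<open>For \<open>r < 1\<close> the estimate follows from the one for \<open>r = 1\<close> by absorption: compare with the
  supremum \<open>s\<close> of \<open>\<bar>V f u\<bar> (1 - dist w u)\<^sup>k\<close> over the unit ball, with \<open>k r\<close> the dimension.\<close>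

lemma stft_gauss_power_mean:
  assumes r: "0 < r" "r \<le> 1"
  shows "\<exists>K\<ge>0. \<forall>f \<in> (pilipovic_dual :: 'd::finite hermite_series set). \<forall>w.
     norm (stft_gauss f w) powr r \<le> K * (LINT u|lborel. indicator (ball w 1) u *\<^sub>R (norm (stft_gauss f u) powr r))"
proof -
  let ?n = "DIM((real ^ 'd) \<times> (real ^ 'd))"
  define k where "k = ?n / r"
  have k: "k > 0" using r by (simp add: k_def)
  define V where "V = measure lborel (ball (0 :: (real ^ 'd) \<times> (real ^ 'd)) 1)"
  have V: "V > 0" unfolding V_def by (simp add: content_ball_pos)
  define K where "K = 2 powr k * exp (1/2) / V"
  have "K \<ge> 0" using V by (simp add: K_def)
  moreover have "norm (stft_gauss f w) powr r \<le> K * (LINT u|lborel. indicator (ball w 1) u *\<^sub>R (norm (stft_gauss f u) powr r))"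
    if f: "f \<in> pilipovic_dual" for f :: "'d hermite_series" and w
  proof -
    let ?F = "\<lambda>u. norm (stft_gauss f u)"
    define I where "I = (LINT u|lborel. indicator (ball w 1) u *\<^sub>R (?F u powr r))"
    have F [measurable]: "stft_gauss f \<in> borel_measurable borel" by (rule borel_measurable_stft_gauss[OF f])
    obtain M where M: "M \<ge> 0" "\<And>u. norm u \<le> norm w + 1 \<Longrightarrow> ?F u \<le> M"
      using stft_gauss_bounded[OF f, of "norm w + 1"] by blast
    have FM: "?F u \<le> M" if "dist w u < 1" for u
      using that norm_triangle_ineq2[of u w] by (intro M) (simp add: dist_norm norm_minus_commute)
    have intr: "integrable lborel (\<lambda>u. indicator (ball w 1) u *\<^sub>R (?F u powr r))"
      using r by (intro integrable_ball_bounded[where M = "M powr r"]) (auto intro!: powr_mono2 FM)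
    let ?G = "\<lambda>u. ?F u * (1 - dist w u) powr k"
    \<comment> \<open>Finite because the transform is bounded on bounded sets; this is what permits
      the final division. The weight vanishes towards the boundary and equals 1 at w.\<close>
    define s where "s = (SUP u\<in>ball w 1. ?G u)"
    have G: "?G u \<le> M" if "u \<in> ball w 1" for u
    proof -
      have "(1 - dist w u) powr k \<le> 1"
        using that k zero_le_dist[of w u] by (intro powr_le1) auto
      then have "?G u \<le> M * 1" using that M(1) by (intro mult_mono FM) auto
      then show ?thesis by simp
    qed
    have bdd: "bdd_above (?G ` ball w 1)" by (rule bdd_aboveI2[of _ _ M]) (rule G)
    have Gs: "?G u \<le> s" if "u \<in> ball w 1" for u unfolding s_def by (rule cSUP_upper[OF that bdd])
    have Fw: "?F w \<le> s" using Gs[of w] by simp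
    show ?thesis
    proof (cases "s > 0")
      case False
      then have "?F w = 0" using Fw by (smt (verit) norm_ge_zero)
      moreover have "I \<ge> 0" unfolding I_def by (intro integral_nonneg_AE AE_I2) auto
      ultimately show ?thesis using \<open>K \<ge> 0\<close> by (simp add: I_def)
    next
      case True
      have main: "?G u \<le> K * I * s powr (1 - r)" if u: "u \<in> ball w 1" for u
      proof -
        \<comment> \<open>Half the distance from u to the boundary of the ball: the ball of radius
          \<delta> at u stays inside, at distance at least \<delta> from that boundary.\<close>
        define \<delta> where "\<delta> = (1 - dist w u) / 2"
        have d: "dist w u < 1" "0 \<le> dist w u" using u by simp_all
        have \<delta>3: "1 - dist w u = 2 * \<delta>" by (simp add: \<delta>_def)
        have \<delta>1: "0 < \<delta>" using d(1) \<delta>3 by linarith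
        have \<delta>2: "\<delta> \<le> 1" using d(2) \<delta>3 by linarith
        note \<delta> = \<delta>1 \<delta>2 \<delta>3
        have sub: "dist w z < 1" "\<delta> \<le> 1 - dist w z" if "z \<in> ball u \<delta>" for z
          using that dist_triangle[of w z u] \<delta> by auto
        have Fs: "?F z \<le> s * \<delta> powr (- k)" if z: "z \<in> ball u \<delta>" for z
        proof -
          have "?F z * \<delta> powr k \<le> ?G z"
            using sub(2)[OF z] \<delta> k by (intro mult_left_mono powr_mono2) auto
          also have "\<dots> \<le> s" using sub(1)[OF z] by (intro Gs) auto
          finally show ?thesis using \<delta> by (simp add: powr_minus field_simps)
        qed
        \<comment> \<open>Only the power 1 - r of the function is bounded by the supremum; the power
          r stays under the integral.\<close>
        have pw: "?F z \<le> (s * \<delta> powr (- k)) powr (1 - r) * ?F z powr r" if z: "z \<in> ball u \<delta>" for z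
        proof (cases "?F z = 0")
          case False
          have "?F z = ?F z powr (1 - r) * ?F z powr r" using False by (simp flip: powr_add)
          also have "\<dots> \<le> (s * \<delta> powr (- k)) powr (1 - r) * ?F z powr r"
            using r by (intro mult_right_mono powr_mono2 Fs z) auto
          finally show ?thesis .
        qed simp
        have "measure lborel (ball (0 :: (real ^ 'd) \<times> (real ^ 'd)) \<delta>) = \<delta> ^ ?n * V"
          unfolding V_def using \<delta> content_ball_conv_unit_ball[of \<delta> "0 :: (real ^ 'd) \<times> (real ^ 'd)"] by simp
        then have "?F u * (\<delta> ^ ?n * V) \<le> exp (1/2) * (LINT z|lborel. indicator (ball u \<delta>) z *\<^sub>R ?F z)"
          using stft_gauss_mean_value[OF f \<delta>(1,2), of u] by simp
        also have "\<dots> \<le> exp (1/2) * (LINT z|lborel. (s * \<delta> powr (- k)) powr (1 - r) * (indicator (ball w 1) z *\<^sub>R (?F z powr r)))"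
        proof (intro mult_left_mono integral_mono)
          show "integrable lborel (\<lambda>z. indicator (ball u \<delta>) z *\<^sub>R ?F z)"
            by (rule integrable_ball_bounded[where M = M]) (auto intro!: FM sub)
          show "integrable lborel (\<lambda>z. (s * \<delta> powr (- k)) powr (1 - r) * (indicator (ball w 1) z *\<^sub>R (?F z powr r)))"
            by (intro integrable_mult_right intr)
          show "indicator (ball u \<delta>) z *\<^sub>R ?F z \<le> (s * \<delta> powr (- k)) powr (1 - r) * (indicator (ball w 1) z *\<^sub>R (?F z powr r))" for z
            using pw[of z] sub(1)[of z] by (auto simp: indicator_def)
        qed auto
        also have "\<dots> = exp (1/2) * ((s * \<delta> powr (- k)) powr (1 - r) * I)"
          unfolding I_def by (subst integral_mult_right_zero) simp
        finally have *: "?F u * (\<delta> ^ ?n * V) \<le> exp (1/2) * ((s * \<delta> powr (- k)) powr (1 - r) * I)" .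
        \<comment> \<open>The choice of k makes the losses match: \<delta>^n from the volume and
          \<delta>^(k (1 - r)) from the supremum bound combine to \<delta>^k, the weight in the
          supremum.\<close>
        have "\<delta> powr k = \<delta> ^ ?n * \<delta> powr (k * (1 - r))"
        proof -
          have "k = real ?n + k * (1 - r)" using r by (simp add: k_def field_simps)
          then have "\<delta> powr k = \<delta> powr real ?n * \<delta> powr (k * (1 - r))" by (metis powr_add)
          then show ?thesis using \<delta> by (simp add: powr_realpow del: DIM_prod)
        qed
        then have "?G u * V = 2 powr k * (?F u * (\<delta> ^ ?n * V)) * \<delta> powr (k * (1 - r))"
          unfolding \<delta>(3) using \<delta> by (simp add: powr_mult del: DIM_prod)
        also have "\<dots> \<le> 2 powr k * (exp (1/2) * ((s * \<delta> powr (- k)) powr (1 - r) * I)) * \<delta> powr (k * (1 - r))"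
          by (intro mult_right_mono mult_left_mono *) auto
        also have "(s * \<delta> powr (- k)) powr (1 - r) = s powr (1 - r) * \<delta> powr (- (k * (1 - r)))"
          using True by (simp add: powr_mult powr_powr)
        also have "2 powr k * (exp (1/2) * (s powr (1 - r) * \<delta> powr (- (k * (1 - r))) * I)) * \<delta> powr (k * (1 - r)) =
            2 powr k * exp (1/2) * I * s powr (1 - r)"
        proof -
          have "\<delta> powr (- (k * (1 - r))) * \<delta> powr (k * (1 - r)) = 1" using \<delta> by (simp flip: powr_add)
          then have "2 powr k * exp (1/2) * I * s powr (1 - r) * (\<delta> powr (- (k * (1 - r))) * \<delta> powr (k * (1 - r))) =
              2 powr k * exp (1/2) * I * s powr (1 - r)" by (simp only: mult_1_right)
          then show ?thesis by (simp only: mult_ac)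
        qed
        finally show ?thesis unfolding K_def using V by (simp add: field_simps)
      qed
      \<comment> \<open>The bound holds for every u of the ball, hence for the supremum, and
        dividing by s powr (1 - r) completes the absorption.\<close>
      have "s \<le> K * I * s powr (1 - r)"
        unfolding s_def[of ] by (rule cSUP_least) (use main in \<open>auto simp: s_def[symmetric]\<close>)
      moreover have "s = s powr r * s powr (1 - r)" using True by (simp flip: powr_add)
      ultimately have "s powr r * s powr (1 - r) \<le> K * I * s powr (1 - r)" by simp
      then have "s powr r \<le> K * I" using True by simp
      moreover have "?F w powr r \<le> s powr r" using Fw r by (intro powr_mono2) auto
      ultimately show ?thesis by (simp add: I_def)
    qed
  qed
  ultimately show ?thesis by blast
qed

section \<open>Weights, lattices and the amalgam estimate\<close>

text \<open>A weight is bounded on compact sets only almost everywhere. To bound v at a given z,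
  write z = x + (z - x) with x and x - z both outside the exceptional null set; such x exists since
  the unit ball is not covered by that set and its translate.\<close>

lemma submultiplicative_locally_bounded:
  fixes v :: "'a::euclidean_space \<Rightarrow> real"
  assumes "submultiplicative v"
  shows "\<exists>B>0. \<forall>z. norm z \<le> R \<longrightarrow> v z \<le> B"
proof -
  have w: "weight v" and even: "\<And>x. v (- x) = v x" using assms by (auto simp: submultiplicative_def)
  have pos: "v x > 0" for x using w by (simp add: weight_def)
  obtain C where C: "C > 0" "\<And>x y. v (x + y) \<le> C * (v x * v y)"
    using assms unfolding submultiplicative_def by blast
  let ?K = "cball (0::'a) (\<bar>R\<bar> + 1)"
  obtain D where "AE x in lebesgue. x \<in> ?K \<longrightarrow> v x \<le> D"
    using w compact_cball[of "0::'a" "\<bar>R\<bar> + 1"] unfolding weight_def by blast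
  then obtain N where N: "\<And>x. x \<notin> N \<Longrightarrow> x \<in> ?K \<Longrightarrow> v x \<le> D" "negligible N"
    by (rule AE_E3) (auto simp: negligible_iff_null_sets)
  have "v z \<le> C * (\<bar>D\<bar> * \<bar>D\<bar>) + 1" if z: "norm z \<le> R" for z
  proof -
    have "negligible (N \<union> (+) z ` N)" using N(2) by (intro negligible_Un negligible_translation)
    moreover have "\<not> negligible (ball (0::'a) 1)" by (rule open_not_negligible) auto
    ultimately obtain x where x: "x \<in> ball 0 1" "x \<notin> N" "x \<notin> (+) z ` N"
      by (metis (no_types, lifting) Un_iff negligible_subset subsetI)
    have "norm (x - z) \<le> 1 + R" using x(1) z norm_triangle_ineq4[of x z] by auto
    moreover have "x - z \<notin> N" using x(3) by (metis add_diff_cancel_left' diff_add_cancel image_eqI add.commute)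
    ultimately have 1: "v (x - z) \<le> D" by (intro N(1)) auto
    have 2: "v x \<le> D" using x(1,2) by (intro N(1)) auto
    have "v z \<le> C * (v x * v (z - x))" using C(2)[of x "z - x"] by simp
    also have "v (z - x) = v (x - z)" using even[of "x - z"] by simp
    also have "C * (v x * v (x - z)) \<le> C * (\<bar>D\<bar> * \<bar>D\<bar>)"
      using C(1) 1 2 pos[of x] pos[of "x - z"] by (intro mult_left_mono mult_mono) auto
    finally show ?thesis by simp
  qed
  moreover have "C * (\<bar>D\<bar> * \<bar>D\<bar>) + 1 > 0" using C(1) by (simp add: add_nonneg_pos)
  ultimately show ?thesis by blast
qed

text \<open>Walk from 0 to z in n equal steps of norm at most 1; each step costs a fixed factor, and
  n is at most norm z + 2.\<close>

lemma submultiplicative_exponential_bound: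
  fixes v :: "'a::euclidean_space \<Rightarrow> real"
  assumes "submultiplicative v"
  shows "\<exists>K>0. \<exists>k\<ge>0. \<forall>z. v z \<le> K * exp (k * norm z)"
proof -
  have pos: "v x > 0" for x using assms by (simp add: submultiplicative_def weight_def)
  obtain C where C: "C > 0" "\<And>x y. v (x + y) \<le> C * (v x * v y)"
    using assms unfolding submultiplicative_def by blast
  obtain B where B: "B > 0" "\<And>z. norm z \<le> 1 \<Longrightarrow> v z \<le> B"
    using submultiplicative_locally_bounded[OF assms, of 1] by blast
  \<comment> \<open>The maximum with 1 makes the rate \<open>ln E\<close> nonnegative, so replacing
    n by its upper bound only increases the estimate.\<close>
  define E where "E = max 1 (C * B)"
  have iter: "v (real n *\<^sub>R y) \<le> (v 0 + B) * E ^ n" if y: "norm y \<le> 1" for n y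
  proof (induction n)
    case 0
    then show ?case using B(1) by simp
  next
    case (Suc n)
    have "v (real (Suc n) *\<^sub>R y) = v (real n *\<^sub>R y + y)" by (simp add: algebra_simps)
    also have "\<dots> \<le> C * (v (real n *\<^sub>R y) * v y)" by (rule C(2))
    also have "\<dots> \<le> C * (((v 0 + B) * E ^ n) * B)"
      using Suc B(2)[OF y] C(1) pos[of y] pos[of 0] B(1) by (intro mult_left_mono mult_mono) (auto simp: E_def)
    also have "\<dots> = (v 0 + B) * E ^ n * (C * B)" by (simp add: mult_ac)
    also have "\<dots> \<le> (v 0 + B) * E ^ n * E"
      using pos[of 0] B(1) by (intro mult_left_mono) (auto simp: E_def)
    finally show ?case by (simp add: mult_ac)
  qed
  have E: "E \<ge> 1" by (simp add: E_def)
  have "v z \<le> ((v 0 + B) * (E * E)) * exp (ln E * norm z)" for z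
  proof -
    \<comment> \<open>The added 1 keeps n positive at z = 0, where the step z / n would otherwise be
      a division by zero.\<close>
    define n where "n = nat \<lceil>norm z\<rceil> + 1"
    have n: "n > 0" "norm z \<le> real n" by (auto simp: n_def) linarith
    have n2: "real n \<le> norm z + 2" unfolding n_def by (simp add: of_nat_nat ceiling_correct) linarith
    have "v z = v (real n *\<^sub>R (z /\<^sub>R real n))" using n by simp
    also have "\<dots> \<le> (v 0 + B) * E ^ n" using n by (intro iter) (simp add: divide_simps)
    also have "E ^ n = exp (ln E * real n)" using E by (simp add: exp_of_nat_mult mult.commute)
    also have "\<dots> \<le> exp (ln E * (norm z + 2))" using E n2 by (simp add: mult_left_mono)
    also have "\<dots> = E * E * exp (ln E * norm z)"     proof -
      have "exp (ln E * 2) = exp (ln E) * exp (ln E)" unfolding mult_2_right exp_add ..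
      then show ?thesis using E by (simp add: distrib_left exp_add)
    qed
    finally show ?thesis
      using pos[of 0] B(1) by (simp add: mult_ac)
  qed
  then show ?thesis using pos[of 0] B(1) E by (intro exI[of _ "(v 0 + B) * (E * E)"] conjI exI[of _ "ln E"]) auto
qed

text \<open>Moderateness is applied to 0 = z + (- z), and v is even.\<close>

lemma moderate_inverse_bound:
  fixes \<omega> v :: "'a::euclidean_space \<Rightarrow> real"
  assumes "weight \<omega>" "moderate \<omega> v" "submultiplicative v"
  shows "\<exists>C>0. \<forall>z. 1 / \<omega> z \<le> C * v z"
proof -
  have pos: "\<omega> z > 0" for z using assms(1) by (simp add: weight_def)
  obtain C where C: "C > 0" "\<And>x y. \<omega> (x + y) \<le> C * (\<omega> x * v y)" using assms(2) unfolding moderate_def by blast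
  have "1 / \<omega> z \<le> (C / \<omega> 0) * v z" for z
  proof -
    have "\<omega> 0 \<le> C * (\<omega> z * v z)"
      using C(2)[of z "- z"] assms(3) by (simp add: submultiplicative_def)
    then show ?thesis using pos[of z] pos[of 0] by (simp add: field_simps)
  qed
  then show ?thesis using C(1) pos[of 0] by (intro exI[of _ "C / \<omega> 0"]) auto
qed

text \<open>The passage between unordered sums and integrals over counting measure, so that sums and
  integrals can be exchanged by Tonelli.\<close>

lemma
  fixes f :: "'a \<Rightarrow> real"
  assumes "\<And>x. x \<in> A \<Longrightarrow> f x \<ge> 0"
  shows summable_on_iff_nn_integral: "f summable_on A \<longleftrightarrow> (\<integral>\<^sup>+x. ennreal (f x) \<partial>count_space A) < top"
    and infsum_eq_nn_integral: "f summable_on A \<Longrightarrow> ennreal (infsum f A) = (\<integral>\<^sup>+x. ennreal (f x) \<partial>count_space A)"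
proof -
  have "f summable_on A \<longleftrightarrow> (\<lambda>x. norm (f x)) summable_on A"
    by (intro summable_on_cong) (use assms in auto)
  also have "\<dots> \<longleftrightarrow> integrable (count_space A) f"
    unfolding abs_summable_equivalent Infinite_Set_Sum.abs_summable_on_def ..
  finally have int: "f summable_on A \<longleftrightarrow> integrable (count_space A) f" .
  have nn: "(\<integral>\<^sup>+x. ennreal (norm (f x)) \<partial>count_space A) = (\<integral>\<^sup>+x. ennreal (f x) \<partial>count_space A)"
    by (intro nn_integral_cong) (use assms in auto)
  show "f summable_on A \<longleftrightarrow> (\<integral>\<^sup>+x. ennreal (f x) \<partial>count_space A) < top"
    unfolding int integrable_iff_bounded nn by simp
  assume s: "f summable_on A"
  then have "Infinite_Set_Sum.abs_summable_on f A"
    unfolding int Infinite_Set_Sum.abs_summable_on_def .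
  then have "infsum f A = infsetsum f A" by (simp add: infsetsum_infsum)
  then show "ennreal (infsum f A) = (\<integral>\<^sup>+x. ennreal (f x) \<partial>count_space A)"
    using s unfolding int infsetsum_def by (subst nn_integral_eq_integral) (auto simp: assms)
qed

section \<open>Counting lattice points\<close>

lemma lattice_pts_altdef: "lattice_pts \<epsilon> = range (\<lambda>m :: 'd::finite \<Rightarrow> int. \<chi> i. \<epsilon> * of_int (m i))"
proof (intro set_eqI iffI)
  fix x :: "real ^ 'd" assume "x \<in> lattice_pts \<epsilon>"
  then have "\<forall>i. \<exists>k :: int. x $ i = \<epsilon> * of_int k" by (simp add: lattice_pts_def)
  then obtain m :: "'d \<Rightarrow> int" where "\<And>i. x $ i = \<epsilon> * of_int (m i)" by metis
  then have "x = (\<chi> i. \<epsilon> * of_int (m i))" by (simp add: vec_eq_iff)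
  then show "x \<in> range (\<lambda>m :: 'd \<Rightarrow> int. \<chi> i. \<epsilon> * of_int (m i))" by blast
qed (auto simp: lattice_pts_def)

lemma countable_lattice_pts: "countable (lattice_pts \<epsilon> :: (real ^ 'd::finite) set)"
  unfolding lattice_pts_altdef by (intro countable_image) simp

lemma lattice_pts_diff: "x \<in> lattice_pts \<epsilon> \<Longrightarrow> y \<in> lattice_pts \<epsilon> \<Longrightarrow> x - y \<in> lattice_pts \<epsilon>"
  unfolding lattice_pts_def by (auto simp: right_diff_distrib[symmetric] simp flip: of_int_diff)
    (metis of_int_diff right_diff_distrib)

lemma lattice_pts_add: "x \<in> lattice_pts \<epsilon> \<Longrightarrow> y \<in> lattice_pts \<epsilon> \<Longrightarrow> x + y \<in> lattice_pts \<epsilon>"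
  unfolding lattice_pts_def by auto (metis of_int_add distrib_left)

lemma lattice_pts_ball_card:
  fixes \<epsilon> R :: real
  assumes "\<epsilon> > 0" "R \<ge> 0"
  shows "\<exists>N::nat. \<forall>x :: real ^ 'd::finite. finite {p \<in> lattice_pts \<epsilon>. norm (p - x) \<le> R} \<and>
    card {p \<in> lattice_pts \<epsilon>. norm (p - x) \<le> R} \<le> N"
proof -
  define M where "M = nat \<lceil>2 * R / \<epsilon> + 1\<rceil>"
  have "finite {p \<in> lattice_pts \<epsilon>. norm (p - x) \<le> R} \<and> card {p \<in> lattice_pts \<epsilon>. norm (p - x) \<le> R} \<le> M ^ CARD('d)" for x :: "real ^ 'd"
  proof -
    let ?I = "\<lambda>i. {\<lceil>(x $ i - R) / \<epsilon>\<rceil>..\<lfloor>(x $ i + R) / \<epsilon>\<rfloor>}"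
    let ?P = "PiE UNIV ?I"
    let ?h = "\<lambda>m :: 'd \<Rightarrow> int. \<chi> i. \<epsilon> * of_int (m i)"
    have sub: "{p \<in> lattice_pts \<epsilon>. norm (p - x) \<le> R} \<subseteq> ?h ` ?P"
    proof safe
      fix p :: "real ^ 'd" assume "p \<in> lattice_pts \<epsilon>" and R: "norm (p - x) \<le> R"
      then obtain m where p: "p = ?h m" unfolding lattice_pts_altdef by blast
      have "m i \<in> ?I i" for i
      proof -
        have "\<bar>(p - x) $ i\<bar> \<le> R" using component_le_norm_cart[of "p - x" i] R by linarith
        then have "\<bar>\<epsilon> * of_int (m i) - x $ i\<bar> \<le> R" by (simp add: p)
        then show ?thesis using assms(1) by (auto simp: ceiling_le_iff le_floor_iff field_simps abs_le_iff)
      qed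
      then show "p \<in> ?h ` ?P" unfolding p by blast
    qed
    have fin: "finite ?P" by (intro finite_PiE) auto
    have c: "card (?I i) \<le> M" for i
    proof -
      have "of_int \<lfloor>(x $ i + R) / \<epsilon>\<rfloor> - of_int \<lceil>(x $ i - R) / \<epsilon>\<rceil> \<le> (x $ i + R) / \<epsilon> - (x $ i - R) / \<epsilon>"
        using of_int_floor_le[of "(x $ i + R) / \<epsilon>"] le_of_int_ceiling[of "(x $ i - R) / \<epsilon>"] by linarith
      also have "\<dots> = 2 * R / \<epsilon>" by (simp add: diff_divide_distrib add_divide_distrib)
      finally have "\<lfloor>(x $ i + R) / \<epsilon>\<rfloor> - \<lceil>(x $ i - R) / \<epsilon>\<rceil> + 1 \<le> \<lceil>2 * R / \<epsilon> + 1\<rceil>" by linarith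
      then show ?thesis unfolding M_def by simp
    qed
    have "card {p \<in> lattice_pts \<epsilon>. norm (p - x) \<le> R} \<le> card (?h ` ?P)"
      by (intro card_mono finite_imageI fin sub)
    also have "\<dots> \<le> card ?P" by (rule card_image_le[OF fin])
    also have "\<dots> = (\<Prod>i\<in>UNIV. card (?I i))" by (rule card_PiE) simp
    also have "\<dots> \<le> (\<Prod>i\<in>(UNIV::'d set). M)" by (intro prod_mono) (use c in auto)
    finally show ?thesis using finite_subset[OF sub finite_imageI[OF fin]] by simp
  qed
  then show ?thesis by blast
qed

text \<open>Bounded overlap: balls of a fixed radius around lattice points cover each point at most
  N times. The integral form is the one that appears after exchanging sum and integral.\<close>

lemma lattice_pts_pair_ball_count:
  fixes \<epsilon> R :: real
  assumes "\<epsilon> > 0" "R \<ge> 0"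
  shows "\<exists>N::nat. \<forall>z :: (real ^ 'd::finite) \<times> (real ^ 'd).
    (\<integral>\<^sup>+k. indicator (cball k R) z \<partial>count_space (lattice_pts \<epsilon> \<times> lattice_pts \<epsilon>)) \<le> of_nat N"
proof -
  obtain N where N: "\<And>x :: real ^ 'd. finite {p \<in> lattice_pts \<epsilon>. norm (p - x) \<le> R}"
      "\<And>x :: real ^ 'd. card {p \<in> lattice_pts \<epsilon>. norm (p - x) \<le> R} \<le> N"
    using lattice_pts_ball_card[OF assms] by blast
  have "(\<integral>\<^sup>+k. indicator (cball k R) z \<partial>count_space (lattice_pts \<epsilon> \<times> lattice_pts \<epsilon>)) \<le> of_nat (N * N)"
    for z :: "(real ^ 'd) \<times> (real ^ 'd)"
  proof -
    let ?A = "\<lambda>x. {p \<in> lattice_pts \<epsilon>. norm (p - x) \<le> R}"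
    let ?S = "?A (fst z) \<times> ?A (snd z)"
    have fin: "finite ?S" using N(1) by simp
    have "(\<integral>\<^sup>+k. indicator (cball k R) z \<partial>count_space (lattice_pts \<epsilon> \<times> lattice_pts \<epsilon>)) \<le>
        (\<integral>\<^sup>+k. indicator ?S k \<partial>count_space (lattice_pts \<epsilon> \<times> lattice_pts \<epsilon>))"
    proof (intro nn_integral_mono)
      fix k :: "(real ^ 'd) \<times> (real ^ 'd)"
      assume k: "k \<in> space (count_space (lattice_pts \<epsilon> \<times> lattice_pts \<epsilon>))"
      have "norm (fst k - fst z) \<le> dist k z" "norm (snd k - snd z) \<le> dist k z"
        using dist_fst_le[of k z] dist_snd_le[of k z] by (auto simp: dist_norm)
      then show "indicator (cball k R) z \<le> (indicator ?S k :: ennreal)"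
        using k by (cases k) (auto simp: indicator_def)
    qed
    also have "\<dots> = emeasure (count_space (lattice_pts \<epsilon> \<times> lattice_pts \<epsilon>)) ?S"
      by (intro nn_integral_indicator) auto
    also have "\<dots> = of_nat (card ?S)"
      using fin by (subst emeasure_count_space_finite) auto
    also have "\<dots> \<le> of_nat (N * N)"
      using N(2)[of "fst z"] N(2)[of "snd z"] by (intro of_nat_mono) (simp add: card_cartesian_product mult_mono)
    finally show ?thesis .
  qed
  then show ?thesis by blast
qed

text \<open>The majorant may depend on s. Taking s \<ge> 2 norm z leaves a factor 2^(-
  \<bar>\<alpha>\<bar>), so the double family over k and \<alpha> is absolutely summable and the
  transform can be taken term by term.\<close>

lemma pilipovic_dual_infsum:
  fixes g :: "'k \<Rightarrow> 'd::finite hermite_series"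
  assumes dom: "\<And>s. s > 0 \<Longrightarrow> \<exists>b. b summable_on I \<and> (\<forall>k\<in>I. \<forall>\<alpha>. norm (g k \<alpha>) * monomial_weight s \<alpha> \<le> b k)"
  shows "(\<lambda>\<alpha>. \<Sum>\<^sub>\<infinity>k\<in>I. g k \<alpha>) \<in> pilipovic_dual"
    and "((\<lambda>k. stft_gauss (g k) z) has_sum stft_gauss (\<lambda>\<alpha>. \<Sum>\<^sub>\<infinity>k\<in>I. g k \<alpha>) z) I"
proof -
  have sm: "(\<lambda>k. norm (g k \<alpha>)) summable_on I" for \<alpha>
  proof -
    obtain b where b: "b summable_on I" "\<And>k \<alpha>. k \<in> I \<Longrightarrow> norm (g k \<alpha>) * monomial_weight 1 \<alpha> \<le> b k"
      using dom[of 1] by auto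
    have p: "monomial_weight 1 \<alpha> > 0" by (rule monomial_weight_pos) simp
    have "(\<lambda>k. b k * (1 / monomial_weight 1 \<alpha>)) summable_on I" by (rule summable_on_cmult_left[OF b(1)])
    then show ?thesis
      by (rule summable_on_comparison_test) (use b(2) p in \<open>auto simp: field_simps\<close>)
  qed
  show "(\<lambda>\<alpha>. \<Sum>\<^sub>\<infinity>k\<in>I. g k \<alpha>) \<in> pilipovic_dual"
    unfolding pilipovic_dual_iff
  proof safe
    fix s :: real assume s: "s > 0"
    obtain b where b: "b summable_on I" "\<And>k \<alpha>. k \<in> I \<Longrightarrow> norm (g k \<alpha>) * monomial_weight s \<alpha> \<le> b k"
      using dom[OF s] by auto
    have "norm (\<Sum>\<^sub>\<infinity>k\<in>I. g k \<alpha>) * monomial_weight s \<alpha> \<le> infsum b I" for \<alpha>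
    proof -
      have p: "monomial_weight s \<alpha> > 0" by (rule monomial_weight_pos[OF s])
      have "norm (\<Sum>\<^sub>\<infinity>k\<in>I. g k \<alpha>) * monomial_weight s \<alpha> \<le> (\<Sum>\<^sub>\<infinity>k\<in>I. norm (g k \<alpha>)) * monomial_weight s \<alpha>"
        by (intro mult_right_mono norm_infsum_bound sm less_imp_le[OF p])
      also have "\<dots> = (\<Sum>\<^sub>\<infinity>k\<in>I. norm (g k \<alpha>) * monomial_weight s \<alpha>)"
        by (rule infsum_cmult_left'[symmetric])
      also have "\<dots> \<le> infsum b I"
        by (intro infsum_mono b summable_on_cmult_left sm)
      finally show ?thesis .
    qed
    then show "\<exists>C. \<forall>\<alpha>. norm (\<Sum>\<^sub>\<infinity>k\<in>I. g k \<alpha>) * monomial_weight s \<alpha> \<le> C" by blast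
  qed
  define s where "s = 2 * norm z + 1"
  have s: "s > 0" "norm z \<le> s / 2" by (auto simp: s_def add_nonneg_pos)
  obtain b where b: "b summable_on I" "\<And>k \<alpha>. k \<in> I \<Longrightarrow> norm (g k \<alpha>) * monomial_weight s \<alpha> \<le> b k"
    using dom[OF s(1)] by auto
  let ?q = "\<lambda>\<alpha> :: 'd \<Rightarrow> nat. \<Prod>i\<in>UNIV. (1/2::real) ^ \<alpha> i"
  let ?t = "\<lambda>k \<alpha>. g k \<alpha> * cnj (coherent_coeff \<alpha> z)"
  have le: "norm (?t k \<alpha>) \<le> b k * ?q \<alpha>" if k: "k \<in> I" for k \<alpha>
  proof -
    have "norm (coherent_coeff \<alpha> z) \<le> monomial_weight (s / 2) \<alpha>" by (rule norm_coherent_coeff_le[OF s(2)])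
    also have "monomial_weight (s / 2) \<alpha> = monomial_weight s \<alpha> * ?q \<alpha>"
      unfolding monomial_weight_def prod.distrib[symmetric] by (simp add: power_divide mult.commute)
    finally have "norm (?t k \<alpha>) \<le> norm (g k \<alpha>) * (monomial_weight s \<alpha> * ?q \<alpha>)"
      by (simp add: norm_mult mult_left_mono)
    also have "\<dots> = (norm (g k \<alpha>) * monomial_weight s \<alpha>) * ?q \<alpha>" by simp
    also have "\<dots> \<le> b k * ?q \<alpha>" by (intro mult_right_mono b k prod_nonneg) auto
    finally show ?thesis .
  qed
  have q: "?q summable_on UNIV"
    using summable_on_prod_multi_index[of "\<lambda>_ :: 'd. \<lambda>k. (1/2::real) ^ k"]
    by (simp add: summable_on_UNIV_nonneg_real_iff summable_geometric prod_nonneg)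
  have bnn: "b k \<ge> 0" if "k \<in> I" for k
    by (rule order.trans[OF _ b(2)[OF that]]) (simp add: monomial_weight_nonneg less_imp_le[OF s(1)])
  have "(\<lambda>(k, \<alpha>). b k * ?q \<alpha>) summable_on I \<times> UNIV"
  proof (rule summable_on_SigmaI[where g = "\<lambda>k. b k * infsum ?q UNIV"])
    show "((\<lambda>\<alpha>. case (k, \<alpha>) of (k, \<alpha>) \<Rightarrow> b k * ?q \<alpha>) has_sum b k * infsum ?q UNIV) UNIV" for k
      unfolding prod.case by (intro has_sum_cmult_right has_sum_infsum q)
    show "(\<lambda>k. b k * infsum ?q UNIV) summable_on I" by (intro summable_on_cmult_left b)
    show "0 \<le> (case (k, \<alpha>) of (k, \<alpha>) \<Rightarrow> b k * ?q \<alpha>)" if "k \<in> I" for k \<alpha>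
      unfolding prod.case by (intro mult_nonneg_nonneg bnn that prod_nonneg) auto
  qed
  then have "(\<lambda>x. norm (case x of (k, \<alpha>) \<Rightarrow> ?t k \<alpha>)) summable_on I \<times> UNIV"
    by (rule Infinite_Sum.abs_summable_on_comparison_test') (use le in auto)
  then have st: "(\<lambda>(k, \<alpha>). ?t k \<alpha>) summable_on I \<times> UNIV" by (rule abs_summable_summable)
  have "(\<lambda>k. \<Sum>\<^sub>\<infinity>\<alpha>. ?t k \<alpha>) summable_on I"
    using summable_on_Sigma_banach[OF st] by simp
  then have "((\<lambda>k. \<Sum>\<^sub>\<infinity>\<alpha>. ?t k \<alpha>) has_sum (\<Sum>\<^sub>\<infinity>k\<in>I. \<Sum>\<^sub>\<infinity>\<alpha>. ?t k \<alpha>)) I" by (rule has_sum_infsum)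
  also have "(\<Sum>\<^sub>\<infinity>k\<in>I. \<Sum>\<^sub>\<infinity>\<alpha>. ?t k \<alpha>) = (\<Sum>\<^sub>\<infinity>\<alpha>. \<Sum>\<^sub>\<infinity>k\<in>I. ?t k \<alpha>)"
    by (rule infsum_swap_banach[OF st])
  also have "\<dots> = (\<Sum>\<^sub>\<infinity>\<alpha>. (\<Sum>\<^sub>\<infinity>k\<in>I. g k \<alpha>) * cnj (coherent_coeff \<alpha> z))"
    unfolding infsum_cmult_left' ..
  finally show "((\<lambda>k. stft_gauss (g k) z) has_sum stft_gauss (\<lambda>\<alpha>. \<Sum>\<^sub>\<infinity>k\<in>I. g k \<alpha>) z) I"
    unfolding stft_gauss_altdef by (rule has_sum_cmult_right)
qed

lemma stft_gauss_scale: "stft_gauss (\<lambda>\<alpha>. a * f \<alpha>) z = a * stft_gauss f z"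
  unfolding stft_gauss_altdef mult.assoc infsum_cmult_right' by (simp only: mult.left_commute)

lemma pilipovic_dual_scale: "f \<in> pilipovic_dual \<Longrightarrow> (\<lambda>\<alpha>. a * f \<alpha>) \<in> pilipovic_dual"
  unfolding pilipovic_dual_iff
proof safe
  fix s :: real assume "\<forall>s>0. \<exists>C. \<forall>\<alpha>. norm (f \<alpha>) * monomial_weight s \<alpha> \<le> C" "s > 0"
  then obtain C where C: "\<And>\<alpha>. norm (f \<alpha>) * monomial_weight s \<alpha> \<le> C" by blast
  have "norm (a * f \<alpha>) * monomial_weight s \<alpha> \<le> norm a * C" for \<alpha>
    using mult_left_mono[OF C, of "norm a"] by (simp add: norm_mult mult.assoc)
  then show "\<exists>C. \<forall>\<alpha>. norm (a * f \<alpha>) * monomial_weight s \<alpha> \<le> C" by blast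
qed

lemma
  fixes g :: "'k \<Rightarrow> 'd::finite hermite_series"
  assumes "finite S" "\<And>k. k \<in> S \<Longrightarrow> g k \<in> pilipovic_dual"
  shows pilipovic_dual_sum: "(\<lambda>\<alpha>. \<Sum>k\<in>S. g k \<alpha>) \<in> pilipovic_dual"
    and stft_gauss_sum: "stft_gauss (\<lambda>\<alpha>. \<Sum>k\<in>S. g k \<alpha>) z = (\<Sum>k\<in>S. stft_gauss (g k) z)"
proof -
  have "\<exists>b. b summable_on S \<and> (\<forall>k\<in>S. \<forall>\<alpha>. norm (g k \<alpha>) * monomial_weight s \<alpha> \<le> b k)" if "s > 0" for s
  proof -
    have "\<forall>k\<in>S. \<exists>C. \<forall>\<alpha>. norm (g k \<alpha>) * monomial_weight s \<alpha> \<le> C"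
      using assms(2) that unfolding pilipovic_dual_iff by blast
    then obtain b where "\<forall>k\<in>S. \<forall>\<alpha>. norm (g k \<alpha>) * monomial_weight s \<alpha> \<le> b k" by metis
    then show ?thesis using assms(1) by (intro exI[of _ b]) simp
  qed
  note * = pilipovic_dual_infsum[OF this]
  show "(\<lambda>\<alpha>. \<Sum>k\<in>S. g k \<alpha>) \<in> pilipovic_dual" using *(1) assms(1) by simp
  show "stft_gauss (\<lambda>\<alpha>. \<Sum>k\<in>S. g k \<alpha>) z = (\<Sum>k\<in>S. stft_gauss (g k) z)"
    using *(2)[of z] assms(1) by (simp add: has_sum_finite_iff)
qed

section \<open>Local suprema of the transform of the window\<close>

lemma enn2real_nonneg_iff_le: "x < top \<Longrightarrow> ennreal a \<le> x \<Longrightarrow> a \<le> enn2real x"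
  by (metis enn2real_nonneg ennreal_enn2real ennreal_le_iff less_top)

text \<open>No term exceeds the total sum, so all but one power of each term can be replaced by a
  constant.\<close>

lemma summable_on_powr_ge_1:
  fixes b :: "'k \<Rightarrow> real"
  assumes s: "b summable_on A" and nn: "\<And>k. k \<in> A \<Longrightarrow> b k \<ge> 0" and p: "p \<ge> 1"
  shows "(\<lambda>k. b k powr p) summable_on A"
proof (rule summable_on_comparison_test)
  show "(\<lambda>k. b k * infsum b A powr (p - 1)) summable_on A" by (rule summable_on_cmult_left[OF s])
  fix k assume k: "k \<in> A"
  have le: "b k \<le> infsum b A"
    using infsum_mono_neutral[of b "{k}" b A] s nn k by simp
  show "b k powr p \<le> b k * infsum b A powr (p - 1)"
  proof (cases "b k = 0")
    case False
    then have "b k powr p = b k * b k powr (p - 1)" using nn[OF k] powr_mult_base[of "b k" "p - 1"] by simp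
    also have "\<dots> \<le> b k * infsum b A powr (p - 1)"
      using nn[OF k] le p by (intro mult_left_mono powr_mono2) auto
    finally show ?thesis .
  qed simp
qed auto

text \<open>The power mean inequality bounds the value at u by an integral over the unit ball at u,
  on which v is comparable to its value at u. Summing over lattice points costs only the overlap
  number, so the L^r norm controls the sum of the local suprema.\<close>

lemma stft_gauss_amalgam:
  fixes \<psi> :: "'d::finite hermite_series"
  assumes \<epsilon>: "\<epsilon> > 0" and r: "0 < r" "r \<le> 1" and v: "submultiplicative v"
    and \<psi>: "\<psi> \<in> modulation_space_Lp r v" and R: "R \<ge> 0"
  shows "\<exists>b. b summable_on (lattice_pts \<epsilon> \<times> lattice_pts \<epsilon>) \<and> (\<forall>k. b k \<ge> 0) \<and>
     (\<forall>k u. norm (u - k) \<le> R \<longrightarrow> (norm (stft_gauss \<psi> u) * v u) powr r \<le> b k)"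
proof -
  let ?L = "lattice_pts \<epsilon> \<times> lattice_pts \<epsilon> :: ((real ^ 'd) \<times> (real ^ 'd)) set"
  let ?\<Psi> = "\<lambda>u. ennreal ((norm (stft_gauss \<psi> u) * v u) powr r)"
  have pil: "\<psi> \<in> pilipovic_dual" and fin: "(\<integral>\<^sup>+u. ?\<Psi> u \<partial>lebesgue) < top"
    using \<psi> by (auto simp: modulation_space_Lp_def)
  have F [measurable]: "stft_gauss \<psi> \<in> borel_measurable borel" by (rule borel_measurable_stft_gauss[OF pil])
  have F' [measurable]: "stft_gauss \<psi> \<in> borel_measurable lebesgue" using F by (simp add: measurable_completion)
  have vm [measurable]: "v \<in> borel_measurable lebesgue" and vpos: "\<And>x. v x > 0"
    using v by (auto simp: submultiplicative_def weight_def)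
  obtain C where C: "C > 0" "\<And>x y. v (x + y) \<le> C * (v x * v y)"
    using v unfolding submultiplicative_def by blast
  obtain B where B: "B > 0" "\<And>z. norm z \<le> 1 \<Longrightarrow> v z \<le> B"
    using submultiplicative_locally_bounded[OF v, of 1] by blast
  obtain K where K: "K \<ge> 0" "\<And>w. norm (stft_gauss \<psi> w) powr r \<le>
      K * (LINT u|lborel. indicator (ball w 1) u *\<^sub>R (norm (stft_gauss \<psi> u) powr r))"
    using stft_gauss_power_mean[OF r, where 'd = 'd] pil by blast
  let ?D = "K * (C * B) powr r"
  have D: "?D \<ge> 0" using K(1) by simp
  \<comment> \<open>The radius R + 1 accommodates the unit ball around any u within R of k. The
    measure is the completed one since v is only Lebesgue measurable.\<close>
  define J where "J k = (\<integral>\<^sup>+y. indicator (cball k (R + 1)) y * ?\<Psi> y \<partial>lebesgue)" for k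
  have cb [measurable]: "cball k (R + 1) \<in> sets lebesgue" for k :: "(real ^ 'd) \<times> (real ^ 'd)" by simp
  have Jfin: "J k < top" for k
    unfolding J_def by (rule le_less_trans[OF _ fin], rule nn_integral_mono) (auto simp: indicator_def)
  define b where "b k = ?D * enn2real (J k)" for k
  have bJ: "ennreal (b k) = ennreal ?D * J k" for k
    unfolding b_def using D Jfin[of k] by (simp add: ennreal_mult)
  have "(norm (stft_gauss \<psi> u) * v u) powr r \<le> b k" if uk: "norm (u - k) \<le> R" for u k
  proof -
    let ?g = "\<lambda>y. indicator (ball u 1) y *\<^sub>R (norm (stft_gauss \<psi> y) powr r)"
    obtain M where M: "M \<ge> 0" "\<And>y. norm y \<le> norm u + 1 \<Longrightarrow> norm (stft_gauss \<psi> y) \<le> M"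
      using stft_gauss_bounded[OF pil, of "norm u + 1"] by blast
    have FM: "norm (stft_gauss \<psi> y) \<le> M" if "dist u y < 1" for y
      using that norm_triangle_ineq2[of y u] by (intro M) (simp add: dist_norm norm_minus_commute)
    have int: "integrable lborel ?g"
      using r by (intro integrable_ball_bounded[where M = "M powr r"]) (auto intro!: powr_mono2 FM)
    have gm: "?g \<in> borel_measurable lborel" using int by (rule borel_measurable_integrable)
    have "ennreal (LINT y|lborel. ?g y) = (\<integral>\<^sup>+y. ennreal (?g y) \<partial>lborel)"
      by (rule nn_integral_eq_integral[OF int, symmetric]) auto
    also have "\<dots> = (\<integral>\<^sup>+y. ennreal (?g y) \<partial>lebesgue)"
      using gm by (subst nn_integral_completion) auto
    finally have eq: "ennreal (LINT y|lborel. ?g y) = (\<integral>\<^sup>+y. ennreal (?g y) \<partial>lebesgue)" .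
    have gm': "(\<lambda>y. ennreal (?g y)) \<in> borel_measurable lebesgue"
      using measurable_completion[OF gm] by measurable
    have "ennreal ((norm (stft_gauss \<psi> u) * v u) powr r) = ennreal (v u powr r * norm (stft_gauss \<psi> u) powr r)"
      using vpos[of u] by (simp add: powr_mult mult.commute)
    also have "\<dots> \<le> ennreal (v u powr r * (K * (LINT y|lborel. ?g y)))"
      using K(2)[of u] by (intro ennreal_leI mult_left_mono) auto
    also have "\<dots> = ennreal (K * v u powr r) * ennreal (LINT y|lborel. ?g y)"
      using K(1) by (subst ennreal_mult[symmetric]) (auto intro!: integral_nonneg_AE simp: mult_ac)
    also have "\<dots> = (\<integral>\<^sup>+y. ennreal (K * v u powr r) * ennreal (?g y) \<partial>lebesgue)"
      unfolding eq by (rule nn_integral_cmult[OF gm', symmetric])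
    also have "\<dots> \<le> (\<integral>\<^sup>+y. ennreal ?D * (indicator (cball k (R + 1)) y * ?\<Psi> y) \<partial>lebesgue)"
    proof (rule nn_integral_mono)
      fix y
      show "ennreal (K * v u powr r) * ennreal (?g y) \<le> ennreal ?D * (indicator (cball k (R + 1)) y * ?\<Psi> y)"
      proof (cases "y \<in> ball u 1")
        case True
        have "norm (y - k) \<le> norm (y - u) + norm (u - k)" using norm_triangle_ineq[of "y - u" "u - k"] by simp
        then have yk: "y \<in> cball k (R + 1)"
          using uk True by (simp add: dist_norm norm_minus_commute)
        have "v u \<le> C * (v y * v (u - y))" using C(2)[of y "u - y"] by simp
        also have "\<dots> \<le> C * (v y * B)"
          using True vpos[of y] C(1) by (intro mult_left_mono B) (auto simp: dist_norm)
        finally have "v u powr r \<le> (C * B * v y) powr r" using vpos[of u] r by (intro powr_mono2) (auto simp: mult_ac)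
        also have "\<dots> = (C * B) powr r * v y powr r" using C(1) B(1) vpos[of y] by (simp add: powr_mult)
        finally have "K * v u powr r * norm (stft_gauss \<psi> y) powr r \<le> K * ((C * B) powr r * v y powr r) * norm (stft_gauss \<psi> y) powr r"
          using K(1) by (intro mult_right_mono mult_left_mono) auto
        also have "\<dots> = ?D * (norm (stft_gauss \<psi> y) * v y) powr r" using vpos[of y] by (simp add: powr_mult mult_ac)
        finally show ?thesis using True yk K(1) D by (simp flip: ennreal_mult)
      qed simp
    qed
    also have "\<dots> = ennreal ?D * J k" unfolding J_def by (rule nn_integral_cmult) measurable
    finally show ?thesis
      unfolding bJ[symmetric] using D by (subst (asm) ennreal_le_iff) (auto simp: b_def)
  qed
  moreover have "b summable_on ?L"
  proof -
    obtain N :: nat where N: "\<And>z :: (real ^ 'd) \<times> (real ^ 'd). (\<integral>\<^sup>+k. indicator (cball k (R + 1)) z \<partial>count_space ?L) \<le> of_nat N"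
      using lattice_pts_pair_ball_count[OF \<epsilon>, of "R + 1", where 'd = 'd] R by auto
    have "(\<integral>\<^sup>+k. ennreal (b k) \<partial>count_space ?L) = ennreal ?D * (\<integral>\<^sup>+k. J k \<partial>count_space ?L)"
      unfolding bJ by (rule nn_integral_cmult) auto
    also have "(\<integral>\<^sup>+k. J k \<partial>count_space ?L) =
        (\<integral>\<^sup>+y. (\<integral>\<^sup>+k. indicator (cball k (R + 1)) y * ?\<Psi> y \<partial>count_space ?L) \<partial>lebesgue)"
      unfolding J_def by (rule nn_integral_count_space_nn_integral[symmetric])
        (auto intro!: countable_SIGMA countable_lattice_pts, measurable)
    also have "\<dots> = (\<integral>\<^sup>+y. (\<integral>\<^sup>+k. indicator (cball k (R + 1)) y \<partial>count_space ?L) * ?\<Psi> y \<partial>lebesgue)"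
      by (intro nn_integral_cong nn_integral_multc) auto
    also have "\<dots> \<le> (\<integral>\<^sup>+y. of_nat N * ?\<Psi> y \<partial>lebesgue)"
      by (intro nn_integral_mono mult_right_mono N) auto
    also have "\<dots> = of_nat N * (\<integral>\<^sup>+y. ?\<Psi> y \<partial>lebesgue)"
      by (rule nn_integral_cmult) measurable
    finally have "(\<integral>\<^sup>+k. ennreal (b k) \<partial>count_space ?L) \<le> ennreal ?D * (of_nat N * (\<integral>\<^sup>+y. ?\<Psi> y \<partial>lebesgue))"
      by (simp add: mult_left_mono)
    also have "\<dots> < top" using fin by (simp add: ennreal_mult_less_top of_nat_less_top)
    finally show ?thesis by (subst summable_on_iff_nn_integral) (use D in \<open>auto simp: b_def\<close>)
  qed
  ultimately show ?thesis using D by (intro exI[of _ b]) (auto simp: b_def)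
qed

section \<open>Weak-star limits\<close>

definition hermite_unit :: "('d \<Rightarrow> nat) \<Rightarrow> 'd::finite hermite_series" where
  "hermite_unit \<alpha> = (\<lambda>\<beta>. if \<beta> = \<alpha> then 1 else 0)"

lemma hermite_unit_pilipovic_dual: "hermite_unit \<alpha> \<in> pilipovic_dual"
  unfolding pilipovic_dual_iff
proof safe
  fix s :: real assume "s > 0"
  then show "\<exists>C. \<forall>\<beta>. norm (hermite_unit \<alpha> \<beta>) * monomial_weight s \<beta> \<le> C"
    by (intro exI[of _ "monomial_weight s \<alpha>"]) (simp add: hermite_unit_def monomial_weight_nonneg)
qed

lemma stft_gauss_hermite_unit:
  fixes \<alpha> :: "'d::finite \<Rightarrow> nat"
  shows "stft_gauss (hermite_unit \<alpha>) z = complex_of_real (stft_const TYPE('d)) * cnj (coherent_coeff \<alpha> z)"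
proof -
  have "(\<Sum>\<^sub>\<infinity>\<beta>. hermite_unit \<alpha> \<beta> * cnj (coherent_coeff \<beta> z)) = cnj (coherent_coeff \<alpha> z)"
    by (rule infsumI, rule has_sum_finite_neutralI[of "{\<alpha>}"]) (auto simp: hermite_unit_def)
  then show ?thesis by (simp add: stft_gauss_altdef)
qed

lemma integrable_gauss_prod:
  assumes s: "s > 0"
  shows "integrable lborel (\<lambda>z :: (real ^ 'd::finite) \<times> (real ^ 'd). exp (- s * (norm z)\<^sup>2))"
proof -
  let ?e = "\<lambda>x :: real ^ 'd. exp (- s * (norm x)\<^sup>2)"
  have prod: "?e x = (\<Prod>i\<in>UNIV. exp (- s * (x $ i)\<^sup>2))" for x
    by (simp add: norm_vec_def L2_set_def sum_nonneg exp_sum[symmetric] sum_distrib_left sum_negf[symmetric] del: sum_negf)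
  have e: "integrable lborel ?e"
    unfolding prod by (rule integrable_lborel_vec_prod) (rule integrable_gauss_real[OF s])
  have em [measurable]: "?e \<in> borel_measurable borel" by (intro borel_measurable_continuous_onI continuous_intros)
  have fin: "(\<integral>\<^sup>+x. ennreal (?e x) \<partial>lborel) < top"
    using e by (simp add: integrable_iff_bounded)
  have split: "exp (- s * (norm z)\<^sup>2) = ?e (fst z) * ?e (snd z)" for z :: "(real ^ 'd) \<times> (real ^ 'd)"
    by (simp add: norm_prod_def algebra_simps flip: exp_add)
  have m: "(\<lambda>z :: (real ^ 'd) \<times> (real ^ 'd). exp (- s * (norm z)\<^sup>2)) \<in> borel_measurable lborel"
    unfolding measurable_lborel2 by (intro borel_measurable_continuous_onI continuous_intros)
  have "(\<integral>\<^sup>+z. ennreal (norm (exp (- s * (norm z)\<^sup>2))) \<partial>(lborel :: ((real ^ 'd) \<times> (real ^ 'd)) measure)) =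
      (\<integral>\<^sup>+z. ennreal (?e (fst z)) * ennreal (?e (snd z)) \<partial>(lborel \<Otimes>\<^sub>M lborel))"
    unfolding lborel_prod
    by (intro nn_integral_cong) (simp only: split real_norm_def abs_mult abs_exp_cancel ennreal_mult exp_ge_zero)
  also have "\<dots> = (\<integral>\<^sup>+x. (\<integral>\<^sup>+y. ennreal (?e x) * ennreal (?e y) \<partial>lborel) \<partial>lborel)"
    by (subst lborel.nn_integral_fst[symmetric]) auto
  also have "\<dots> = (\<integral>\<^sup>+x. ennreal (?e x) * (\<integral>\<^sup>+y. ennreal (?e y) \<partial>lborel) \<partial>lborel)"
    by (intro nn_integral_cong nn_integral_cmult) auto
  also have "\<dots> = (\<integral>\<^sup>+x. ennreal (?e x) \<partial>lborel) * (\<integral>\<^sup>+y. ennreal (?e y) \<partial>lborel)"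
    by (rule nn_integral_multc) auto
  also have "\<dots> < top" using fin by (simp add: ennreal_mult_less_top)
  finally show ?thesis using m unfolding integrable_iff_bounded by simp
qed

text \<open>The monomial is at most a multiple of exp (norm z). Half of the Gaussian exponent then
  absorbs both exponentials and the other half is kept for integrability.\<close>

lemma coherent_coeff_exponential_decay:
  fixes \<alpha> :: "'d::finite \<Rightarrow> nat"
  assumes k: "k \<ge> 0"
  shows "\<exists>M\<ge>0. \<forall>z. norm (coherent_coeff \<alpha> z) * exp (k * norm z) \<le> M * exp (- (1/8) * (norm z)\<^sup>2)"
proof -
  let ?m = "\<Sum>i\<in>UNIV. \<alpha> i"
  let ?F = "sqrt (\<Prod>i\<in>UNIV. fact (\<alpha> i)) :: real"
  have F: "?F > 0" by (simp add: prod_pos)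
  define M where "M = fact ?m / ?F * exp (2 * (k + 1)\<^sup>2)"
  have "norm (coherent_coeff \<alpha> z) * exp (k * norm z) \<le> M * exp (- (1/8) * (norm z)\<^sup>2)" for z
  proof -
    let ?s = "norm z"
    have "(\<Prod>i\<in>UNIV. norm (phase_point (fst z $ i) (snd z $ i)) ^ \<alpha> i / sqrt (fact (\<alpha> i))) \<le> monomial_weight ?s \<alpha>"
      unfolding monomial_weight_def by (intro prod_mono conjI divide_right_mono power_mono norm_phase_point_le') auto
    also have "\<dots> \<le> fact ?m * exp ?s / ?F"
      unfolding monomial_weight_altdef
    proof (intro divide_right_mono less_imp_le[OF F])
      have "(\<Sum>n\<in>{?m}. ?s ^ n /\<^sub>R fact n) \<le> (\<Sum>n. ?s ^ n /\<^sub>R fact n)"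
        by (intro sum_le_suminf summable_exp_generic) auto
      then have "?s ^ ?m / fact ?m \<le> exp ?s" unfolding exp_def by (simp add: divide_inverse mult.commute)
      then show "?s ^ ?m \<le> fact ?m * exp ?s" by (simp add: field_simps)
    qed
    finally have "norm (coherent_coeff \<alpha> z) * exp (k * ?s) \<le> exp (- ?s\<^sup>2 / 4) * (fact ?m * exp ?s / ?F) * exp (k * ?s)"
      unfolding norm_coherent_coeff by (intro mult_right_mono mult_left_mono) auto
    also have "\<dots> = fact ?m / ?F * exp (- ?s\<^sup>2 / 4 + ?s + k * ?s)"
      unfolding exp_add by (simp add: mult_ac)
    also have "\<dots> \<le> fact ?m / ?F * exp (2 * (k + 1)\<^sup>2 + - (1/8) * ?s\<^sup>2)"
    proof -
      \<comment> \<open>Completing the square in (k + 1) s - s^2 / 8 is where the constant 2 (k +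
        1)^2 comes from.\<close>
      have "0 \<le> (?s / 4 - (k + 1))\<^sup>2 * 2" by simp
      then have "- ?s\<^sup>2 / 4 + ?s + k * ?s \<le> 2 * (k + 1)\<^sup>2 + - (1/8) * ?s\<^sup>2"
        by (simp add: power2_eq_square field_simps)
      then show ?thesis using F by (intro mult_left_mono) auto
    qed
    also have "\<dots> = M * exp (- (1/8) * ?s\<^sup>2)" unfolding M_def exp_add by (simp add: mult_ac)
    finally show ?thesis .
  qed
  moreover have "M \<ge> 0" using F by (simp add: M_def)
  ultimately show ?thesis by blast
qed

text \<open>1 / \<omega> is at most a multiple of v and thus grows at most exponentially, which the
  Gaussian decay beats. This places the Hermite functions in the predual.\<close>

lemma coherent_coeff_weighted_integrable:
  fixes \<omega> v :: "(real ^ 'd::finite) \<times> (real ^ 'd) \<Rightarrow> real"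
  assumes \<omega>: "weight \<omega>" "moderate \<omega> v" and v: "submultiplicative v"
  shows "integrable lebesgue (\<lambda>z. norm (coherent_coeff \<alpha> z) * (1 / \<omega> z))"
proof -
  have \<omega>pos: "\<omega> z > 0" for z using \<omega>(1) unfolding weight_def by blast
  have \<omega>m [measurable]: "\<omega> \<in> borel_measurable lebesgue" using \<omega>(1) by (simp add: weight_def)
  obtain C where C: "C > 0" "\<And>z. 1 / \<omega> z \<le> C * v z" using moderate_inverse_bound[OF \<omega> v] by blast
  obtain K k where K: "K > 0" "k \<ge> 0" "\<And>z. v z \<le> K * exp (k * norm z)"
    using submultiplicative_exponential_bound[OF v] by blast
  obtain M where M: "M \<ge> 0" "\<And>z. norm (coherent_coeff \<alpha> z) * exp (k * norm z) \<le> M * exp (- (1/8) * (norm z)\<^sup>2)"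
    using coherent_coeff_exponential_decay[OF K(2), of \<alpha>] by blast
  have cm [measurable]: "coherent_coeff \<alpha> \<in> borel_measurable lebesgue"
    using borel_measurable_coherent_coeff[of \<alpha>] by (simp add: measurable_completion)
  have "integrable lborel (\<lambda>z :: (real ^ 'd) \<times> (real ^ 'd). (C * K * M) * exp (- (1/8) * (norm z)\<^sup>2))"
    by (intro integrable_mult_right integrable_gauss_prod) simp
  then have "integrable lebesgue (\<lambda>z :: (real ^ 'd) \<times> (real ^ 'd). (C * K * M) * exp (- (1/8) * (norm z)\<^sup>2))"
    by (subst integrable_completion) (auto dest: borel_measurable_integrable)
  then show ?thesis
  proof (rule Bochner_Integration.integrable_bound)
    show "AE z in lebesgue. norm (norm (coherent_coeff \<alpha> z) * (1 / \<omega> z)) \<le> norm ((C * K * M) * exp (- (1/8) * (norm z)\<^sup>2))"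
    proof (rule AE_I2)
      fix z :: "(real ^ 'd) \<times> (real ^ 'd)"
      have "norm (coherent_coeff \<alpha> z) * (1 / \<omega> z) \<le> norm (coherent_coeff \<alpha> z) * (C * (K * exp (k * norm z)))"
        using C K by (intro mult_left_mono order.trans[OF C(2)]) auto
      also have "\<dots> = C * K * (norm (coherent_coeff \<alpha> z) * exp (k * norm z))" by simp
      also have "\<dots> \<le> C * K * (M * exp (- (1/8) * (norm z)\<^sup>2))"
        using C K by (intro mult_left_mono M) auto
      finally show "norm (norm (coherent_coeff \<alpha> z) * (1 / \<omega> z)) \<le> norm ((C * K * M) * exp (- (1/8) * (norm z)\<^sup>2))"
        using \<omega>pos[of z] C K M by (simp add: abs_mult mult.assoc)
    qed
  qed measurable
qed

lemma hermite_unit_modulation_space: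
  fixes \<omega> v :: "(real ^ 'd::finite) \<times> (real ^ 'd) \<Rightarrow> real"
  assumes "weight \<omega>" "moderate \<omega> v" "submultiplicative v"
  shows "hermite_unit \<alpha> \<in> modulation_space_Lp 1 (\<lambda>z. 1 / \<omega> z)"
proof -
  have \<omega>pos: "\<omega> z > 0" for z using assms(1) unfolding weight_def by blast
  have "integrable lebesgue (\<lambda>z. stft_const TYPE('d) * (norm (coherent_coeff \<alpha> z) * (1 / \<omega> z)))"
    by (intro integrable_mult_right coherent_coeff_weighted_integrable[OF assms])
  then have "(\<integral>\<^sup>+z. ennreal (norm (stft_const TYPE('d) * (norm (coherent_coeff \<alpha> z) * (1 / \<omega> z)))) \<partial>lebesgue) < top"
    unfolding integrable_iff_bounded infinity_ennreal_def by (rule conjunct2)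
  moreover have "(norm (stft_gauss (hermite_unit \<alpha>) z) * (1 / \<omega> z)) powr 1 = norm (stft_const TYPE('d) * (norm (coherent_coeff \<alpha> z) * (1 / \<omega> z)))" for z
    using \<omega>pos[of z] by (simp add: stft_gauss_hermite_unit norm_mult abs_mult)
  ultimately have "(\<integral>\<^sup>+z. ennreal ((norm (stft_gauss (hermite_unit \<alpha>) z) * (1 / \<omega> z)) powr 1) \<partial>lebesgue) < top"
    by (simp only:)
  then show ?thesis
    unfolding modulation_space_Lp_def mem_Collect_eq by (intro conjI hermite_unit_pilipovic_dual)
qed

text \<open>A lower bound uniform in R, for the limit of large radii below. At the point with all
  positions 1 and frequency 0 no coherent coefficient vanishes, so a small ball there already
  contributes a positive amount.\<close>

lemma coherent_norm_eventually_ge: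
  fixes \<alpha> :: "'d::finite \<Rightarrow> nat"
  shows "\<exists>R0>0. \<exists>a>0. \<forall>R\<ge>R0. coherent_norm R \<alpha> \<ge> a"
proof -
  define p where "p = ((\<chi> i. 1) :: real ^ 'd, 0 :: real ^ 'd)"
  have "phase_point 1 0 \<noteq> 0" by (simp add: phase_point_def complex_eq_iff)
  then have pos: "norm (coherent_coeff \<alpha> p) > 0"
    unfolding norm_coherent_coeff p_def by (simp add: prod_pos)
  let ?h = "\<lambda>z. norm (coherent_coeff \<alpha> z)"
  have "isCont ?h p"
    using continuous_on_norm[OF continuous_on_coherent_coeff[of UNIV \<alpha>]] by (metis UNIV_I continuous_on_eq_continuous_at open_UNIV)
  then obtain \<rho> where \<rho>: "\<rho> > 0" "\<And>z. dist z p < \<rho> \<Longrightarrow> dist (?h z) (?h p) < ?h p / 2"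
    using pos unfolding continuous_at_eps_delta by (metis half_gt_zero)
  have le: "?h p / 2 \<le> ?h z" if "z \<in> ball p \<rho>" for z
    using \<rho>(2)[of z] that by (simp add: dist_commute dist_real_def abs_if split: if_splits)
  define R0 where "R0 = norm p + \<rho> + 1"
  have R0: "R0 > 0" using \<rho>(1) by (simp add: R0_def add_nonneg_pos)
  have "(?h p / 2)\<^sup>2 * measure lborel (ball p \<rho>) \<le> coherent_norm R \<alpha>" if "R \<ge> R0" for R
  proof (rule coherent_norm_ge)
    show "ball p \<rho> \<subseteq> ball 0 R"
    proof
      fix z assume "z \<in> ball p \<rho>"
      then show "z \<in> ball 0 R" using norm_triangle_ineq2[of z p] that
        by (simp add: dist_norm norm_minus_commute R0_def)
    qed
  qed (use le R0 that in auto)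
  moreover have "(?h p / 2)\<^sup>2 * measure lborel (ball p \<rho>) > 0"
    using pos \<rho>(1) by (intro mult_pos_pos) (auto simp: content_ball_pos)
  ultimately show ?thesis using R0 by blast
qed

text \<open>Pairing with \<open>hermite_unit \<alpha>\<close> is, up to a constant, the limit of the
  ball extractions as the radius grows. The limit of \<open>coherent_norm\<close> is never computed:
  equal pairings force the difference of coefficients times \<open>coherent_norm\<close> to 0, while
  \<open>coherent_norm\<close> stays away from 0.\<close>

lemma modulation_space_Linf_eqI:
  fixes f g :: "'d::finite hermite_series"
  assumes \<omega>: "weight \<omega>" "moderate \<omega> v" "submultiplicative v"
    and f: "f \<in> modulation_space_Linf \<omega>" and g: "g \<in> modulation_space_Linf \<omega>"
    and eq: "\<And>h. h \<in> modulation_space_Lp 1 (\<lambda>z. 1 / \<omega> z) \<Longrightarrow> modulation_pairing f h = modulation_pairing g h"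
  shows "f = g"
proof
  fix \<alpha>
  let ?c = "complex_of_real (stft_const TYPE('d))"
  have lim: "(\<lambda>n. ?c * f \<alpha> * complex_of_real (coherent_norm (real (Suc n)) \<alpha>)) \<longlonglongrightarrow>
      modulation_pairing f (hermite_unit \<alpha>) / ?c" if f: "f \<in> modulation_space_Linf \<omega>" for f
  proof -
    have pil: "f \<in> pilipovic_dual" using f by (simp add: modulation_space_Linf_def)
    obtain A where A: "AE z in lebesgue. norm (stft_gauss f z) * \<omega> z \<le> A"
      using f unfolding modulation_space_Linf_def by blast
    have \<omega>pos: "\<omega> z > 0" for z using \<omega>(1) unfolding weight_def by blast
    let ?h = "\<lambda>z. stft_gauss f z * coherent_coeff \<alpha> z"
    have F: "stft_gauss f \<in> borel_measurable borel" by (rule borel_measurable_stft_gauss[OF pil])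
    have [measurable]: "stft_gauss f \<in> borel_measurable lebesgue" "coherent_coeff \<alpha> \<in> borel_measurable lebesgue"
      using F borel_measurable_coherent_coeff[of \<alpha>] by (simp_all add: measurable_completion)
    have h: "?h \<in> borel_measurable borel" using F by measurable
    have bound: "AE z in lebesgue. norm (?h z) \<le> A * (norm (coherent_coeff \<alpha> z) * (1 / \<omega> z))"
      using A
    proof eventually_elim
      case (elim z)
      then have "norm (stft_gauss f z) \<le> A * (1 / \<omega> z)" using \<omega>pos[of z] by (simp add: field_simps)
      from mult_right_mono[OF this norm_ge_zero[of "coherent_coeff \<alpha> z"]] show ?case
        by (simp add: norm_mult mult_ac)
    qed
    have intb: "integrable lebesgue (\<lambda>z. A * (norm (coherent_coeff \<alpha> z) * (1 / \<omega> z)))"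
      by (intro integrable_mult_right coherent_coeff_weighted_integrable[OF \<omega>])
    have "(\<lambda>n. LINT z|lebesgue. indicator (ball 0 (real (Suc n))) z *\<^sub>R ?h z) \<longlonglongrightarrow> (LINT z|lebesgue. ?h z)"
    proof (rule integral_dominated_convergence[OF _ _ intb])
      show "AE z in lebesgue. (\<lambda>n. indicator (ball 0 (real (Suc n))) z *\<^sub>R ?h z) \<longlonglongrightarrow> ?h z"
      proof (rule AE_I2, rule tendsto_eventually)
        fix z :: "(real ^ 'd) \<times> (real ^ 'd)"
        have "\<forall>\<^sub>F n in sequentially. norm z < real (Suc n)"
          using eventually_gt_at_top[of "nat \<lceil>norm z\<rceil>"] by eventually_elim linarith
        then show "\<forall>\<^sub>F n in sequentially. indicator (ball 0 (real (Suc n))) z *\<^sub>R ?h z = ?h z"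
          by eventually_elim simp
      qed
      show "AE z in lebesgue. norm (indicator (ball 0 (real (Suc n))) z *\<^sub>R ?h z) \<le> A * (norm (coherent_coeff \<alpha> z) * (1 / \<omega> z))" for n
        using bound by eventually_elim (auto simp: indicator_def intro: order.trans[OF norm_ge_zero])
      show "?h \<in> borel_measurable lebesgue" by measurable
      show "(\<lambda>z. indicator (ball 0 (real (Suc n))) z *\<^sub>R ?h z) \<in> borel_measurable lebesgue" for n
        by (rule borel_measurable_scaleR[OF borel_measurable_indicator]) (simp, measurable)
    qed
    moreover have "(LINT z|lebesgue. indicator (ball 0 (real (Suc n))) z *\<^sub>R ?h z) = ?c * f \<alpha> * complex_of_real (coherent_norm (real (Suc n)) \<alpha>)" for n
    proof -
      have "(\<lambda>z. indicator (ball 0 (real (Suc n))) z *\<^sub>R ?h z) \<in> borel_measurable lborel"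
        by (rule borel_measurable_scaleR[OF borel_measurable_indicator]) (simp_all add: h)
      then show ?thesis
        using stft_gauss_extraction[OF pil, of "real (Suc n)" \<alpha>] by (simp only: integral_completion of_nat_0_less_iff zero_less_Suc)
    qed
    moreover have "modulation_pairing f (hermite_unit \<alpha>) = ?c * (LINT z|lebesgue. ?h z)"
      unfolding modulation_pairing_def stft_gauss_hermite_unit
      by (subst integral_mult_right_zero[symmetric]) (simp add: mult_ac)
    ultimately show ?thesis by simp
  qed
  have "hermite_unit \<alpha> \<in> modulation_space_Lp 1 (\<lambda>z. 1 / \<omega> z)" by (rule hermite_unit_modulation_space[OF \<omega>])
  from eq[OF this] have "(\<lambda>n. ?c * f \<alpha> * complex_of_real (coherent_norm (real (Suc n)) \<alpha>) -
      ?c * g \<alpha> * complex_of_real (coherent_norm (real (Suc n)) \<alpha>)) \<longlonglongrightarrow> 0"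
    using tendsto_diff[OF lim[OF f] lim[OF g]] by simp
  then have L: "(\<lambda>n. norm (?c * (f \<alpha> - g \<alpha>) * complex_of_real (coherent_norm (real (Suc n)) \<alpha>))) \<longlonglongrightarrow> 0"
    by (simp only: left_diff_distrib right_diff_distrib tendsto_norm_zero)
  obtain R0 a where R0: "a > 0" "\<And>R. R \<ge> R0 \<Longrightarrow> coherent_norm R \<alpha> \<ge> a"
    using coherent_norm_eventually_ge[of \<alpha>] by blast
  have "\<forall>\<^sub>F n in sequentially. real (Suc n) \<ge> R0"
    using eventually_ge_at_top[of "nat \<lceil>R0\<rceil>"] by eventually_elim linarith
  then have "\<forall>\<^sub>F n in sequentially. stft_const TYPE('d) * norm (f \<alpha> - g \<alpha>) * a \<le>
      norm (?c * (f \<alpha> - g \<alpha>) * complex_of_real (coherent_norm (real (Suc n)) \<alpha>))"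
  proof eventually_elim
    case (elim n)
    have "stft_const TYPE('d) * norm (f \<alpha> - g \<alpha>) * a \<le> stft_const TYPE('d) * norm (f \<alpha> - g \<alpha>) * \<bar>coherent_norm (real (Suc n)) \<alpha>\<bar>"
      using R0(2)[OF elim] R0(1) by (intro mult_left_mono) auto
    then show ?case by (simp add: norm_mult)
  qed
  then have "stft_const TYPE('d) * norm (f \<alpha> - g \<alpha>) * a \<le> 0"
    by (rule tendsto_lowerbound[OF L]) simp
  then show "f \<alpha> = g \<alpha>" using R0(1) by (simp add: mult_le_0_iff)
qed

text \<open>In the pullback of a product topology convergence is convergence of each pairing. Open
  sets lie inside the space, so the net itself has to be eventually there.\<close>

lemma weak_star_limitin_iff:
  assumes ev: "\<forall>\<^sub>F x in F. s x \<in> modulation_space_Linf \<omega>"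
  shows "limitin (weak_star_topology \<omega>) s l F \<longleftrightarrow> l \<in> modulation_space_Linf \<omega> \<and>
    (\<forall>p \<in> modulation_space_Lp 1 (\<lambda>z. 1 / \<omega> z). ((\<lambda>x. modulation_pairing (s x) p) \<longlongrightarrow> modulation_pairing l p) F)"
proof -
  let ?A = "modulation_space_Linf \<omega>"
  let ?P = "modulation_space_Lp 1 (\<lambda>z. 1 / \<omega> z)"
  let ?T = "product_topology (\<lambda>_. euclidean :: complex topology) ?P"
  let ?g = "\<lambda>f. restrict (modulation_pairing f) ?P"
  let ?W = "pullback_topology ?A ?g ?T"
  have W: "weak_star_topology \<omega> = ?W" unfolding weak_star_topology_def Let_def ..
  have lim: "limitin ?T (\<lambda>x. ?g (s x)) (?g l) F \<longleftrightarrow> (\<forall>p\<in>?P. ((\<lambda>x. modulation_pairing (s x) p) \<longlongrightarrow> modulation_pairing l p) F)"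
    by (simp add: limitin_componentwise)
  have gT: "?g f \<in> topspace ?T" for f by (simp add: topspace_product_topology)
  show ?thesis unfolding W lim[symmetric]
  proof
    assume L: "limitin ?W s l F"
    have "l \<in> topspace ?W" using L by (rule limitin_topspace)
    moreover have "limitin ?T (id \<circ> ?g \<circ> s) ((id \<circ> ?g) l) F"
      by (rule continuous_map_limit[OF continuous_map_pullback[OF continuous_map_id] L])
    ultimately show "l \<in> ?A \<and> limitin ?T (\<lambda>x. ?g (s x)) (?g l) F"
      by (simp add: topspace_pullback_topology o_def)
  next
    assume R: "l \<in> ?A \<and> limitin ?T (\<lambda>x. ?g (s x)) (?g l) F"
    show "limitin ?W s l F"
      unfolding limitin_def
    proof (intro conjI allI impI)
      show "l \<in> topspace ?W" using R gT by (simp add: topspace_pullback_topology)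
      fix U assume U: "openin ?W U \<and> l \<in> U"
      then obtain V where V: "openin ?T V" "U = ?g -` V \<inter> ?A" unfolding openin_pullback_topology by blast
      then have "\<forall>\<^sub>F x in F. ?g (s x) \<in> V" using R U unfolding limitin_def by auto
      then show "\<forall>\<^sub>F x in F. s x \<in> U" using ev by eventually_elim (simp add: V(2))
    qed
  qed
qed

section \<open>The synthesis series\<close>

definition lattice_round :: "real \<Rightarrow> real ^ 'd::finite \<Rightarrow> real ^ 'd" where
  "lattice_round \<epsilon> x = (\<chi> i. \<epsilon> * of_int \<lfloor>x $ i / \<epsilon>\<rfloor>)"

lemma lattice_round_in [simp]: "lattice_round \<epsilon> x \<in> lattice_pts \<epsilon>"
  by (auto simp: lattice_round_def lattice_pts_def)

lemma lattice_round_bounds: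
  assumes "\<epsilon> > 0"
  shows "lattice_round \<epsilon> x $ i \<le> x $ i" "x $ i \<le> lattice_round \<epsilon> x $ i + \<epsilon>"
proof -
  have "\<epsilon> * of_int \<lfloor>x $ i / \<epsilon>\<rfloor> \<le> \<epsilon> * (x $ i / \<epsilon>)" using assms by (intro mult_left_mono) auto
  then show "lattice_round \<epsilon> x $ i \<le> x $ i" using assms by (simp add: lattice_round_def)
  have "x $ i / \<epsilon> \<le> of_int \<lfloor>x $ i / \<epsilon>\<rfloor> + 1" by linarith
  then show "x $ i \<le> lattice_round \<epsilon> x $ i + \<epsilon>" using assms by (simp add: lattice_round_def field_simps)
qed

lemma norm_lattice_round:
  fixes x :: "real ^ 'd::finite" and \<epsilon> :: real
  assumes "\<epsilon> > 0"
  shows "norm (x - lattice_round \<epsilon> x) \<le> CARD('d) * \<epsilon>"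
proof -
  have "norm (x - lattice_round \<epsilon> x) \<le> (\<Sum>i\<in>UNIV. \<bar>(x - lattice_round \<epsilon> x) $ i\<bar>)" by (rule norm_le_l1_cart)
  also have "\<dots> \<le> (\<Sum>i\<in>(UNIV::'d set). \<epsilon>)"
  proof (rule sum_mono)
    fix i show "\<bar>(x - lattice_round \<epsilon> x) $ i\<bar> \<le> \<epsilon>"
      using lattice_round_bounds[OF assms, of x i] by simp
  qed
  finally show ?thesis by simp
qed

lemma lattice_pts_0: "0 \<in> lattice_pts \<epsilon>" by (auto simp: lattice_pts_def intro: exI[of _ 0])

text \<open>A reflection rather than a translation: it turns sums over k of functions of z - k into
  sums over the difference, and it is its own inverse.\<close>

lemma bij_betw_lattice_reflect:
  assumes "p \<in> lattice_pts \<epsilon> \<times> lattice_pts \<epsilon>"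
  shows "bij_betw (\<lambda>k. p - k) (lattice_pts \<epsilon> \<times> lattice_pts \<epsilon>) (lattice_pts \<epsilon> \<times> lattice_pts \<epsilon>)"
proof (rule bij_betw_byWitness[where f' = "\<lambda>k. p - k"])
  show "(\<lambda>k. p - k) ` (lattice_pts \<epsilon> \<times> lattice_pts \<epsilon>) \<subseteq> lattice_pts \<epsilon> \<times> lattice_pts \<epsilon>"
    using assms by (simp add: image_subset_iff mem_Times_iff lattice_pts_diff)
  then show "(\<lambda>k. p - k) ` (lattice_pts \<epsilon> \<times> lattice_pts \<epsilon>) \<subseteq> lattice_pts \<epsilon> \<times> lattice_pts \<epsilon>" .
qed auto

locale gabor_synthesis =
  fixes \<epsilon> r :: real and \<omega> v :: "(real ^ 'd::finite) \<times> (real ^ 'd) \<Rightarrow> real" and \<psi> :: "'d hermite_series"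
  assumes \<epsilon>: "\<epsilon> > 0" and r: "0 < r" "r \<le> 1" and \<omega>: "weight \<omega>" and mod: "moderate \<omega> v"
    and v: "submultiplicative v" and \<psi>: "\<psi> \<in> modulation_space_Lp r v"
begin

abbreviation L :: "((real ^ 'd) \<times> (real ^ 'd)) set" where "L \<equiv> lattice_pts \<epsilon> \<times> lattice_pts \<epsilon>"

definition atom :: "(real ^ 'd) \<times> (real ^ 'd) \<Rightarrow> 'd hermite_series" where
  "atom k = tf_shift (fst k) (snd k) \<psi>"

definition synth :: "((real ^ 'd) \<times> (real ^ 'd) \<Rightarrow> complex) \<Rightarrow> 'd hermite_series" where
  "synth c = (\<lambda>\<alpha>. \<Sum>\<^sub>\<infinity>k\<in>L. c k * atom k \<alpha>)"

text \<open>Bounds the distance to the rounded lattice point, by the l1 norm: CARD('d) \<epsilon>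
  for the position and the same for the frequency.\<close>

definition cell_radius :: real where "cell_radius = 2 * (CARD('d) * \<epsilon>)"

lemma \<omega>_pos: "\<omega> z > 0" using \<omega> unfolding weight_def by blast
lemma v_pos: "v z > 0" using v unfolding submultiplicative_def weight_def by blast
lemma v_even: "v (- z) = v z" using v unfolding submultiplicative_def by blast

lemma \<psi>_pil: "\<psi> \<in> pilipovic_dual" using \<psi> by (simp add: modulation_space_Lp_def)

lemma atom_pil: "atom k \<in> pilipovic_dual" unfolding atom_def by (rule tf_shift_pilipovic_dual[OF \<psi>_pil])

lemma norm_stft_atom: "norm (stft_gauss (atom k) z) = norm (stft_gauss \<psi> (z - k))"
  unfolding atom_def norm_stft_gauss_tf_shift[OF \<psi>_pil] prod.collapse ..

lemma countable_L: "countable L" by (intro countable_SIGMA countable_lattice_pts)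

lemma round_in_L:
  fixes z :: "(real ^ 'd) \<times> (real ^ 'd)"
  shows "(lattice_round \<epsilon> (fst z), lattice_round \<epsilon> (snd z)) \<in> L" by simp

lemma norm_round:
  fixes z :: "(real ^ 'd) \<times> (real ^ 'd)"
  shows "norm (z - (lattice_round \<epsilon> (fst z), lattice_round \<epsilon> (snd z))) \<le> cell_radius"
proof -
  have "norm (z - (lattice_round \<epsilon> (fst z), lattice_round \<epsilon> (snd z))) \<le>
      norm (fst z - lattice_round \<epsilon> (fst z)) + norm (snd z - lattice_round \<epsilon> (snd z))"
    using norm_Pair_le[of "fst z - lattice_round \<epsilon> (fst z)" "snd z - lattice_round \<epsilon> (snd z)"]
    by (simp add: norm_prod_def)
  then show ?thesis
    using norm_lattice_round[OF \<epsilon>, of "fst z"] norm_lattice_round[OF \<epsilon>, of "snd z"] by (simp add: cell_radius_def)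
qed

lemma cell_radius_nonneg: "cell_radius \<ge> 0" using \<epsilon> by (simp add: cell_radius_def)

section \<open>Lattice sums of translates of the window's transform\<close>

lemma amalgam_l1:
  assumes "R \<ge> 0"
  shows "\<exists>b. b summable_on L \<and> (\<forall>k. b k \<ge> 0) \<and> (\<forall>k u. norm (u - k) \<le> R \<longrightarrow> norm (stft_gauss \<psi> u) * v u \<le> b k)"
proof -
  obtain b where b: "b summable_on L" "\<And>k. b k \<ge> 0"
      "\<And>k u. norm (u - k) \<le> R \<Longrightarrow> (norm (stft_gauss \<psi> u) * v u) powr r \<le> b k"
    using stft_gauss_amalgam[OF \<epsilon> r v \<psi> assms] by blast
  have "norm (stft_gauss \<psi> u) * v u \<le> b k powr (1 / r)" if "norm (u - k) \<le> R" for k u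
  proof -
    have "norm (stft_gauss \<psi> u) * v u = ((norm (stft_gauss \<psi> u) * v u) powr r) powr (1 / r)"
      using r v_pos[of u] by (simp add: powr_powr)
    also have "\<dots> \<le> b k powr (1 / r)" using r b(3)[OF that] by (intro powr_mono2) auto
    finally show ?thesis .
  qed
  moreover have "(\<lambda>k. b k powr (1 / r)) summable_on L"
    using r by (intro summable_on_powr_ge_1 b) auto
  ultimately show ?thesis by (intro exI[of _ "\<lambda>k. b k powr (1 / r)"]) auto
qed

text \<open>If p is z rounded to the lattice, then z - k is within \<open>cell_radius\<close> of p -
  k. The local suprema at p - k run through the same family for every z, which gives a bound
  independent of z.\<close>

lemma uniform_lattice_sum:
  "\<exists>C\<ge>0. \<forall>z. (\<lambda>k. norm (stft_gauss \<psi> (z - k)) * v (z - k)) summable_on L \<and>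
     (\<Sum>\<^sub>\<infinity>k\<in>L. norm (stft_gauss \<psi> (z - k)) * v (z - k)) \<le> C"
proof -
  obtain b where b: "b summable_on L" "\<And>k. b k \<ge> 0"
      "\<And>k u. norm (u - k) \<le> cell_radius \<Longrightarrow> norm (stft_gauss \<psi> u) * v u \<le> b k"
    using amalgam_l1[OF cell_radius_nonneg] by blast
  have "(\<lambda>k. norm (stft_gauss \<psi> (z - k)) * v (z - k)) summable_on L \<and>
     (\<Sum>\<^sub>\<infinity>k\<in>L. norm (stft_gauss \<psi> (z - k)) * v (z - k)) \<le> infsum b L" for z
  proof -
    let ?p = "(lattice_round \<epsilon> (fst z), lattice_round \<epsilon> (snd z))"
    note bij = bij_betw_lattice_reflect[OF round_in_L[of z]]
    have s: "(\<lambda>k. b (?p - k)) summable_on L"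
      using b(1) summable_on_reindex_bij_betw[OF bij, of b] by simp
    have le: "norm (stft_gauss \<psi> (z - k)) * v (z - k) \<le> b (?p - k)" for k
      using norm_round[of z] by (intro b(3)) simp
    have s': "(\<lambda>k. norm (stft_gauss \<psi> (z - k)) * v (z - k)) summable_on L"
      by (rule summable_on_comparison_test[OF s le]) (intro mult_nonneg_nonneg norm_ge_zero less_imp_le[OF v_pos])
    have "(\<Sum>\<^sub>\<infinity>k\<in>L. norm (stft_gauss \<psi> (z - k)) * v (z - k)) \<le> (\<Sum>\<^sub>\<infinity>k\<in>L. b (?p - k))"
      by (rule infsum_mono[OF s' s le])
    also have "\<dots> = infsum b L" by (rule infsum_reindex_bij_betw[OF bij])
    finally show ?thesis using s' by simp
  qed
  moreover have "infsum b L \<ge> 0" by (intro infsum_nonneg b)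
  ultimately show ?thesis by blast
qed

definition mod_const :: real where
  "mod_const = (SOME C. C > 0 \<and> (\<forall>x y. \<omega> (x + y) \<le> C * (\<omega> x * v y)))"

lemma mod_const: "mod_const > 0" "\<omega> (x + y) \<le> mod_const * (\<omega> x * v y)"
proof -
  have "\<exists>C. C > 0 \<and> (\<forall>x y. \<omega> (x + y) \<le> C * (\<omega> x * v y))" using mod unfolding moderate_def by blast
  from someI_ex[OF this] show "mod_const > 0" "\<omega> (x + y) \<le> mod_const * (\<omega> x * v y)"
    unfolding mod_const_def by blast+
qed

text \<open>Moderateness at z = k + (z - k) moves the weight to the lattice point k, at the price of
  v (z - k) next to the transform of \<psi>.\<close>

lemma atom_weight_le:
  "norm (c k * stft_gauss (atom k) z) * \<omega> z \<le> mod_const * ((norm (c k) * \<omega> k) * (norm (stft_gauss \<psi> (z - k)) * v (z - k)))"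
proof -
  have "\<omega> z \<le> mod_const * (\<omega> k * v (z - k))" using mod_const(2)[of k "z - k"] by simp
  then have "norm (c k) * norm (stft_gauss \<psi> (z - k)) * \<omega> z \<le> norm (c k) * norm (stft_gauss \<psi> (z - k)) * (mod_const * (\<omega> k * v (z - k)))"
    by (intro mult_left_mono) auto
  then show ?thesis by (simp add: norm_mult norm_stft_atom mult_ac)
qed

definition uniform_const :: real where
  "uniform_const = (SOME C. C \<ge> 0 \<and> (\<forall>z. (\<lambda>k. norm (stft_gauss \<psi> (z - k)) * v (z - k)) summable_on L \<and>
     (\<Sum>\<^sub>\<infinity>k\<in>L. norm (stft_gauss \<psi> (z - k)) * v (z - k)) \<le> C))"

lemma uniform_const:
  "uniform_const \<ge> 0" "(\<lambda>k. norm (stft_gauss \<psi> (z - k)) * v (z - k)) summable_on L"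
  "(\<Sum>\<^sub>\<infinity>k\<in>L. norm (stft_gauss \<psi> (z - k)) * v (z - k)) \<le> uniform_const"
proof -
  from someI_ex[OF uniform_lattice_sum[unfolded Bex_def]]
  show "uniform_const \<ge> 0" "(\<lambda>k. norm (stft_gauss \<psi> (z - k)) * v (z - k)) summable_on L"
    "(\<Sum>\<^sub>\<infinity>k\<in>L. norm (stft_gauss \<psi> (z - k)) * v (z - k)) \<le> uniform_const"
    unfolding uniform_const_def by blast+
qed

text \<open>Existence and uniqueness of the synthesis concern bounded weighted sequences; the Orlicz
  condition enters here only through its embedding, \<open>sequence_space_bounded\<close>.\<close>

context
  fixes c :: "(real ^ 'd) \<times> (real ^ 'd) \<Rightarrow> complex" and A :: real
  assumes A: "A \<ge> 0" "\<And>k. k \<in> L \<Longrightarrow> norm (c k) * \<omega> k \<le> A"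
begin

lemma atom_sum_weighted:
  "(\<lambda>k. norm (c k * stft_gauss (atom k) z)) summable_on L"
  "(\<Sum>\<^sub>\<infinity>k\<in>L. norm (c k * stft_gauss (atom k) z)) \<le> mod_const * A * uniform_const / \<omega> z"
proof -
  let ?u = "\<lambda>k. mod_const * A / \<omega> z * (norm (stft_gauss \<psi> (z - k)) * v (z - k))"
  have le: "norm (c k * stft_gauss (atom k) z) \<le> ?u k" if "k \<in> L" for k
  proof -
    have "norm (c k * stft_gauss (atom k) z) * \<omega> z \<le> mod_const * (A * (norm (stft_gauss \<psi> (z - k)) * v (z - k)))"
      by (rule order.trans[OF atom_weight_le])
         (use mod_const(1) v_pos[of "z - k"] A(2)[OF that] in \<open>intro mult_left_mono mult_right_mono; simp\<close>)
    then show ?thesis using \<omega>_pos[of z] by (simp add: field_simps)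
  qed
  have s: "?u summable_on L" by (rule summable_on_cmult_right[OF uniform_const(2)])
  show s': "(\<lambda>k. norm (c k * stft_gauss (atom k) z)) summable_on L"
    by (rule summable_on_comparison_test[OF s le]) auto
  have "(\<Sum>\<^sub>\<infinity>k\<in>L. norm (c k * stft_gauss (atom k) z)) \<le> infsum ?u L" by (rule infsum_mono[OF s' s le])
  also have "\<dots> = mod_const * A / \<omega> z * (\<Sum>\<^sub>\<infinity>k\<in>L. norm (stft_gauss \<psi> (z - k)) * v (z - k))"
    by (rule infsum_cmult_right')
  also have "\<dots> \<le> mod_const * A / \<omega> z * uniform_const"
    using mod_const(1) A(1) \<omega>_pos[of z] by (intro mult_left_mono uniform_const(3)) simp
  finally show "(\<Sum>\<^sub>\<infinity>k\<in>L. norm (c k * stft_gauss (atom k) z)) \<le> mod_const * A * uniform_const / \<omega> z" by simp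
qed

text \<open>Here the majorant must be uniform in z over a ball. The growth of c k is at most that of
  1 / \<omega>, hence of v k, and v k is at most a multiple of v z v (z - k). The index - k occurs
  because z - k lies within R of - k.\<close>

lemma atom_dominated_local:
  assumes R: "R > 0"
  shows "\<exists>b. b summable_on L \<and> (\<forall>k. b k \<ge> 0) \<and> (\<forall>k\<in>L. \<forall>z. norm z \<le> R \<longrightarrow> norm (c k * stft_gauss (atom k) z) \<le> b k)"
proof -
  obtain b where b: "b summable_on L" "\<And>k. b k \<ge> 0"
      "\<And>k u. norm (u - k) \<le> R \<Longrightarrow> norm (stft_gauss \<psi> u) * v u \<le> b k"
    using amalgam_l1[of R] R by auto
  obtain Ci where Ci: "Ci > 0" "\<And>z. 1 / \<omega> z \<le> Ci * v z" using moderate_inverse_bound[OF \<omega> mod v] by blast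
  obtain Cs where Cs: "Cs > 0" "\<And>x y. v (x + y) \<le> Cs * (v x * v y)" using v unfolding submultiplicative_def by blast
  obtain B where B: "B > 0" "\<And>z. norm z \<le> R \<Longrightarrow> v z \<le> B" using submultiplicative_locally_bounded[OF v, of R] by blast
  let ?D = "A * Ci * Cs * B"
  have D: "?D \<ge> 0" using A(1) Ci Cs B by simp
  have "norm (c k * stft_gauss (atom k) z) \<le> ?D * b (- k)" if k: "k \<in> L" and z: "norm z \<le> R" for k z
  proof -
    have "norm (c k) \<le> A * (1 / \<omega> k)" using A(2)[OF k] \<omega>_pos[of k] by (simp add: field_simps)
    also have "\<dots> \<le> A * (Ci * v k)" by (intro mult_left_mono Ci A)
    also have "v k \<le> Cs * (v z * v (z - k))" using Cs(2)[of z "- (z - k)"] by (simp only: v_even) simp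
    also have "v z \<le> B" by (rule B(2)[OF z])
    finally have "norm (c k) \<le> A * (Ci * (Cs * (B * v (z - k))))"
      using A(1) Ci(1) Cs(1) v_pos[of "z - k"] by (simp add: mult_left_mono mult_right_mono)
    then have "norm (c k) * norm (stft_gauss \<psi> (z - k)) \<le> A * (Ci * (Cs * (B * v (z - k)))) * norm (stft_gauss \<psi> (z - k))"
      by (intro mult_right_mono) auto
    also have "\<dots> = ?D * (norm (stft_gauss \<psi> (z - k)) * v (z - k))" by (simp add: mult_ac)
    also have "\<dots> \<le> ?D * b (- k)" using z by (intro mult_left_mono b(3) D) simp
    finally show ?thesis by (simp add: norm_mult norm_stft_atom)
  qed
  moreover have "(\<lambda>k. ?D * b (- k)) summable_on L"
  proof (rule summable_on_cmult_right)
    have "(0 :: (real ^ 'd) \<times> (real ^ 'd)) \<in> L" by (simp add: mem_Times_iff lattice_pts_0)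
    from summable_on_reindex_bij_betw[OF bij_betw_lattice_reflect[OF this], of b] b(1)
    show "(\<lambda>k. b (- k)) summable_on L" by simp
  qed
  ultimately show ?thesis using b(2) D by (intro exI[of _ "\<lambda>k. ?D * b (- k)"]) auto
qed

text \<open>The coefficients of the shifted windows are never estimated directly; the Cauchy
  estimate derives their majorant from the one for the transforms.\<close>

lemma atom_dominated_coeff:
  assumes s: "s > 0"
  shows "\<exists>b. b summable_on L \<and> (\<forall>k\<in>L. \<forall>\<alpha>. norm (c k * atom k \<alpha>) * monomial_weight s \<alpha> \<le> b k)"
proof -
  obtain C R where CR: "C \<ge> 0" "R > 0"
    "\<And>f M \<alpha>. f \<in> (pilipovic_dual :: 'd hermite_series set) \<Longrightarrow> M \<ge> 0 \<Longrightarrow>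
       (\<And>z. norm z < R \<Longrightarrow> norm (stft_gauss f z) \<le> M) \<Longrightarrow> norm (f \<alpha>) * monomial_weight s \<alpha> \<le> C * M"
    using hermite_coefficient_bound[OF s, where 'd = 'd] by blast
  obtain b where b: "b summable_on L" "\<And>k. b k \<ge> 0"
    "\<And>k z. k \<in> L \<Longrightarrow> norm z \<le> R \<Longrightarrow> norm (c k * stft_gauss (atom k) z) \<le> b k"
    using atom_dominated_local[OF CR(2)] by blast
  have "norm (c k * atom k \<alpha>) * monomial_weight s \<alpha> \<le> C * b k" if "k \<in> L" for k \<alpha>
    using CR(3)[OF pilipovic_dual_scale[OF atom_pil[of k], of "c k"] b(2)[of k], of \<alpha>]
      b(3)[OF that] by (simp add: stft_gauss_scale)
  moreover have "(\<lambda>k. C * b k) summable_on L" by (rule summable_on_cmult_right[OF b(1)])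
  ultimately show ?thesis by blast
qed

lemma atom_summable: "(\<lambda>k. c k * atom k \<alpha>) summable_on L"
proof -
  obtain b where b: "b summable_on L" "\<And>k \<alpha>. k \<in> L \<Longrightarrow> norm (c k * atom k \<alpha>) * monomial_weight 1 \<alpha> \<le> b k"
    using atom_dominated_coeff[of 1] by auto
  have p: "monomial_weight 1 \<alpha> > 0" by (rule monomial_weight_pos) simp
  have "(\<lambda>k. b k * (1 / monomial_weight 1 \<alpha>)) summable_on L" by (rule summable_on_cmult_left[OF b(1)])
  then have "(\<lambda>k. norm (c k * atom k \<alpha>)) summable_on L"
    by (rule summable_on_comparison_test) (use b(2) p in \<open>auto simp: field_simps\<close>)
  then show ?thesis by (rule abs_summable_summable)
qed

lemma synth_pil: "synth c \<in> pilipovic_dual"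
  unfolding synth_def by (rule pilipovic_dual_infsum(1)[OF atom_dominated_coeff])

lemma stft_synth: "((\<lambda>k. c k * stft_gauss (atom k) z) has_sum stft_gauss (synth c) z) L"
  using pilipovic_dual_infsum(2)[OF atom_dominated_coeff, where z = z]
  unfolding synth_def stft_gauss_scale by simp

lemma synth_Linf: "synth c \<in> modulation_space_Linf \<omega>"
proof -
  have "norm (stft_gauss (synth c) z) * \<omega> z \<le> mod_const * A * uniform_const" for z
  proof -
    have "norm (stft_gauss (synth c) z) \<le> (\<Sum>\<^sub>\<infinity>k\<in>L. norm (c k * stft_gauss (atom k) z))"
      using norm_infsum_bound[OF atom_sum_weighted(1)[of z]] infsumI[OF stft_synth[of z]] by simp
    also have "\<dots> \<le> mod_const * A * uniform_const / \<omega> z" by (rule atom_sum_weighted(2))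
    finally show ?thesis using \<omega>_pos[of z] by (simp add: field_simps)
  qed
  then have "\<exists>C. AE z in lebesgue. norm (stft_gauss (synth c) z) * \<omega> z \<le> C" by (intro exI AE_I2)
  then show ?thesis using synth_pil unfolding modulation_space_Linf_def by blast
qed

lemma partial_sum_Linf:
  assumes S: "finite S" "S \<subseteq> L"
  shows "(\<lambda>\<alpha>. \<Sum>k\<in>S. c k * atom k \<alpha>) \<in> modulation_space_Linf \<omega>"
    and "stft_gauss (\<lambda>\<alpha>. \<Sum>k\<in>S. c k * atom k \<alpha>) z = (\<Sum>k\<in>S. c k * stft_gauss (atom k) z)"
proof -
  have pil: "(\<lambda>\<alpha>. c k * atom k \<alpha>) \<in> pilipovic_dual" for k by (rule pilipovic_dual_scale[OF atom_pil])
  show eq: "stft_gauss (\<lambda>\<alpha>. \<Sum>k\<in>S. c k * atom k \<alpha>) z = (\<Sum>k\<in>S. c k * stft_gauss (atom k) z)" for z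
    by (simp add: stft_gauss_sum[OF S(1) pil] stft_gauss_scale)
  have "norm (stft_gauss (\<lambda>\<alpha>. \<Sum>k\<in>S. c k * atom k \<alpha>) z) * \<omega> z \<le> mod_const * A * uniform_const" for z
  proof -
    have "norm (stft_gauss (\<lambda>\<alpha>. \<Sum>k\<in>S. c k * atom k \<alpha>) z) \<le> (\<Sum>k\<in>S. norm (c k * stft_gauss (atom k) z))"
      unfolding eq by (rule norm_sum)
    also have "\<dots> \<le> (\<Sum>\<^sub>\<infinity>k\<in>L. norm (c k * stft_gauss (atom k) z))"
      by (rule finite_sum_le_infsum[OF atom_sum_weighted(1) S]) auto
    also have "\<dots> \<le> mod_const * A * uniform_const / \<omega> z" by (rule atom_sum_weighted(2))
    finally show ?thesis using \<omega>_pos[of z] by (simp add: field_simps)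
  qed
  then show "(\<lambda>\<alpha>. \<Sum>k\<in>S. c k * atom k \<alpha>) \<in> modulation_space_Linf \<omega>"
    using pilipovic_dual_sum[OF S(1) pil] unfolding modulation_space_Linf_def mem_Collect_eq
    by (intro conjI exI AE_I2)
qed

text \<open>The weights \<omega> and 1 / \<omega> cancel in the total integral of the moduli, which
  is finite by Tonelli; the series can therefore be paired term by term.\<close>

lemma pairing_has_sum:
  assumes p: "p \<in> modulation_space_Lp 1 (\<lambda>z. 1 / \<omega> z)"
  shows "((\<lambda>k. LINT z|lebesgue. c k * stft_gauss (atom k) z * cnj (stft_gauss p z)) has_sum modulation_pairing (synth c) p) L"
    and "k \<in> L \<Longrightarrow> integrable lebesgue (\<lambda>z. c k * stft_gauss (atom k) z * cnj (stft_gauss p z))"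
proof -
  have ppil: "p \<in> pilipovic_dual" and fin: "(\<integral>\<^sup>+z. ennreal ((norm (stft_gauss p z) * (1 / \<omega> z)) powr 1) \<partial>lebesgue) < top"
    using p by (auto simp: modulation_space_Lp_def)
  have [measurable]: "stft_gauss (atom k) \<in> borel_measurable lebesgue" for k
    using borel_measurable_stft_gauss[OF atom_pil[of k]] by (simp add: measurable_completion)
  have pm [measurable]: "stft_gauss p \<in> borel_measurable lebesgue"
    using borel_measurable_stft_gauss[OF ppil] by (simp add: measurable_completion)
  have \<omega>m [measurable]: "\<omega> \<in> borel_measurable lebesgue" using \<omega> unfolding weight_def by blast
  let ?h = "\<lambda>k z. c k * stft_gauss (atom k) z * cnj (stft_gauss p z)"
  let ?B = "mod_const * A * uniform_const"
  have B: "?B \<ge> 0" using mod_const(1) A(1) uniform_const(1) by simp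
  have hm: "?h k \<in> borel_measurable lebesgue" for k by measurable
  have ps: "(\<lambda>k. norm (?h k z)) summable_on L" for z
    using summable_on_cmult_left[OF atom_sum_weighted(1)[of z], of "norm (stft_gauss p z)"] by (simp add: norm_mult)
  have tot: "(\<integral>\<^sup>+k. (\<integral>\<^sup>+z. ennreal (norm (?h k z)) \<partial>lebesgue) \<partial>count_space L) < top"
  proof -
    have "(\<integral>\<^sup>+k. (\<integral>\<^sup>+z. ennreal (norm (?h k z)) \<partial>lebesgue) \<partial>count_space L) =
        (\<integral>\<^sup>+z. (\<integral>\<^sup>+k. ennreal (norm (?h k z)) \<partial>count_space L) \<partial>lebesgue)"
      by (rule nn_integral_count_space_nn_integral[symmetric, OF countable_L]) measurable
    also have "\<dots> \<le> (\<integral>\<^sup>+z. ennreal ?B * ennreal ((norm (stft_gauss p z) * (1 / \<omega> z)) powr 1) \<partial>lebesgue)"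
    proof (rule nn_integral_mono)
      fix z
      have "(\<integral>\<^sup>+k. ennreal (norm (?h k z)) \<partial>count_space L) = ennreal (\<Sum>\<^sub>\<infinity>k\<in>L. norm (?h k z))"
        by (rule infsum_eq_nn_integral[symmetric, OF _ ps]) simp
      also have "(\<Sum>\<^sub>\<infinity>k\<in>L. norm (?h k z)) = (\<Sum>\<^sub>\<infinity>k\<in>L. norm (c k * stft_gauss (atom k) z)) * norm (stft_gauss p z)"
        unfolding infsum_cmult_left'[symmetric] by (simp add: norm_mult)
      also have "ennreal \<dots> \<le> ennreal (?B / \<omega> z * norm (stft_gauss p z))"
        by (intro ennreal_leI mult_right_mono atom_sum_weighted(2)) auto
      also have "?B / \<omega> z * norm (stft_gauss p z) = ?B * (norm (stft_gauss p z) * (1 / \<omega> z)) powr 1"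
        using \<omega>_pos[of z] by simp
      also have "ennreal \<dots> = ennreal ?B * ennreal ((norm (stft_gauss p z) * (1 / \<omega> z)) powr 1)"
        by (rule ennreal_mult[OF B]) simp
      finally show "(\<integral>\<^sup>+k. ennreal (norm (?h k z)) \<partial>count_space L) \<le> \<dots>" .
    qed
    also have "\<dots> = ennreal ?B * (\<integral>\<^sup>+z. ennreal ((norm (stft_gauss p z) * (1 / \<omega> z)) powr 1) \<partial>lebesgue)"
      by (rule nn_integral_cmult) measurable
    also have "\<dots> < top" using fin by (simp add: ennreal_mult_less_top)
    finally show ?thesis .
  qed
  have fink: "(\<integral>\<^sup>+z. ennreal (norm (?h k z)) \<partial>lebesgue) < top" if k: "k \<in> L" for k
  proof -
    have "(\<integral>\<^sup>+z. ennreal (norm (?h k z)) \<partial>lebesgue) \<le> (\<integral>\<^sup>+k. (\<integral>\<^sup>+z. ennreal (norm (?h k z)) \<partial>lebesgue) \<partial>count_space L)"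
      using k by (rule nn_integral_ge_point)
    then show ?thesis using tot by (rule le_less_trans)
  qed
  show int: "integrable lebesgue (?h k)" if k: "k \<in> L" for k
    using hm fink[OF k] unfolding integrable_iff_bounded infinity_ennreal_def by (intro conjI)
  have "(\<lambda>k. LINT z|lebesgue. norm (?h k z)) summable_on L"
  proof (subst summable_on_iff_nn_integral)
    have "(\<integral>\<^sup>+k. ennreal (LINT z|lebesgue. norm (?h k z)) \<partial>count_space L) =
        (\<integral>\<^sup>+k. (\<integral>\<^sup>+z. ennreal (norm (?h k z)) \<partial>lebesgue) \<partial>count_space L)"
      by (intro nn_integral_cong nn_integral_eq_integral[symmetric] integrable_norm int) auto
    then show "(\<integral>\<^sup>+k. ennreal (LINT z|lebesgue. norm (?h k z)) \<partial>count_space L) < top" using tot by simp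
  qed simp
  then have "((\<lambda>k. LINT z|lebesgue. ?h k z) has_sum (LINT z|lebesgue. (\<Sum>\<^sub>\<infinity>k\<in>L. ?h k z))) L"
    by (intro has_sum_integral countable_L int ps)
  also have "(LINT z|lebesgue. (\<Sum>\<^sub>\<infinity>k\<in>L. ?h k z)) = modulation_pairing (synth c) p"
    unfolding modulation_pairing_def infsum_cmult_left' infsumI[OF stft_synth] ..
  finally show "((\<lambda>k. LINT z|lebesgue. ?h k z) has_sum modulation_pairing (synth c) p) L" .
qed

text \<open>The equivalence makes the definite description in \<open>synthesis\<close> meaningful.
  Termwise pairing gives the limit; separation by the predual gives its uniqueness.\<close>

lemma synthesizes_iff: "synthesizes \<epsilon> \<omega> \<psi> c f \<longleftrightarrow> f = synth c"
proof -
  let ?s = "\<lambda>S \<alpha>. \<Sum>(j, \<iota>)\<in>S. c (j, \<iota>) * tf_shift j \<iota> \<psi> \<alpha>"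
  have s: "?s S = (\<lambda>\<alpha>. \<Sum>k\<in>S. c k * atom k \<alpha>)" for S by (simp add: atom_def case_prod_unfold)
  have ev: "\<forall>\<^sub>F S in finite_subsets_at_top L. ?s S \<in> modulation_space_Linf \<omega>"
    unfolding s by (intro eventually_finite_subsets_at_top_weakI partial_sum_Linf(1))
  have lim: "((\<lambda>S. modulation_pairing (?s S) p) \<longlongrightarrow> modulation_pairing (synth c) p) (finite_subsets_at_top L)"
    if p: "p \<in> modulation_space_Lp 1 (\<lambda>z. 1 / \<omega> z)" for p
  proof (rule Lim_transform_eventually)
    show "(sum (\<lambda>k. LINT z|lebesgue. c k * stft_gauss (atom k) z * cnj (stft_gauss p z)) \<longlongrightarrow>
        modulation_pairing (synth c) p) (finite_subsets_at_top L)"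
      using pairing_has_sum(1)[OF p] unfolding has_sum_def .
    show "\<forall>\<^sub>F S in finite_subsets_at_top L.
        (\<Sum>k\<in>S. LINT z|lebesgue. c k * stft_gauss (atom k) z * cnj (stft_gauss p z)) = modulation_pairing (?s S) p"
    proof (rule eventually_finite_subsets_at_top_weakI)
      fix S assume S: "finite S" "S \<subseteq> L"
      have "modulation_pairing (?s S) p = (LINT z|lebesgue. (\<Sum>k\<in>S. c k * stft_gauss (atom k) z * cnj (stft_gauss p z)))"
        unfolding modulation_pairing_def s partial_sum_Linf(2)[OF S] sum_distrib_right ..
      also have "\<dots> = (\<Sum>k\<in>S. LINT z|lebesgue. c k * stft_gauss (atom k) z * cnj (stft_gauss p z))"
        using S by (intro Bochner_Integration.integral_sum pairing_has_sum(2)[OF p]) auto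
      finally show "(\<Sum>k\<in>S. LINT z|lebesgue. c k * stft_gauss (atom k) z * cnj (stft_gauss p z)) = modulation_pairing (?s S) p" ..
    qed
  qed
  show ?thesis
    unfolding synthesizes_def weak_star_limitin_iff[OF ev]
  proof safe
    assume f: "f \<in> modulation_space_Linf \<omega>"
      and pf: "\<forall>p\<in>modulation_space_Lp 1 (\<lambda>z. 1 / \<omega> z).
        ((\<lambda>S. modulation_pairing (?s S) p) \<longlongrightarrow> modulation_pairing f p) (finite_subsets_at_top L)"
    show "f = synth c"
    proof (rule modulation_space_Linf_eqI[OF \<omega> mod v f synth_Linf])
      fix p assume p: "p \<in> modulation_space_Lp 1 (\<lambda>z. 1 / \<omega> z)"
      show "modulation_pairing f p = modulation_pairing (synth c) p"
        by (rule tendsto_unique[OF finite_subsets_at_top_neq_bot bspec[OF pf p] lim[OF p]])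
    qed
  next
    show "synth c \<in> modulation_space_Linf \<omega>" by (rule synth_Linf)
  next
    fix p assume "p \<in> modulation_space_Lp 1 (\<lambda>z. 1 / \<omega> z)"
    then show "((\<lambda>S. modulation_pairing (?s S) p) \<longlongrightarrow> modulation_pairing (synth c) p) (finite_subsets_at_top L)"
      by (rule lim)
  qed
qed

lemma synthesis_eq: "synthesis \<epsilon> \<omega> \<psi> c = synth c"
  unfolding synthesis_def synthesizes_iff by simp

end

end

section \<open>Orlicz quasi-norms of lattice convolutions\<close>

lemma young_function_sub:
  assumes "young_function \<Phi>" "t \<ge> 0" "0 \<le> u" "u \<le> 1"
  shows "\<Phi> (u * t) \<le> ennreal u * \<Phi> t"
proof -
  have "\<Phi> (u * t + (1 - u) * 0) \<le> ennreal u * \<Phi> t + ennreal (1 - u) * \<Phi> 0"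
    using assms unfolding young_function_def by (metis atLeastAtMost_iff order_refl)
  then show ?thesis using assms(1) by (simp add: young_function_def)
qed

lemma young_function_mono:
  assumes "young_function \<Phi>" "0 \<le> s" "s \<le> t"
  shows "\<Phi> s \<le> \<Phi> t"
proof (cases "t = 0")
  case False
  then have t: "t > 0" using assms by simp
  have "\<Phi> (s / t * t) \<le> ennreal (s / t) * \<Phi> t"
    using assms t by (intro young_function_sub) (auto simp: divide_le_eq_1)
  also have "\<dots> \<le> 1 * \<Phi> t"
    using assms t by (intro mult_right_mono) (auto simp: ennreal_le_1 divide_le_eq_1)
  finally show ?thesis using t by simp
qed (use assms in auto)

text \<open>Total weight at most 1 is enough, since the missing mass sits at 0, where \<Phi>
  vanishes. The induction splits off one point and renormalizes the others by 1 - p x; for p x = 1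
  the others have weight 0.\<close>

lemma young_function_jensen:
  assumes \<Phi>: "young_function \<Phi>" and "finite S"
    and "\<And>k. k \<in> S \<Longrightarrow> p k \<ge> 0" "\<And>k. k \<in> S \<Longrightarrow> t k \<ge> 0" "sum p S \<le> 1"
  shows "\<Phi> (\<Sum>k\<in>S. p k * t k) \<le> (\<Sum>k\<in>S. ennreal (p k) * \<Phi> (t k))"
  using assms(2-)
proof (induction S arbitrary: p rule: finite_induct)
  case empty
  then show ?case using \<Phi> by (simp add: young_function_def)
next
  case (insert x S)
  have px: "0 \<le> p x" "p x \<le> 1"
    using insert.prems insert.hyps sum_nonneg[of S p] by auto
  show ?case
  proof (cases "p x = 1")
    case True
    then have "sum p S \<le> 0" using insert by simp
    then have 0: "p k = 0" if "k \<in> S" for k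
      using insert.prems(1) insert.hyps(1) that
      by (metis insertCI order_antisym sum_nonneg sum_nonneg_eq_0_iff)
    then have "(\<Sum>k\<in>S. p k * t k) = 0" by (intro sum.neutral) auto
    then show ?thesis using insert True by simp
  next
    case False
    then have q: "1 - p x > 0" using px by simp
    let ?p = "\<lambda>k. p k / (1 - p x)"
    let ?s = "\<Sum>k\<in>S. ?p k * t k"
    have IH: "\<Phi> ?s \<le> (\<Sum>k\<in>S. ennreal (?p k) * \<Phi> (t k))"
    proof (rule insert.IH)
      show "sum ?p S \<le> 1" using insert q by (simp add: sum_divide_distrib[symmetric])
    qed (use insert q in auto)
    have "?s \<ge> 0" using insert q by (intro sum_nonneg) auto
    moreover have "t x \<ge> 0" using insert by simp
    ultimately have "\<Phi> (p x * t x + (1 - p x) * ?s) \<le> ennreal (p x) * \<Phi> (t x) + ennreal (1 - p x) * \<Phi> ?s"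
      using \<Phi> px unfolding young_function_def by auto
    also have "\<dots> \<le> ennreal (p x) * \<Phi> (t x) + ennreal (1 - p x) * (\<Sum>k\<in>S. ennreal (?p k) * \<Phi> (t k))"
      by (intro add_left_mono mult_left_mono IH) auto
    also have "ennreal (1 - p x) * (\<Sum>k\<in>S. ennreal (?p k) * \<Phi> (t k)) = (\<Sum>k\<in>S. ennreal (p k) * \<Phi> (t k))"
      unfolding sum_distrib_left
    proof (intro sum.cong refl)
      fix k assume "k \<in> S"
      then have "ennreal (1 - p x) * ennreal (?p k) = ennreal (p k)"
        using insert.prems(1) q by (subst ennreal_mult[symmetric]) auto
      then show "ennreal (1 - p x) * (ennreal (?p k) * \<Phi> (t k)) = ennreal (p k) * \<Phi> (t k)"
        by (simp add: mult.assoc[symmetric])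
    qed
    also have "p x * t x + (1 - p x) * ?s = (\<Sum>k\<in>insert x S. p k * t k)"
      using insert q by (simp add: sum_distrib_left)
    finally show ?thesis using insert by simp
  qed
qed

lemma sum_le_nn_integral_count_space:
  assumes "finite F" "F \<subseteq> I"
  shows "(\<Sum>k\<in>F. g k) \<le> (\<integral>\<^sup>+k. g k \<partial>count_space I)"
proof -
  have "(\<Sum>k\<in>F. g k) = (\<Sum>k\<in>F. g k * emeasure (count_space I) {k})"
    using assms by (intro sum.cong) (auto simp: emeasure_count_space_finite)
  also have "\<dots> = (\<integral>\<^sup>+k. g k * indicator F k \<partial>count_space I)"
    using assms by (intro nn_integral_indicator_finite[symmetric]) auto
  also have "\<dots> \<le> (\<integral>\<^sup>+k. g k \<partial>count_space I)"
    by (intro nn_integral_mono) (auto simp: indicator_def)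
  finally show ?thesis .
qed

text \<open>The factor \<open>1 / 2\<close> is needed because a Young function need not be left-continuous.\<close>

lemma young_function_jensen_countable:
  assumes \<Phi>: "young_function \<Phi>"
    and nn: "\<And>k. k \<in> I \<Longrightarrow> p k \<ge> 0" "\<And>k. k \<in> I \<Longrightarrow> t k \<ge> 0"
    and p: "(\<integral>\<^sup>+k. ennreal (p k) \<partial>count_space I) \<le> 1"
    and s: "s \<ge> 0" "ennreal s \<le> (\<integral>\<^sup>+k. ennreal (p k * t k) \<partial>count_space I)"
  shows "\<Phi> (s / 2) \<le> (\<integral>\<^sup>+k. ennreal (p k) * \<Phi> (t k) \<partial>count_space I)"
proof (cases "s = 0")
  case True
  then show ?thesis using \<Phi> by (simp add: young_function_def)
next
  case False
  let ?f = "\<lambda>k. p k * t k"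
  have f: "?f k \<ge> 0" if "k \<in> I" for k using nn that by simp
  \<comment> \<open>Some finite subsum reaches half of s, even if the full sum is infinite, so
    finite Jensen and monotonicity are enough.\<close>
  obtain F where F: "finite F" "F \<subseteq> I" "s / 2 \<le> sum ?f F"
  proof (rule ccontr)
    assume "\<not> thesis"
    then have le: "sum ?f F \<le> s / 2" if "finite F" "F \<subseteq> I" for F
      using that \<open>\<And>F. finite F \<Longrightarrow> F \<subseteq> I \<Longrightarrow> s / 2 \<le> sum ?f F \<Longrightarrow> thesis\<close> by (meson linear)
    have sm: "?f summable_on I"
      by (rule nonneg_bdd_above_summable_on) (use f le in \<open>auto intro!: bdd_aboveI2[where M = "s / 2"]\<close>)
    have "infsum ?f I \<le> s / 2" by (rule infsum_le_finite_sums[OF sm le])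
    moreover have "s \<le> infsum ?f I"
    proof -
      have "ennreal s \<le> ennreal (infsum ?f I)"
        by (rule order.trans[OF s(2) eq_refl[OF infsum_eq_nn_integral[of I ?f, OF f sm, symmetric]]])
      then show ?thesis using infsum_nonneg[of I ?f, OF f] by (subst (asm) ennreal_le_iff)
    qed
    ultimately show False using s(1) False by simp
  qed
  have "ennreal (sum p F) = (\<Sum>k\<in>F. ennreal (p k))" using F nn by (intro sum_ennreal[symmetric]) auto
  also have "\<dots> \<le> 1" using sum_le_nn_integral_count_space[OF F(1,2), of "\<lambda>k. ennreal (p k)"] p by simp
  finally have pF: "sum p F \<le> 1" by (simp add: ennreal_le_1)
  have "\<Phi> (s / 2) \<le> \<Phi> (sum ?f F)" using F(3) s(1) by (intro young_function_mono[OF \<Phi>]) auto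
  also have "\<dots> \<le> (\<Sum>k\<in>F. ennreal (p k) * \<Phi> (t k))"
    using F nn pF by (intro young_function_jensen[OF \<Phi>]) auto
  also have "\<dots> \<le> (\<integral>\<^sup>+k. ennreal (p k) * \<Phi> (t k) \<partial>count_space I)"
    by (rule sum_le_nn_integral_count_space[OF F(1,2)])
  finally show ?thesis .
qed

lemma quasi_young_function_mono:
  assumes "quasi_young_function r \<Phi>" "0 \<le> s" "s \<le> t"
  shows "\<Phi> s \<le> \<Phi> t"
proof -
  obtain \<Phi>0 where \<Phi>0: "young_function \<Phi>0" "\<And>t. t \<ge> 0 \<Longrightarrow> \<Phi> t = \<Phi>0 (t powr r)" and r: "0 < r"
    using assms(1) unfolding quasi_young_function_def by blast
  have "\<Phi>0 (s powr r) \<le> \<Phi>0 (t powr r)"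
    using assms r by (intro young_function_mono[OF \<Phi>0(1)] powr_mono2) auto
  then show ?thesis using \<Phi>0(2) assms by simp
qed

lemma quasi_young_function_0: "quasi_young_function r \<Phi> \<Longrightarrow> \<Phi> 0 = 0"
  unfolding quasi_young_function_def young_function_def by force

lemma extend_top_mono:
  assumes "quasi_young_function r \<Phi>" "s \<le> t"
  shows "extend_top \<Phi> s \<le> extend_top \<Phi> t"
proof (cases "t = top")
  case False
  then have "s \<noteq> top" using assms(2) by (metis top.extremum_unique)
  moreover have "\<Phi> (enn2real s) \<le> \<Phi> (enn2real t)"
    using assms False by (intro quasi_young_function_mono[OF assms(1)] enn2real_mono) (auto simp: less_top)
  ultimately show ?thesis using False by (simp add: extend_top_def)
qed (simp add: extend_top_def)

section \<open>Orlicz quasi-norms\<close>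

lemma extend_top_ennreal_divide:
  "x \<ge> 0 \<Longrightarrow> l > 0 \<Longrightarrow> extend_top \<Phi> (ennreal x / ennreal l) = \<Phi> (x / l)"
  by (simp add: divide_ennreal extend_top_def)

lemma orlicz_norm_leI:
  "l > 0 \<Longrightarrow> (\<integral>\<^sup>+x. extend_top \<Phi> (f x / ennreal l) \<partial>M) \<le> 1 \<Longrightarrow> orlicz_norm M \<Phi> f \<le> ennreal l"
  unfolding orlicz_norm_def by (rule Inf_lower) blast

lemma orlicz_norm_lessE:
  assumes "orlicz_norm M \<Phi> f < c"
  obtains l where "l > 0" "ennreal l < c" "(\<integral>\<^sup>+x. extend_top \<Phi> (f x / ennreal l) \<partial>M) \<le> 1"
  using assms unfolding orlicz_norm_def Inf_less_iff by auto

lemma orlicz_norm_mono: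
  assumes "quasi_young_function r \<Phi>" "\<And>x. f x \<le> g x"
  shows "orlicz_norm M \<Phi> f \<le> orlicz_norm M \<Phi> g"
  unfolding orlicz_norm_def
proof (rule Inf_superset_mono, safe)
  fix l :: real assume l: "0 < l" "(\<integral>\<^sup>+x. extend_top \<Phi> (g x / ennreal l) \<partial>M) \<le> 1"
  have "(\<integral>\<^sup>+x. extend_top \<Phi> (f x / ennreal l) \<partial>M) \<le> (\<integral>\<^sup>+x. extend_top \<Phi> (g x / ennreal l) \<partial>M)"
    by (intro nn_integral_mono extend_top_mono[OF assms(1)] divide_right_mono_ennreal assms(2))
  then show "\<exists>l'. ennreal l = ennreal l' \<and> 0 < l' \<and> (\<integral>\<^sup>+x. extend_top \<Phi> (f x / ennreal l') \<partial>M) \<le> 1"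
    using l by (intro exI[of _ l]) auto
qed

lemma orlicz_norm_zero:
  assumes "quasi_young_function r \<Phi>"
  shows "orlicz_norm M \<Phi> (\<lambda>_. 0) = 0"
proof -
  have "orlicz_norm M \<Phi> (\<lambda>_. 0) \<le> ennreal e" if "e > 0" for e
    using that quasi_young_function_0[OF assms] by (intro orlicz_norm_leI) (simp_all add: extend_top_def)
  then show ?thesis by (metis ennreal_le_epsilon add_0 le_zero_eq)
qed

text \<open>Points have mass 1, so an admissible l satisfies \<Phi> (f p / l) \<le> 1; since \<Phi>
  exceeds 1 from some T on, f p \<le> T l. The constant depends on \<Phi> only. This is the
  embedding into bounded sequences.\<close>

lemma orlicz_norm_count_space_pointwise:
  assumes "quasi_young_function r \<Phi>"
  shows "\<exists>T>0. \<forall>A. \<forall>f. \<forall>p\<in>A. f p \<le> ennreal T * orlicz_norm (count_space A) \<Phi> f"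
proof -
  obtain \<Phi>0 where \<Phi>0: "young_function \<Phi>0" "\<And>t. t \<ge> 0 \<Longrightarrow> \<Phi> t = \<Phi>0 (t powr r)" and r: "0 < r"
    using assms unfolding quasi_young_function_def by blast
  have "\<forall>\<^sub>F x in at_top. \<Phi>0 x > 1"
    using \<Phi>0(1) unfolding young_function_def by (auto intro: order_tendstoD(1))
  then obtain S where S: "\<And>x. x \<ge> S \<Longrightarrow> \<Phi>0 x > 1" unfolding eventually_at_top_linorder by blast
  define T where "T = max 1 S powr (1 / r)"
  have T: "T > 0" by (simp add: T_def)
  have big: "\<Phi> t > 1" if "t \<ge> T" for t
  proof -
    have "max 1 S = T powr r" using r by (simp add: T_def powr_powr)
    also have "\<dots> \<le> t powr r" using that r T by (intro powr_mono2) auto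
    finally show ?thesis using S[of "t powr r"] \<Phi>0(2)[of t] that T by auto
  qed
  have "f p \<le> ennreal T * orlicz_norm (count_space A) \<Phi> f" if p: "p \<in> A" for A f and p :: 'a
  proof (rule ccontr)
    assume "\<not> ?thesis"
    then have "ennreal T * orlicz_norm (count_space A) \<Phi> f < f p" by simp
    moreover have "N < y / ennreal T" if *: "ennreal T * N < y" for N y
    proof -
      have "N \<noteq> top" using * T by (auto simp: ennreal_mult_top)
      then obtain n where n: "N = ennreal n" "n \<ge> 0" by (cases N) auto
      show ?thesis
      proof (cases "y = top")
        case True
        then show ?thesis using n by (simp add: ennreal_top_divide)
      next
        case False
        then obtain x where x: "y = ennreal x" "x \<ge> 0" by (cases y) auto
        have "T * n < x" using * T n x by (simp add: ennreal_mult[symmetric] ennreal_less_iff)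
        then show ?thesis using T n x by (simp add: divide_ennreal ennreal_less_iff field_simps)
      qed
    qed
    ultimately have "orlicz_norm (count_space A) \<Phi> f < f p / ennreal T" by blast
    then obtain l where l: "l > 0" "ennreal l < f p / ennreal T" "(\<integral>\<^sup>+x. extend_top \<Phi> (f x / ennreal l) \<partial>count_space A) \<le> 1"
      by (rule orlicz_norm_lessE)
    have "extend_top \<Phi> (f p / ennreal l) \<le> 1"
      using nn_integral_ge_point[OF p, of "\<lambda>x. extend_top \<Phi> (f x / ennreal l)"] l(3) by (rule order.trans)
    moreover have "extend_top \<Phi> (f p / ennreal l) > 1"
    proof (cases "f p = top")
      case True
      then show ?thesis using l(1) by (simp add: extend_top_def ennreal_top_divide)
    next
      case False
      then obtain y where y: "f p = ennreal y" "y \<ge> 0" by (cases "f p") auto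
      have "l < y / T" using l(2) T l(1) y by (simp add: divide_ennreal ennreal_less_iff)
      then have "T \<le> y / l" using l(1) T by (simp add: field_simps)
      then show ?thesis using big[of "y / l"] y l(1) by (simp add: extend_top_ennreal_divide)
    qed
    ultimately show False by simp
  qed
  then show ?thesis using T by blast
qed

text \<open>Closed cubes at the lattice points cover space with overlapping faces, whence an
  inequality. The majorant is measurable in x whatever G is.\<close>

lemma nn_integral_lattice_round:
  fixes G :: "real ^ 'd::finite \<Rightarrow> ennreal"
  assumes "\<epsilon> > 0"
  shows "(\<integral>\<^sup>+x. G (lattice_round \<epsilon> x) \<partial>lebesgue) \<le> ennreal (\<epsilon> ^ CARD('d)) * (\<integral>\<^sup>+p. G p \<partial>count_space (lattice_pts \<epsilon>))"
proof -
  let ?Q = "\<lambda>p :: real ^ 'd. cbox p (p + (\<chi> i. \<epsilon>))"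
  have "(\<integral>\<^sup>+x. G (lattice_round \<epsilon> x) \<partial>lebesgue) \<le>
      (\<integral>\<^sup>+x. (\<integral>\<^sup>+p. G p * indicator (?Q p) x \<partial>count_space (lattice_pts \<epsilon>)) \<partial>lebesgue)"
  proof (rule nn_integral_mono)
    fix x :: "real ^ 'd"
    have "x \<in> ?Q (lattice_round \<epsilon> x)"
      using lattice_round_bounds[OF assms, of x] by (simp add: mem_box_cart)
    then have "G (lattice_round \<epsilon> x) = G (lattice_round \<epsilon> x) * indicator (?Q (lattice_round \<epsilon> x)) x" by simp
    also have "\<dots> \<le> (\<integral>\<^sup>+p. G p * indicator (?Q p) x \<partial>count_space (lattice_pts \<epsilon>))"
      by (rule nn_integral_ge_point[of "lattice_round \<epsilon> x" _ "\<lambda>p. G p * indicator (?Q p) x"]) simp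
    finally show "G (lattice_round \<epsilon> x) \<le> \<dots>" .
  qed
  also have "\<dots> = (\<integral>\<^sup>+p. (\<integral>\<^sup>+x. G p * indicator (?Q p) x \<partial>lebesgue) \<partial>count_space (lattice_pts \<epsilon>))"
    by (rule nn_integral_count_space_nn_integral[OF countable_lattice_pts])
       (intro borel_measurable_times_ennreal borel_measurable_const borel_measurable_indicator, simp)
  also have "\<dots> = (\<integral>\<^sup>+p. ennreal (\<epsilon> ^ CARD('d)) * G p \<partial>count_space (lattice_pts \<epsilon>))"
  proof (intro nn_integral_cong)
    fix p :: "real ^ 'd"
    have "emeasure lebesgue (?Q p) = ennreal (measure lborel (?Q p))"
    proof -
      have "emeasure lborel (?Q p) \<noteq> top"
        using emeasure_bounded_finite[OF bounded_cbox, of p "p + (\<chi> i. \<epsilon>)"] by simp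
      then show ?thesis by (simp add: emeasure_eq_ennreal_measure)
    qed
    also have "measure lborel (?Q p) = (\<Prod>i\<in>(UNIV :: 'd set). \<epsilon>)"
    proof -
      have "p \<in> ?Q p" using assms by (simp add: mem_box_cart)
      then have "?Q p \<noteq> {}" by blast
      then show ?thesis by (subst content_cbox_cart) simp_all
    qed
    finally show "(\<integral>\<^sup>+x. G p * indicator (?Q p) x \<partial>lebesgue) = ennreal (\<epsilon> ^ CARD('d)) * G p"
      by (subst nn_integral_cmult_indicator) (simp_all add: mult.commute)
  qed
  also have "\<dots> = ennreal (\<epsilon> ^ CARD('d)) * (\<integral>\<^sup>+p. G p \<partial>count_space (lattice_pts \<epsilon>))"
    by (rule nn_integral_cmult) simp
  finally show ?thesis .
qed

text \<open>Jensen bounds the modular of u at x by an average of modulars of shifted g k at the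
  rounded point. Lattice shifts preserve the sum, and passing from the lattice to the continuum
  costs the cell volume. Letting g depend on k allows each column of a two-variable sequence to be
  normalized by its own norm.\<close>

lemma lattice_convolution_orlicz_bound:
  fixes u :: "real ^ 'd::finite \<Rightarrow> real" and g :: "'k \<Rightarrow> real ^ 'd \<Rightarrow> real"
  assumes \<Phi>: "quasi_young_function r \<Phi>" and \<epsilon>: "\<epsilon> > 0" and I: "countable I"
    and \<sigma>: "\<And>k. k \<in> I \<Longrightarrow> \<sigma> k \<in> lattice_pts \<epsilon>"
    and p: "\<And>k. k \<in> I \<Longrightarrow> p k \<ge> 0" "(\<integral>\<^sup>+k. ennreal (p k) \<partial>count_space I) \<le> 1"
    and g: "\<And>k q. k \<in> I \<Longrightarrow> g k q \<ge> 0" "\<And>k. k \<in> I \<Longrightarrow> (\<integral>\<^sup>+q. \<Phi> (g k q) \<partial>count_space (lattice_pts \<epsilon>)) \<le> 1"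
    and P: "P > 0" and u: "\<And>x. u x \<ge> 0"
    and le: "\<And>x. ennreal (u x powr r) \<le> (\<integral>\<^sup>+k. ennreal (P * (p k * g k (lattice_round \<epsilon> x - \<sigma> k) powr r)) \<partial>count_space I)"
  shows "orlicz_norm lebesgue \<Phi> (\<lambda>x. ennreal (u x)) \<le> ennreal ((2 * max 1 (\<epsilon> ^ CARD('d)) * P) powr (1 / r))"
proof -
  obtain \<Phi>0 where \<Phi>0: "young_function \<Phi>0" "\<And>t. t \<ge> 0 \<Longrightarrow> \<Phi> t = \<Phi>0 (t powr r)" and r: "0 < r"
    using \<Phi> unfolding quasi_young_function_def by blast
  \<comment> \<open>K dominates the cell volume, and K \<ge> 1 lets convexity turn division of the
    argument by K into division of the value. In \<open>?l\<close> the factor 2 comes from countable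
    Jensen and P from normalization.\<close>
  define K where "K = max 1 (\<epsilon> ^ CARD('d))"
  have K: "K \<ge> 1" "\<epsilon> ^ CARD('d) \<le> K" by (auto simp: K_def)
  let ?l = "(2 * K * P) powr (1 / r)"
  let ?G = "\<lambda>q. \<integral>\<^sup>+k. ennreal (p k) * \<Phi> (g k (q - \<sigma> k)) \<partial>count_space I"
  have l: "?l > 0" using K P by simp
  have pt: "extend_top \<Phi> (ennreal (u x) / ennreal ?l) \<le> ennreal (1 / K) * ?G (lattice_round \<epsilon> x)" for x
  proof -
    let ?q = "lattice_round \<epsilon> x"
    let ?s = "u x powr r / P"
    have "ennreal P * ennreal ?s = ennreal (u x powr r)"
      using P by (subst ennreal_mult[symmetric]) auto
    also have "\<dots> \<le> (\<integral>\<^sup>+k. ennreal (P * (p k * g k (?q - \<sigma> k) powr r)) \<partial>count_space I)" by (rule le)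
    also have "\<dots> = (\<integral>\<^sup>+k. ennreal P * ennreal (p k * g k (?q - \<sigma> k) powr r) \<partial>count_space I)"
      using P p(1) by (intro nn_integral_cong ennreal_mult) auto
    also have "\<dots> = ennreal P * (\<integral>\<^sup>+k. ennreal (p k * g k (?q - \<sigma> k) powr r) \<partial>count_space I)"
      by (rule nn_integral_cmult) simp
    finally have "ennreal ?s \<le> (\<integral>\<^sup>+k. ennreal (p k * g k (?q - \<sigma> k) powr r) \<partial>count_space I)"
      using P by (subst (asm) ennreal_mult_le_mult_iff) auto
    then have "\<Phi>0 (?s / 2) \<le> (\<integral>\<^sup>+k. ennreal (p k) * \<Phi>0 (g k (?q - \<sigma> k) powr r) \<partial>count_space I)"
      using p P by (intro young_function_jensen_countable[OF \<Phi>0(1)]) auto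
    also have "\<dots> = ?G ?q"
      by (intro nn_integral_cong) (use \<Phi>0(2) g(1) in auto)
    finally have J: "\<Phi>0 (?s / 2) \<le> ?G ?q" .
    have "(u x / ?l) powr r = 1 / K * (?s / 2)"
      using u[of x] l r K P by (simp add: powr_divide powr_powr)
    then have "extend_top \<Phi> (ennreal (u x) / ennreal ?l) = \<Phi>0 (1 / K * (?s / 2))"
      using u[of x] l by (subst extend_top_ennreal_divide) (auto simp: \<Phi>0(2))
    also have "\<dots> \<le> ennreal (1 / K) * \<Phi>0 (?s / 2)"
      using K P by (intro young_function_sub[OF \<Phi>0(1)]) auto
    also have "\<dots> \<le> ennreal (1 / K) * ?G ?q" by (intro mult_left_mono J) auto
    finally show ?thesis .
  qed
  have total: "(\<integral>\<^sup>+q. ?G q \<partial>count_space (lattice_pts \<epsilon>)) \<le> 1"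
  proof -
    have "(\<integral>\<^sup>+q. ?G q \<partial>count_space (lattice_pts \<epsilon>)) =
        (\<integral>\<^sup>+k. (\<integral>\<^sup>+q. ennreal (p k) * \<Phi> (g k (q - \<sigma> k)) \<partial>count_space (lattice_pts \<epsilon>)) \<partial>count_space I)"
      by (rule nn_integral_count_space_nn_integral[OF I]) simp
    also have "\<dots> \<le> (\<integral>\<^sup>+k. ennreal (p k) * 1 \<partial>count_space I)"
    proof (rule nn_integral_mono)
      fix k assume "k \<in> space (count_space I)"
      then have k: "k \<in> I" by simp
      have bij: "bij_betw (\<lambda>q. q - \<sigma> k) (lattice_pts \<epsilon>) (lattice_pts \<epsilon>)"
        by (rule bij_betw_byWitness[where f' = "\<lambda>q. q + \<sigma> k"])
           (use \<sigma>[OF k] in \<open>auto intro: lattice_pts_diff lattice_pts_add\<close>)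
      have "(\<integral>\<^sup>+q. ennreal (p k) * \<Phi> (g k (q - \<sigma> k)) \<partial>count_space (lattice_pts \<epsilon>)) =
          ennreal (p k) * (\<integral>\<^sup>+q. \<Phi> (g k (q - \<sigma> k)) \<partial>count_space (lattice_pts \<epsilon>))"
        by (rule nn_integral_cmult) simp
      also have "(\<integral>\<^sup>+q. \<Phi> (g k (q - \<sigma> k)) \<partial>count_space (lattice_pts \<epsilon>)) = (\<integral>\<^sup>+q. \<Phi> (g k q) \<partial>count_space (lattice_pts \<epsilon>))"
        by (rule nn_integral_bij_count_space[OF bij])
      also have "ennreal (p k) * \<dots> \<le> ennreal (p k) * 1" by (intro mult_left_mono g(2)[OF k]) auto
      finally show "(\<integral>\<^sup>+q. ennreal (p k) * \<Phi> (g k (q - \<sigma> k)) \<partial>count_space (lattice_pts \<epsilon>)) \<le> ennreal (p k) * 1" .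
    qed
    finally show ?thesis using p(2) by (simp only: mult_1_right)
  qed
  have "(\<integral>\<^sup>+x. extend_top \<Phi> (ennreal (u x) / ennreal ?l) \<partial>lebesgue) \<le> (\<integral>\<^sup>+x. ennreal (1 / K) * ?G (lattice_round \<epsilon> x) \<partial>lebesgue)"
    by (intro nn_integral_mono pt)
  also have "\<dots> \<le> ennreal (\<epsilon> ^ CARD('d)) * (\<integral>\<^sup>+q. ennreal (1 / K) * ?G q \<partial>count_space (lattice_pts \<epsilon>))"
    by (rule nn_integral_lattice_round[OF \<epsilon>])
  also have "\<dots> = ennreal (\<epsilon> ^ CARD('d)) * (ennreal (1 / K) * (\<integral>\<^sup>+q. ?G q \<partial>count_space (lattice_pts \<epsilon>)))"
    by (subst nn_integral_cmult) auto
  also have "\<dots> \<le> ennreal (\<epsilon> ^ CARD('d)) * (ennreal (1 / K) * 1)"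
    by (intro mult_left_mono total) auto
  also have "\<dots> = ennreal (\<epsilon> ^ CARD('d) / K)"
    using \<epsilon> K by (simp add: ennreal_mult[symmetric])
  also have "\<dots> \<le> 1" using K by (simp add: ennreal_le_1 divide_le_eq_1)
  finally show ?thesis unfolding K_def[symmetric] by (rule orlicz_norm_leI[OF l])
qed

text \<open>The one-variable bound is used twice. For fixed \<xi> the columns of X are normalized by
  their inner norms, so the inner norm of U to the power r is at most a convolution of a with powers
  of these norms; this is again of the required form for the outer norm.\<close>

lemma mixed_orlicz_lattice_convolution:
  fixes a :: "(real ^ 'd::finite) \<times> (real ^ 'd) \<Rightarrow> real"
  assumes \<Phi>1: "quasi_young_function r \<Phi>1" and \<Phi>2: "quasi_young_function r \<Phi>2" and \<epsilon>: "\<epsilon> > 0"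
    and a: "\<And>k. a k \<ge> 0" "a summable_on (lattice_pts \<epsilon> \<times> lattice_pts \<epsilon>)"
  shows "\<exists>C>0. \<forall>X U. (\<forall>z. X z \<ge> 0) \<longrightarrow> (\<forall>z. U z \<ge> 0) \<longrightarrow>
    (\<forall>x \<xi>. ennreal (U (x, \<xi>) powr r) \<le> (\<integral>\<^sup>+k. ennreal (a k * X (lattice_round \<epsilon> x - fst k, lattice_round \<epsilon> \<xi> - snd k) powr r)
       \<partial>count_space (lattice_pts \<epsilon> \<times> lattice_pts \<epsilon>))) \<longrightarrow>
    orlicz_norm lebesgue \<Phi>2 (\<lambda>\<xi>. orlicz_norm lebesgue \<Phi>1 (\<lambda>x. ennreal (U (x, \<xi>)))) \<le>
    ennreal C * orlicz_norm (count_space (lattice_pts \<epsilon>)) \<Phi>2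
      (\<lambda>q. orlicz_norm (count_space (lattice_pts \<epsilon>)) \<Phi>1 (\<lambda>p. ennreal (X (p, q))))"
proof -
  let ?\<Lambda> = "lattice_pts \<epsilon> :: (real ^ 'd) set"
  let ?L = "?\<Lambda> \<times> ?\<Lambda>"
  have r: "0 < r" using \<Phi>1 unfolding quasi_young_function_def by blast
  have cL: "countable ?L" by (intro countable_SIGMA countable_lattice_pts)
  obtain T1 where T1_ex: "T1 > 0 \<and> (\<forall>A. \<forall>f. \<forall>p :: real ^ 'd \<in> A. f p \<le> ennreal T1 * orlicz_norm (count_space A) \<Phi>1 f)"
    using orlicz_norm_count_space_pointwise[OF \<Phi>1, where 'a = "real ^ 'd"] ..
  then have T1_pos: "T1 > 0" and T1_all: "\<forall>A. \<forall>f. \<forall>p :: real ^ 'd \<in> A. f p \<le> ennreal T1 * orlicz_norm (count_space A) \<Phi>1 f"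
    by (rule conjunct1, rule conjunct2)
  have T1_le: "f p \<le> ennreal T1 * orlicz_norm (count_space ?\<Lambda>) \<Phi>1 f" if "p \<in> ?\<Lambda>" for f p
    by (rule T1_all[rule_format, OF that])
  note T1 = T1_pos T1_le
  obtain T2 where T2_ex: "T2 > 0 \<and> (\<forall>A. \<forall>f. \<forall>p :: real ^ 'd \<in> A. f p \<le> ennreal T2 * orlicz_norm (count_space A) \<Phi>2 f)"
    using orlicz_norm_count_space_pointwise[OF \<Phi>2, where 'a = "real ^ 'd"] ..
  then have T2_pos: "T2 > 0" and T2_all: "\<forall>A. \<forall>f. \<forall>p :: real ^ 'd \<in> A. f p \<le> ennreal T2 * orlicz_norm (count_space A) \<Phi>2 f"
    by (rule conjunct1, rule conjunct2)
  have T2_le: "f p \<le> ennreal T2 * orlicz_norm (count_space ?\<Lambda>) \<Phi>2 f" if "p \<in> ?\<Lambda>" for f p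
    by (rule T2_all[rule_format, OF that])
  note T2 = T2_pos T2_le
  define K where "K = max 1 (\<epsilon> ^ CARD('d))"
  \<comment> \<open>The added 1 keeps A positive when a vanishes, so that a k / A is defined as a
    subprobability.\<close>
  define A where "A = infsum a ?L + 1"
  have K: "K \<ge> 1" by (simp add: K_def)
  have A: "A \<ge> 1" using infsum_nonneg[of ?L a] a(1) by (simp add: A_def)
  \<comment> \<open>Each use of the one-variable bound contributes 2 K, which gives 4 K^2; A is the
    mass of a, and the outer factor 2 stems from normalizing columns by 2 m instead of m.\<close>
  define C where "C = 2 * (4 * K\<^sup>2 * A) powr (1 / r)"
  have C: "C > 0" using K A by (simp add: C_def)
  have main: "orlicz_norm lebesgue \<Phi>2 (\<lambda>\<xi>. orlicz_norm lebesgue \<Phi>1 (\<lambda>x. ennreal (U (x, \<xi>)))) \<le> ennreal (C * \<mu>)"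
    if X: "\<And>z. X z \<ge> 0" and U: "\<And>z. U z \<ge> 0"
      and le: "\<And>x \<xi>. ennreal (U (x, \<xi>) powr r) \<le> (\<integral>\<^sup>+k. ennreal (a k * X (lattice_round \<epsilon> x - fst k, lattice_round \<epsilon> \<xi> - snd k) powr r) \<partial>count_space ?L)"
      and \<mu>: "\<mu> > 0" "(\<integral>\<^sup>+q. extend_top \<Phi>2 (orlicz_norm (count_space ?\<Lambda>) \<Phi>1 (\<lambda>p. ennreal (X (p, q))) / ennreal \<mu>) \<partial>count_space ?\<Lambda>) \<le> 1"
    for X U \<mu>
  proof -
    define n where "n q = orlicz_norm (count_space ?\<Lambda>) \<Phi>1 (\<lambda>p. ennreal (X (p, q)))" for q
    \<comment> \<open>Inner norms are extended reals; \<open>nT\<close> shows that they are finite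
      at lattice points, so nothing is lost there.\<close>
    define m where "m q = enn2real (n q)" for q
    have m0: "m q \<ge> 0" for q by (simp add: m_def)
    have "orlicz_norm (count_space ?\<Lambda>) \<Phi>2 n \<le> ennreal \<mu>"
      unfolding n_def by (rule orlicz_norm_leI[OF \<mu>])
    then have nT: "n q \<le> ennreal (T2 * \<mu>)" if "q \<in> ?\<Lambda>" for q
      using T2(2)[OF that, of n] T2(1) \<mu>(1) by (metis ennreal_mult less_imp_le mult_left_mono order.trans zero_le)
    then have nm: "n q = ennreal (m q)" if "q \<in> ?\<Lambda>" for q
      using that unfolding m_def by (metis ennreal_enn2real ennreal_less_top le_less_trans)
    have mT: "m q \<le> T2 * \<mu>" if "q \<in> ?\<Lambda>" for q
      using nT[OF that] T2(1) \<mu>(1) unfolding nm[OF that] by (subst (asm) ennreal_le_iff) auto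
    have Xm: "X (p, q) \<le> T1 * m q" if "p \<in> ?\<Lambda>" "q \<in> ?\<Lambda>" for p q
    proof -
      have "ennreal (X (p, q)) \<le> ennreal T1 * n q"
        using T1(2)[OF that(1), of "\<lambda>p. ennreal (X (p, q))"] unfolding n_def .
      then have "ennreal (X (p, q)) \<le> ennreal (T1 * m q)"
        using T1(1) m0[of q] by (simp add: nm[OF that(2)] ennreal_mult)
      then show ?thesis using T1(1) m0[of q] by (subst (asm) ennreal_le_iff) auto
    qed
    \<comment> \<open>The modular at m itself may exceed 1, as the infimum need not be attained; 2 m
      lies strictly above it unless m = 0, where division by zero yields 0 and \<Phi>1 0 =
      0.\<close>
    have inner_le_1: "(\<integral>\<^sup>+p. \<Phi>1 (X (p, q) / (2 * m q)) \<partial>count_space ?\<Lambda>) \<le> 1" if q: "q \<in> ?\<Lambda>" for q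
    proof (cases "m q = 0")
      case True
      then show ?thesis using quasi_young_function_0[OF \<Phi>1] by simp
    next
      case False
      then have mq: "m q > 0" using m0[of q] by simp
      then have "n q < ennreal (2 * m q)" unfolding nm[OF q] by (intro ennreal_lessI) auto
      then obtain l where l: "l > 0" "ennreal l < ennreal (2 * m q)"
          "(\<integral>\<^sup>+p. extend_top \<Phi>1 (ennreal (X (p, q)) / ennreal l) \<partial>count_space ?\<Lambda>) \<le> 1"
        unfolding n_def by (rule orlicz_norm_lessE)
      have ll: "l \<le> 2 * m q" using l(1,2) mq by (simp add: ennreal_less_iff)
      have "(\<integral>\<^sup>+p. \<Phi>1 (X (p, q) / (2 * m q)) \<partial>count_space ?\<Lambda>) \<le>
          (\<integral>\<^sup>+p. extend_top \<Phi>1 (ennreal (X (p, q)) / ennreal l) \<partial>count_space ?\<Lambda>)"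
      proof (rule nn_integral_mono)
        fix p
        have "\<Phi>1 (X (p, q) / (2 * m q)) \<le> \<Phi>1 (X (p, q) / l)"
          using X[of "(p, q)"] l(1) ll mq by (intro quasi_young_function_mono[OF \<Phi>1] divide_left_mono) auto
        then show "\<Phi>1 (X (p, q) / (2 * m q)) \<le> extend_top \<Phi>1 (ennreal (X (p, q)) / ennreal l)"
          using X[of "(p, q)"] l(1) by (simp add: extend_top_ennreal_divide)
      qed
      then show ?thesis using l(3) by (rule order.trans)
    qed
    \<comment> \<open>Each value of X becomes a column norm times a normalized entry.
      \<open>?w q k\<close> is the resulting weight of the k-th entry at frequency q, and M q is the
      mass by which these weights are normalized.\<close>
    let ?w = "\<lambda>q k. a k * (2 * m (q - snd k)) powr r"
    define M where "M q = infsum (?w q) ?L" for q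
    have w0: "?w q k \<ge> 0" for q k using a(1) by simp
    have ws: "?w q summable_on ?L" if q: "q \<in> ?\<Lambda>" for q
    proof (rule summable_on_comparison_test)
      show "(\<lambda>k. a k * (2 * (T2 * \<mu>)) powr r) summable_on ?L" by (rule summable_on_cmult_left[OF a(2)])
      fix k assume k: "k \<in> ?L"
      then have "q - snd k \<in> ?\<Lambda>" using q by (auto intro: lattice_pts_diff)
      then show "?w q k \<le> a k * (2 * (T2 * \<mu>)) powr r"
        using m0 mT r a(1) by (intro mult_left_mono powr_mono2) auto
    qed (use w0 in auto)
    have Meq: "ennreal (M q) = (\<integral>\<^sup>+k. ennreal (?w q k) \<partial>count_space ?L)" if q: "q \<in> ?\<Lambda>" for q
      unfolding M_def by (rule infsum_eq_nn_integral[OF w0 ws[OF q]])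
    have M0: "M q \<ge> 0" for q unfolding M_def by (intro infsum_nonneg w0)
    \<comment> \<open>The factorization survives a vanishing column norm, because then the column
      itself is zero by \<open>Xm\<close>.\<close>
    have Xw: "a k * X (x - fst k, q - snd k) powr r = ?w q k * (X (x - fst k, q - snd k) / (2 * m (q - snd k))) powr r"
      if "x \<in> ?\<Lambda>" "q \<in> ?\<Lambda>" "k \<in> ?L" for x q k
    proof (cases "m (q - snd k) = 0")
      case True
      have "X (x - fst k, q - snd k) \<le> T1 * m (q - snd k)"
        using that by (intro Xm) (auto intro: lattice_pts_diff)
      then show ?thesis using True X[of "(x - fst k, q - snd k)"] by simp
    next
      case False
      then have "m (q - snd k) > 0" using m0[of "q - snd k"] by simp
      then show ?thesis using X[of "(x - fst k, q - snd k)"] by (simp add: powr_divide)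
    qed
    let ?N = "\<lambda>q. (2 * K * M q) powr (1 / r)"
    have inner: "orlicz_norm lebesgue \<Phi>1 (\<lambda>x. ennreal (U (x, \<xi>))) \<le> ennreal (?N (lattice_round \<epsilon> \<xi>))" for \<xi>
    proof -
      let ?q = "lattice_round \<epsilon> \<xi>"
      have q: "?q \<in> ?\<Lambda>" by simp
      show ?thesis
      \<comment> \<open>Zero mass cannot be normalized, but then U vanishes identically in
        x.\<close>
      proof (cases "M ?q = 0")
        case True
        have z: "?w ?q k = 0" if "k \<in> ?L" for k
        proof -
          have "sum (?w ?q) {k} \<le> M ?q"
            unfolding M_def by (rule finite_sum_le_infsum[OF ws[OF q]]) (use that w0[where q = ?q] in auto)
          then show ?thesis using True w0[of k ?q] by simp
        qed
        have "U (x, \<xi>) = 0" for x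
        proof -
          have "ennreal (U (x, \<xi>) powr r) \<le> (\<integral>\<^sup>+k. 0 \<partial>count_space ?L)"
            by (rule order.trans[OF le], rule nn_integral_mono) (simp only: space_count_space Xw[OF lattice_round_in q] z mult_zero_left ennreal_0 order_refl)
          then show ?thesis by (simp add: ennreal_eq_0_iff)
        qed
        then show ?thesis by (simp add: orlicz_norm_zero[OF \<Phi>1])
      next
        case False
        then have Mp: "M ?q > 0" using M0[of ?q] by simp
        show ?thesis
          unfolding K_def
        proof (rule lattice_convolution_orlicz_bound[OF \<Phi>1 \<epsilon> cL, where \<sigma> = fst and p = "\<lambda>k. ?w ?q k / M ?q"
              and g = "\<lambda>k p. X (p, ?q - snd k) / (2 * m (?q - snd k))"])
          have "(\<integral>\<^sup>+k. ennreal (?w ?q k / M ?q) \<partial>count_space ?L) = (\<integral>\<^sup>+k. ennreal (1 / M ?q) * ennreal (?w ?q k) \<partial>count_space ?L)"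
            using Mp w0 by (intro nn_integral_cong) (simp add: ennreal_mult[symmetric])
          also have "\<dots> = ennreal (1 / M ?q) * ennreal (M ?q)"
            unfolding Meq[OF q] by (rule nn_integral_cmult) simp
          also have "\<dots> = 1" using Mp by (simp add: ennreal_mult[symmetric])
          finally show "(\<integral>\<^sup>+k. ennreal (?w ?q k / M ?q) \<partial>count_space ?L) \<le> 1" by simp
          show "(\<integral>\<^sup>+p. \<Phi>1 (X (p, ?q - snd k) / (2 * m (?q - snd k))) \<partial>count_space ?\<Lambda>) \<le> 1" if "k \<in> ?L" for k
            using that by (intro inner_le_1) (auto intro: lattice_pts_diff)
          show "ennreal (U (x, \<xi>) powr r) \<le> (\<integral>\<^sup>+k. ennreal (M ?q * (?w ?q k / M ?q *
              (X (lattice_round \<epsilon> x - fst k, ?q - snd k) / (2 * m (?q - snd k))) powr r)) \<partial>count_space ?L)" for x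
          proof (rule order.trans[OF le], rule nn_integral_mono)
            fix k assume "k \<in> space (count_space ?L)"
            then have k: "k \<in> ?L" by simp
            show "ennreal (a k * X (lattice_round \<epsilon> x - fst k, ?q - snd k) powr r) \<le>
                ennreal (M ?q * (?w ?q k / M ?q * (X (lattice_round \<epsilon> x - fst k, ?q - snd k) / (2 * m (?q - snd k))) powr r))"
              unfolding Xw[OF lattice_round_in q k] using Mp by simp
          qed
        qed (use Mp w0 X m0 U in auto)
      qed
    qed
    have "orlicz_norm lebesgue \<Phi>2 (\<lambda>\<xi>. orlicz_norm lebesgue \<Phi>1 (\<lambda>x. ennreal (U (x, \<xi>)))) \<le>
        orlicz_norm lebesgue \<Phi>2 (\<lambda>\<xi>. ennreal (?N (lattice_round \<epsilon> \<xi>)))"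
      by (rule orlicz_norm_mono[OF \<Phi>2 inner])
    also have "\<dots> \<le> ennreal ((2 * K * (2 * K * A * (2 * \<mu>) powr r)) powr (1 / r))"
      unfolding K_def
    \<comment> \<open>The power r of \<open>?N\<close> is 2 K M, itself a convolution of a with
      powers of m, now shifted in the frequency component.\<close>
    proof (rule lattice_convolution_orlicz_bound[OF \<Phi>2 \<epsilon> cL, where \<sigma> = snd and p = "\<lambda>k. a k / A" and g = "\<lambda>k q. m q / \<mu>"],
        unfold K_def[symmetric])
      have "(\<integral>\<^sup>+k. ennreal (a k / A) \<partial>count_space ?L) = (\<integral>\<^sup>+k. ennreal (1 / A) * ennreal (a k) \<partial>count_space ?L)"
        using A a(1) by (intro nn_integral_cong) (simp add: ennreal_mult[symmetric])
      also have "\<dots> = ennreal (1 / A) * ennreal (infsum a ?L)"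
        unfolding infsum_eq_nn_integral[OF a(1) a(2)] by (rule nn_integral_cmult) simp
      also have "\<dots> = ennreal (infsum a ?L / A)"
        using A infsum_nonneg[of ?L a] a(1) by (simp add: ennreal_mult[symmetric])
      also have "\<dots> \<le> 1" using A by (simp add: A_def ennreal_le_1 divide_le_eq_1)
      finally show "(\<integral>\<^sup>+k. ennreal (a k / A) \<partial>count_space ?L) \<le> 1" .
      have "(\<integral>\<^sup>+q. \<Phi>2 (m q / \<mu>) \<partial>count_space ?\<Lambda>) = (\<integral>\<^sup>+q. extend_top \<Phi>2 (n q / ennreal \<mu>) \<partial>count_space ?\<Lambda>)"
        by (intro nn_integral_cong) (simp add: nm extend_top_ennreal_divide m0 \<mu>(1))
      then show "(\<integral>\<^sup>+q. \<Phi>2 (m q / \<mu>) \<partial>count_space ?\<Lambda>) \<le> 1" using \<mu>(2) by (simp add: n_def)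
      show "0 < 2 * K * A * (2 * \<mu>) powr r" using K A \<mu>(1) by simp
      show "ennreal (?N (lattice_round \<epsilon> \<xi>) powr r) \<le> (\<integral>\<^sup>+k. ennreal (2 * K * A * (2 * \<mu>) powr r *
          (a k / A * (m (lattice_round \<epsilon> \<xi> - snd k) / \<mu>) powr r)) \<partial>count_space ?L)" for \<xi>
      proof -
        let ?q = "lattice_round \<epsilon> \<xi>"
        have q: "?q \<in> ?\<Lambda>" by simp
        have "?N ?q powr r = 2 * K * M ?q" using r K M0[of ?q] by (simp add: powr_powr)
        then have "ennreal (?N ?q powr r) = ennreal (2 * K) * ennreal (M ?q)"
          using K M0[of ?q] by (simp add: ennreal_mult)
        also have "\<dots> = (\<integral>\<^sup>+k. ennreal (2 * K) * ennreal (?w ?q k) \<partial>count_space ?L)"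
          unfolding Meq[OF q] by (rule nn_integral_cmult[symmetric]) simp
        also have "\<dots> = (\<integral>\<^sup>+k. ennreal (2 * K * A * (2 * \<mu>) powr r * (a k / A * (m (?q - snd k) / \<mu>) powr r)) \<partial>count_space ?L)"
        proof (intro nn_integral_cong)
          fix k :: "(real ^ 'd) \<times> (real ^ 'd)"
          have "(2 * m (?q - snd k)) powr r = (2 * \<mu>) powr r * (m (?q - snd k) / \<mu>) powr r"
            using \<mu>(1) m0[of "?q - snd k"] by (simp flip: powr_mult)
          then have "2 * K * ?w ?q k = 2 * K * A * (2 * \<mu>) powr r * (a k / A * (m (?q - snd k) / \<mu>) powr r)"
            using A by simp
          then show "ennreal (2 * K) * ennreal (?w ?q k) = ennreal (2 * K * A * (2 * \<mu>) powr r * (a k / A * (m (?q - snd k) / \<mu>) powr r))"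
            using K w0[of k ?q] by (simp only: ennreal_mult[symmetric])
        qed
        finally show ?thesis by simp
      qed
    qed (use A a(1) m0 \<mu>(1) in auto)
    also have "(2 * K * (2 * K * A * (2 * \<mu>) powr r)) powr (1 / r) = C * \<mu>"
    proof -
      have "2 * K * (2 * K * A * (2 * \<mu>) powr r) = (4 * K\<^sup>2 * A) * (2 * \<mu>) powr r" by (simp add: power2_eq_square)
      moreover have "((4 * K\<^sup>2 * A) * (2 * \<mu>) powr r) powr (1 / r) =
          (4 * K\<^sup>2 * A) powr (1 / r) * ((2 * \<mu>) powr r) powr (1 / r)"
        by (rule powr_mult)
      moreover have "((2 * \<mu>) powr r) powr (1 / r) = 2 * \<mu>" using r \<mu>(1) by (simp add: powr_powr)
      ultimately show ?thesis by (simp only: C_def mult_ac)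
    qed
    finally show ?thesis .
  qed
  \<comment> \<open>Passes from all admissible levels \<mu> to the quasi-norm, their infimum, with
    an arbitrarily small slack.\<close>
  have fin: "y \<le> ennreal C * orlicz_norm (count_space ?\<Lambda>) \<Phi>2 h"
    if bnd: "\<And>\<mu>. \<mu> > 0 \<Longrightarrow> (\<integral>\<^sup>+q. extend_top \<Phi>2 (h q / ennreal \<mu>) \<partial>count_space ?\<Lambda>) \<le> 1 \<Longrightarrow> y \<le> ennreal (C * \<mu>)" for y h
  proof (cases "orlicz_norm (count_space ?\<Lambda>) \<Phi>2 h = top")
    case True
    then show ?thesis using C by (simp add: ennreal_mult_top)
  next
    case False
    then obtain s where s: "orlicz_norm (count_space ?\<Lambda>) \<Phi>2 h = ennreal s" "s \<ge> 0"
      by (cases "orlicz_norm (count_space ?\<Lambda>) \<Phi>2 h") auto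
    have bnd_e: "y \<le> ennreal (C * s) + ennreal e" if e: "e > 0" for e
    proof -
      have "orlicz_norm (count_space ?\<Lambda>) \<Phi>2 h < ennreal (s + e / C)"
        unfolding s(1) using s(2) e C by (intro ennreal_lessI) (auto intro: add_nonneg_pos)
      then obtain l where l: "l > 0" "ennreal l < ennreal (s + e / C)"
          "(\<integral>\<^sup>+q. extend_top \<Phi>2 (h q / ennreal l) \<partial>count_space ?\<Lambda>) \<le> 1"
        by (rule orlicz_norm_lessE)
      have "y \<le> ennreal (C * l)" by (rule bnd[OF l(1,3)])
      also have "C * l \<le> C * s + e"
      proof -
        have "l \<le> s + e / C" using l(1,2) by (simp add: ennreal_less_iff)
        then have "C * l \<le> C * (s + e / C)" using C by (intro mult_left_mono) auto
        then show ?thesis using C by (simp add: distrib_left)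
      qed
      then have "ennreal (C * l) \<le> ennreal (C * s + e)" by (rule ennreal_leI)
      also have "\<dots> = ennreal (C * s) + ennreal e" using C s(2) e by (intro ennreal_plus) auto
      finally show ?thesis .
    qed
    have "y \<le> ennreal (C * s)" by (rule ennreal_le_epsilon) (rule bnd_e)
    then show ?thesis unfolding s(1) ennreal_mult[OF less_imp_le[OF C] s(2)] .
  qed
  show ?thesis
  proof (intro exI[of _ C] conjI C allI impI)
    fix X U :: "(real ^ 'd) \<times> (real ^ 'd) \<Rightarrow> real"
    assume X: "\<forall>z. X z \<ge> 0" and U: "\<forall>z. U z \<ge> 0"
      and le: "\<forall>x \<xi>. ennreal (U (x, \<xi>) powr r) \<le> (\<integral>\<^sup>+k. ennreal (a k * X (lattice_round \<epsilon> x - fst k, lattice_round \<epsilon> \<xi> - snd k) powr r) \<partial>count_space ?L)"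
    show "orlicz_norm lebesgue \<Phi>2 (\<lambda>\<xi>. orlicz_norm lebesgue \<Phi>1 (\<lambda>x. ennreal (U (x, \<xi>)))) \<le>
      ennreal C * orlicz_norm (count_space ?\<Lambda>) \<Phi>2 (\<lambda>q. orlicz_norm (count_space ?\<Lambda>) \<Phi>1 (\<lambda>p. ennreal (X (p, q))))"
      by (rule fin[OF main[OF spec[OF X] spec[OF U] spec[OF spec[OF le]]]])
  qed
qed

text \<open>After scaling to x + y = 1 it reduces to t \<le> t powr r on the unit interval.\<close>

lemma powr_add_le:
  fixes x y :: real
  assumes "0 < r" "r \<le> 1" "x \<ge> 0" "y \<ge> 0"
  shows "(x + y) powr r \<le> x powr r + y powr r"
proof (cases "x + y = 0")
  case False
  then have s: "x + y > 0" using assms by simp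
  have le: "t \<le> t powr r" if "0 \<le> t" "t \<le> 1" for t :: real
    using that assms powr_mono'[of r 1 t] by (cases "t = 0") auto
  have "1 = x / (x + y) + y / (x + y)" using s by (simp add: add_divide_distrib[symmetric])
  also have "\<dots> \<le> (x / (x + y)) powr r + (y / (x + y)) powr r"
    using s assms by (intro add_mono le) (auto simp: divide_le_eq_1)
  also have "\<dots> = (x powr r + y powr r) / (x + y) powr r"
    using s assms by (simp add: powr_divide add_divide_distrib)
  finally show ?thesis using s by (simp add: le_divide_eq)
qed (use assms in auto)

lemma powr_norm_sum_le:
  fixes f :: "'k \<Rightarrow> 'b::real_normed_vector"
  assumes "0 < r" "r \<le> 1"
  shows "norm (sum f S) powr r \<le> (\<Sum>k\<in>S. norm (f k) powr r)"
proof (induction S rule: infinite_finite_induct)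
  case (insert k S)
  have "norm (sum f (insert k S)) powr r \<le> (norm (f k) + norm (sum f S)) powr r"
    using insert.hyps assms by (simp add: powr_mono2 norm_triangle_ineq)
  also have "\<dots> \<le> norm (f k) powr r + norm (sum f S) powr r" using assms by (intro powr_add_le) auto
  finally show ?case using insert by simp
qed auto

lemma powr_norm_has_sum_le:
  fixes f :: "'k \<Rightarrow> 'b::real_normed_vector"
  assumes r: "0 < r" "r \<le> 1" and f: "(f has_sum s) I"
  shows "ennreal (norm s powr r) \<le> (\<integral>\<^sup>+k. ennreal (norm (f k) powr r) \<partial>count_space I)"
proof (rule tendsto_upperbound)
  have "((\<lambda>S. norm (sum f S) powr r) \<longlongrightarrow> norm s powr r) (finite_subsets_at_top I)"
    using f r unfolding has_sum_def by (intro tendsto_powr' tendsto_norm tendsto_const) auto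
  then show "((\<lambda>S. ennreal (norm (sum f S) powr r)) \<longlongrightarrow> ennreal (norm s powr r)) (finite_subsets_at_top I)"
    by (rule tendsto_ennrealI)
  show "\<forall>\<^sub>F S in finite_subsets_at_top I. ennreal (norm (sum f S) powr r) \<le> (\<integral>\<^sup>+k. ennreal (norm (f k) powr r) \<partial>count_space I)"
  proof (rule eventually_finite_subsets_at_top_weakI)
    fix S assume S: "finite S" "S \<subseteq> I"
    have "ennreal (norm (sum f S) powr r) \<le> ennreal (\<Sum>k\<in>S. norm (f k) powr r)"
      by (intro ennreal_leI powr_norm_sum_le r)
    also have "\<dots> = (\<Sum>k\<in>S. ennreal (norm (f k) powr r))" by (rule sum_ennreal[symmetric]) simp
    also have "\<dots> \<le> (\<integral>\<^sup>+k. ennreal (norm (f k) powr r) \<partial>count_space I)"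
      by (rule sum_le_nn_integral_count_space[OF S])
    finally show "ennreal (norm (sum f S) powr r) \<le> (\<integral>\<^sup>+k. ennreal (norm (f k) powr r) \<partial>count_space I)" .
  qed
qed simp

text \<open>The pointwise bound is applied first in position and then in frequency.\<close>

lemma sequence_space_bounded:
  fixes \<omega> :: "(real ^ 'd::finite) \<times> (real ^ 'd) \<Rightarrow> real"
  assumes "quasi_young_function r \<Phi>1" "quasi_young_function r \<Phi>2" and c: "c \<in> sequence_space \<epsilon> \<Phi>1 \<Phi>2 \<omega>"
  shows "\<exists>A\<ge>0. \<forall>k \<in> lattice_pts \<epsilon> \<times> lattice_pts \<epsilon>. norm (c k) * \<omega> k \<le> A"
proof -
  let ?\<Lambda> = "lattice_pts \<epsilon> :: (real ^ 'd) set"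
  obtain T1 where T1_ex: "T1 > 0 \<and> (\<forall>A. \<forall>f. \<forall>p :: real ^ 'd \<in> A. f p \<le> ennreal T1 * orlicz_norm (count_space A) \<Phi>1 f)"
    using orlicz_norm_count_space_pointwise[OF assms(1), where 'a = "real ^ 'd"] ..
  then have T1_pos: "T1 > 0" and T1_all: "\<forall>A. \<forall>f. \<forall>p :: real ^ 'd \<in> A. f p \<le> ennreal T1 * orlicz_norm (count_space A) \<Phi>1 f"
    by (rule conjunct1, rule conjunct2)
  have T1_le: "f p \<le> ennreal T1 * orlicz_norm (count_space ?\<Lambda>) \<Phi>1 f" if "p \<in> ?\<Lambda>" for f p
    by (rule T1_all[rule_format, OF that])
  note T1 = T1_pos T1_le
  obtain T2 where T2_ex: "T2 > 0 \<and> (\<forall>A. \<forall>f. \<forall>p :: real ^ 'd \<in> A. f p \<le> ennreal T2 * orlicz_norm (count_space A) \<Phi>2 f)"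
    using orlicz_norm_count_space_pointwise[OF assms(2), where 'a = "real ^ 'd"] ..
  then have T2_pos: "T2 > 0" and T2_all: "\<forall>A. \<forall>f. \<forall>p :: real ^ 'd \<in> A. f p \<le> ennreal T2 * orlicz_norm (count_space A) \<Phi>2 f"
    by (rule conjunct1, rule conjunct2)
  have T2_le: "f p \<le> ennreal T2 * orlicz_norm (count_space ?\<Lambda>) \<Phi>2 f" if "p \<in> ?\<Lambda>" for f p
    by (rule T2_all[rule_format, OF that])
  note T2 = T2_pos T2_le
  let ?S = "sequence_norm \<epsilon> \<Phi>1 \<Phi>2 \<omega> c"
  have S: "?S < top" using c by (simp add: sequence_space_def)
  define A where "A = enn2real (ennreal T1 * (ennreal T2 * ?S))"
  have fin: "ennreal T1 * (ennreal T2 * ?S) < top" using S by (simp add: ennreal_mult_less_top)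
  have "norm (c k) * \<omega> k \<le> A" if k: "k \<in> ?\<Lambda> \<times> ?\<Lambda>" for k
  proof -
    have "ennreal (norm (c (fst k, snd k)) * \<omega> (fst k, snd k)) \<le>
        ennreal T1 * orlicz_norm (count_space ?\<Lambda>) \<Phi>1 (\<lambda>p. ennreal (norm (c (p, snd k)) * \<omega> (p, snd k)))"
      using k by (intro T1(2)[where f = "\<lambda>p. ennreal (norm (c (p, snd k)) * \<omega> (p, snd k))"]) auto
    also have "\<dots> \<le> ennreal T1 * (ennreal T2 * ?S)"
      unfolding sequence_norm_def mixed_orlicz_norm_def
      using k by (intro mult_left_mono T2(2)[where f = "\<lambda>q. orlicz_norm (count_space ?\<Lambda>) \<Phi>1 (\<lambda>p. ennreal (norm (c (p, q)) * \<omega> (p, q)))"]) auto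
    finally show ?thesis unfolding A_def using fin by (intro enn2real_nonneg_iff_le) auto
  qed
  then show ?thesis by (intro exI[of _ A]) (simp add: A_def)
qed

section \<open>Boundedness and linearity of the synthesis operator\<close>

context gabor_synthesis
begin

text \<open>The convolution theorem is used with the weighted sequence as X, the weighted transform
  of the sum as U, and the r-summable local suprema of \<psi> as kernel a.\<close>

lemma synth_modulation_norm_bound:
  assumes \<Phi>: "quasi_young_function r \<Phi>1" "quasi_young_function r \<Phi>2"
  shows "\<exists>C>0. \<forall>c \<in> sequence_space \<epsilon> \<Phi>1 \<Phi>2 \<omega>.
    modulation_norm \<Phi>1 \<Phi>2 \<omega> (synth c) \<le> ennreal C * sequence_norm \<epsilon> \<Phi>1 \<Phi>2 \<omega> c"
proof -
  obtain b where b: "b summable_on L" "\<And>k. b k \<ge> 0"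
      "\<And>k u. norm (u - k) \<le> cell_radius \<Longrightarrow> (norm (stft_gauss \<psi> u) * v u) powr r \<le> b k"
    using stft_gauss_amalgam[OF \<epsilon> r v \<psi> cell_radius_nonneg] by blast
  let ?a = "\<lambda>k. mod_const powr r * b k"
  have "\<exists>C>0. \<forall>X U. (\<forall>z. X z \<ge> 0) \<longrightarrow> (\<forall>z. U z \<ge> 0) \<longrightarrow>
    (\<forall>x \<xi>. ennreal (U (x, \<xi>) powr r) \<le> (\<integral>\<^sup>+k. ennreal (?a k * X (lattice_round \<epsilon> x - fst k, lattice_round \<epsilon> \<xi> - snd k) powr r)
       \<partial>count_space L)) \<longrightarrow>
    orlicz_norm lebesgue \<Phi>2 (\<lambda>\<xi>. orlicz_norm lebesgue \<Phi>1 (\<lambda>x. ennreal (U (x, \<xi>)))) \<le>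
    ennreal C * orlicz_norm (count_space (lattice_pts \<epsilon>)) \<Phi>2
      (\<lambda>q. orlicz_norm (count_space (lattice_pts \<epsilon>)) \<Phi>1 (\<lambda>p. ennreal (X (p, q))))"
    by (rule mixed_orlicz_lattice_convolution[OF \<Phi> \<epsilon>]) (use b(2) in simp, rule summable_on_cmult_right[OF b(1)])
  then obtain C where C: "C > 0" and main: "\<And>X U. (\<And>z. X z \<ge> 0) \<Longrightarrow> (\<And>z. U z \<ge> 0) \<Longrightarrow>
    (\<And>x \<xi>. ennreal (U (x, \<xi>) powr r) \<le> (\<integral>\<^sup>+k. ennreal (?a k * X (lattice_round \<epsilon> x - fst k, lattice_round \<epsilon> \<xi> - snd k) powr r)
       \<partial>count_space L)) \<Longrightarrow>
    orlicz_norm lebesgue \<Phi>2 (\<lambda>\<xi>. orlicz_norm lebesgue \<Phi>1 (\<lambda>x. ennreal (U (x, \<xi>)))) \<le>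
    ennreal C * orlicz_norm (count_space (lattice_pts \<epsilon>)) \<Phi>2
      (\<lambda>q. orlicz_norm (count_space (lattice_pts \<epsilon>)) \<Phi>1 (\<lambda>p. ennreal (X (p, q))))"
    by blast
  have "modulation_norm \<Phi>1 \<Phi>2 \<omega> (synth c) \<le> ennreal C * sequence_norm \<epsilon> \<Phi>1 \<Phi>2 \<omega> c"
    if c: "c \<in> sequence_space \<epsilon> \<Phi>1 \<Phi>2 \<omega>" for c
  proof -
    obtain A where A: "A \<ge> 0" "\<And>k. k \<in> L \<Longrightarrow> norm (c k) * \<omega> k \<le> A"
      using sequence_space_bounded[OF \<Phi> c] by blast
    show ?thesis
      unfolding modulation_norm_def sequence_norm_def mixed_orlicz_norm_def
    proof (rule main[where X = "\<lambda>z. norm (c z) * \<omega> z" and U = "\<lambda>z. norm (stft_gauss (synth c) z) * \<omega> z"])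
      fix x \<xi> :: "real ^ 'd"
      let ?z = "(x, \<xi>)"
      let ?p = "(lattice_round \<epsilon> (fst ?z), lattice_round \<epsilon> (snd ?z))"
      let ?X = "\<lambda>k. norm (c k) * \<omega> k"
      have hs: "((\<lambda>k. c k * stft_gauss (atom k) ?z * complex_of_real (\<omega> ?z)) has_sum stft_gauss (synth c) ?z * complex_of_real (\<omega> ?z)) L"
        by (intro has_sum_cmult_left stft_synth[OF A])
      have "ennreal ((norm (stft_gauss (synth c) ?z) * \<omega> ?z) powr r) =
          ennreal (norm (stft_gauss (synth c) ?z * complex_of_real (\<omega> ?z)) powr r)"
        using \<omega>_pos[of ?z] by (simp add: norm_mult)
      also have "\<dots> \<le> (\<integral>\<^sup>+k. ennreal (norm (c k * stft_gauss (atom k) ?z * complex_of_real (\<omega> ?z)) powr r) \<partial>count_space L)"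
        by (rule powr_norm_has_sum_le[OF r hs])
      \<comment> \<open>z - k is within \<open>cell_radius\<close> of p - k, so the kernel may be
        evaluated at the lattice point p - k. Writing k as p - (p - k) prepares the reflection of
        the summation index.\<close>
      also have "\<dots> \<le> (\<integral>\<^sup>+k. ennreal (?a (?p - k) * ?X (?p - (?p - k)) powr r) \<partial>count_space L)"
      proof (intro nn_integral_mono ennreal_leI)
        fix k
        have "norm (c k * stft_gauss (atom k) ?z * complex_of_real (\<omega> ?z)) = norm (c k * stft_gauss (atom k) ?z) * \<omega> ?z"
          using \<omega>_pos[of ?z] by (simp add: norm_mult)
        also have "\<dots> \<le> mod_const * (?X k * (norm (stft_gauss \<psi> (?z - k)) * v (?z - k)))" by (rule atom_weight_le)
        finally have "norm (c k * stft_gauss (atom k) ?z * complex_of_real (\<omega> ?z)) powr r \<le>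
            (mod_const * (?X k * (norm (stft_gauss \<psi> (?z - k)) * v (?z - k)))) powr r"
          using r by (intro powr_mono2) auto
        also have "\<dots> = mod_const powr r * (?X k powr r * (norm (stft_gauss \<psi> (?z - k)) * v (?z - k)) powr r)"
          unfolding powr_mult[of mod_const] powr_mult[of "?X k"] ..
        also have "\<dots> \<le> mod_const powr r * (?X k powr r * b (?p - k))"
          using norm_round[of ?z] by (intro mult_left_mono b(3)) auto
        finally show "norm (c k * stft_gauss (atom k) ?z * complex_of_real (\<omega> ?z)) powr r \<le> ?a (?p - k) * ?X (?p - (?p - k)) powr r"
          by (simp add: mult_ac)
      qed
      also have "\<dots> = (\<integral>\<^sup>+k. ennreal (?a k * ?X (?p - k) powr r) \<partial>count_space L)"
        by (rule nn_integral_bij_count_space[OF bij_betw_lattice_reflect[OF round_in_L[of ?z]],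
              of "\<lambda>k. ennreal (?a k * ?X (?p - k) powr r)"])
      also have "\<dots> = (\<integral>\<^sup>+k. ennreal (?a k * ?X (lattice_round \<epsilon> x - fst k, lattice_round \<epsilon> \<xi> - snd k) powr r) \<partial>count_space L)"
      proof (intro nn_integral_cong)
        fix k
        have "?p - k = (lattice_round \<epsilon> x - fst k, lattice_round \<epsilon> \<xi> - snd k)" by (simp add: prod_eq_iff)
        then show "ennreal (?a k * ?X (?p - k) powr r) = ennreal (?a k * ?X (lattice_round \<epsilon> x - fst k, lattice_round \<epsilon> \<xi> - snd k) powr r)"
          by (simp only:)
      qed
      finally show "ennreal ((norm (stft_gauss (synth c) (x, \<xi>)) * \<omega> (x, \<xi>)) powr r) \<le> \<dots>" .
    qed (simp_all add: less_imp_le[OF \<omega>_pos])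
  qed
  then show ?thesis using C by blast
qed

text \<open>Neighbourhoods in the quasi-norm topologies are described by differences, so linearity
  reduces continuity to the norm bound.\<close>

lemma synth_diff:
  assumes \<Phi>: "quasi_young_function r \<Phi>1" "quasi_young_function r \<Phi>2"
    and c: "c \<in> sequence_space \<epsilon> \<Phi>1 \<Phi>2 \<omega>" "c' \<in> sequence_space \<epsilon> \<Phi>1 \<Phi>2 \<omega>"
  shows "synth (c' - c) = synth c' - synth c"
proof
  fix \<alpha>
  obtain A where A: "A \<ge> 0" "\<And>k. k \<in> L \<Longrightarrow> norm (c k) * \<omega> k \<le> A"
    using sequence_space_bounded[OF \<Phi> c(1)] by blast
  obtain A' where A': "A' \<ge> 0" "\<And>k. k \<in> L \<Longrightarrow> norm (c' k) * \<omega> k \<le> A'"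
    using sequence_space_bounded[OF \<Phi> c(2)] by blast
  have "((\<lambda>k. - (c k * atom k \<alpha>)) has_sum - synth c \<alpha>) L"
    unfolding has_sum_uminus minus_minus synth_def by (rule has_sum_infsum[OF atom_summable[OF A]])
  moreover have "((\<lambda>k. c' k * atom k \<alpha>) has_sum synth c' \<alpha>) L"
    unfolding synth_def by (rule has_sum_infsum[OF atom_summable[OF A']])
  ultimately have "((\<lambda>k. c' k * atom k \<alpha> + - (c k * atom k \<alpha>)) has_sum synth c' \<alpha> + - synth c \<alpha>) L"
    by (rule has_sum_add[rotated])
  from infsumI[OF this] show "synth (c' - c) \<alpha> = (synth c' - synth c) \<alpha>"
    by (simp add: synth_def[of "c' - c"] left_diff_distrib)
qed

end

theorem theorem4p6:
  fixes \<epsilon> r0 :: real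
    and \<Phi>1 \<Phi>2 :: "real \<Rightarrow> ennreal"
    and \<omega> v :: "(real ^ 'd::finite) \<times> (real ^ 'd) \<Rightarrow> real"
    and \<psi> :: "'d hermite_series"
  assumes "\<epsilon> > 0"
    and "0 < r0" and "r0 \<le> 1"
    and "quasi_young_function r0 \<Phi>1" and "quasi_young_function r0 \<Phi>2"
    and "\<omega> \<in> moderate_weights" and "v \<in> moderate_weights"
    and "submultiplicative v" and "moderate \<omega> v"
    and "\<psi> \<in> modulation_space_Lp r0 v"
    and "\<exists>\<phi> \<in> modulation_space_Lp r0 v. dual_window \<epsilon> \<phi> \<psi>"
  shows "(\<forall>c \<in> sequence_space \<epsilon> \<Phi>1 \<Phi>2 \<omega>. synthesizes \<epsilon> \<omega> \<psi> c (synthesis \<epsilon> \<omega> \<psi> c)) \<and>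
    continuous_map
      (quasinorm_topology (sequence_space \<epsilon> \<Phi>1 \<Phi>2 \<omega>) (sequence_norm \<epsilon> \<Phi>1 \<Phi>2 \<omega>))
      (quasinorm_topology (modulation_space \<Phi>1 \<Phi>2 \<omega>) (modulation_norm \<Phi>1 \<Phi>2 \<omega>))
      (synthesis \<epsilon> \<omega> \<psi>) \<and>
    (\<exists>C>0. \<forall>c \<in> sequence_space \<epsilon> \<Phi>1 \<Phi>2 \<omega>.
      modulation_norm \<Phi>1 \<Phi>2 \<omega> (synthesis \<epsilon> \<omega> \<psi> c) \<le> ennreal C * sequence_norm \<epsilon> \<Phi>1 \<Phi>2 \<omega> c)"
proof -
  interpret gabor_synthesis \<epsilon> r0 \<omega> v \<psi>
    by standard (use assms in \<open>auto simp: moderate_weights_def\<close>)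
  let ?X = "sequence_space \<epsilon> \<Phi>1 \<Phi>2 \<omega>"
  let ?N = "sequence_norm \<epsilon> \<Phi>1 \<Phi>2 \<omega>"
  let ?M = "modulation_norm \<Phi>1 \<Phi>2 \<omega>"
  let ?D = "synthesis \<epsilon> \<omega> \<psi>"
  note \<Phi> = assms(4,5)
  have D: "?D c = synth c" "synthesizes \<epsilon> \<omega> \<psi> c (?D c)" "synth c \<in> pilipovic_dual" if c: "c \<in> ?X" for c
  proof -
    obtain A where A: "A \<ge> 0" "\<And>k. k \<in> L \<Longrightarrow> norm (c k) * \<omega> k \<le> A"
      using sequence_space_bounded[OF \<Phi> c] by blast
    show "?D c = synth c" "synthesizes \<epsilon> \<omega> \<psi> c (?D c)" "synth c \<in> pilipovic_dual"
      using synthesis_eq[OF A] synthesizes_iff[OF A] synth_pil[OF A] by simp_all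
  qed
  obtain C where C: "C > 0" "\<And>c. c \<in> ?X \<Longrightarrow> ?M (synth c) \<le> ennreal C * ?N c"
    using synth_modulation_norm_bound[OF \<Phi>] by blast
  have DM: "?D c \<in> modulation_space \<Phi>1 \<Phi>2 \<omega>" if c: "c \<in> ?X" for c
  proof -
    have "?M (synth c) < top"
      by (rule le_less_trans[OF C(2)[OF c]]) (use c in \<open>simp add: sequence_space_def ennreal_mult_less_top\<close>)
    then show ?thesis using D(1,3)[OF c] by (simp add: modulation_space_def)
  qed
  have "continuous_map (quasinorm_topology ?X ?N) (quasinorm_topology (modulation_space \<Phi>1 \<Phi>2 \<omega>) ?M) ?D"
    unfolding continuous_map_def topspace_quasinorm_topology
  proof (intro conjI allI impI)
    show "?D \<in> ?X \<rightarrow> modulation_space \<Phi>1 \<Phi>2 \<omega>" using DM by blast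
    fix U assume "openin (quasinorm_topology (modulation_space \<Phi>1 \<Phi>2 \<omega>) ?M) U"
    then have U: "\<And>f. f \<in> U \<Longrightarrow> \<exists>e>0. \<forall>g\<in>modulation_space \<Phi>1 \<Phi>2 \<omega>. ?M (g - f) < e \<longrightarrow> g \<in> U"
      unfolding openin_quasinorm_topology by blast
    show "openin (quasinorm_topology ?X ?N) {c \<in> ?X. ?D c \<in> U}"
      unfolding openin_quasinorm_topology
    proof (intro conjI ballI)
      fix c assume "c \<in> {c \<in> ?X. ?D c \<in> U}"
      then have c: "c \<in> ?X" "?D c \<in> U" by auto
      obtain e where e: "e > 0" "\<And>g. g \<in> modulation_space \<Phi>1 \<Phi>2 \<omega> \<Longrightarrow> ?M (g - ?D c) < e \<Longrightarrow> g \<in> U"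
        using U[OF c(2)] by blast
      \<comment> \<open>The radius e / C is dictated by the norm bound. As e is an extended real,
        the infinite value is treated separately below.\<close>
      have "c' \<in> {c \<in> ?X. ?D c \<in> U}" if c': "c' \<in> ?X" "?N (c' - c) < e / ennreal C" for c'
      proof -
        \<comment> \<open>The difference has finite quasi-norm because it is close, which puts it in
          the sequence space without a quasi-triangle inequality.\<close>
        have "?N (c' - c) < top" using c'(2) by (metis top.not_eq_extremum less_trans top_greatest not_less_iff_gr_or_eq)
        then have d: "c' - c \<in> ?X" using c(1) c'(1) by (simp add: sequence_space_def)
        have "?M (?D c' - ?D c) = ?M (synth (c' - c))"
          unfolding D(1)[OF c(1)] D(1)[OF c'(1)] synth_diff[OF \<Phi> c(1) c'(1)] ..
        also have "\<dots> \<le> ennreal C * ?N (c' - c)" by (rule C(2)[OF d])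
        also have "\<dots> < e"
        proof (cases "e = top")
          case True
          then show ?thesis using \<open>?N (c' - c) < top\<close> by (simp add: ennreal_mult_less_top)
        next
          case False
          then obtain e' where e': "e = ennreal e'" "e' \<ge> 0" by (cases e) auto
          obtain s where s: "?N (c' - c) = ennreal s" "s \<ge> 0"
            using \<open>?N (c' - c) < top\<close> by (cases "?N (c' - c)") auto
          have "s < e' / C" using c'(2) C(1) e' s by (simp add: divide_ennreal ennreal_less_iff)
          then have "C * s < e'" using C(1) by (simp add: field_simps)
          then show ?thesis using C(1) s(2) unfolding e' s by (simp add: ennreal_mult[symmetric] ennreal_less_iff)
        qed
        finally show ?thesis using c'(1) e(2)[OF DM[OF c'(1)]] by simp
      qed
      moreover have "e / ennreal C > 0" using e(1) C(1) by (simp add: ennreal_zero_less_divide)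
      ultimately show "\<exists>d>0. \<forall>c'\<in>?X. ?N (c' - c) < d \<longrightarrow> c' \<in> {c \<in> ?X. ?D c \<in> U}" by blast
    qed blast
  qed
  moreover have "\<exists>C>0. \<forall>c \<in> ?X. ?M (?D c) \<le> ennreal C * ?N c" using C D(1) by auto
  ultimately show ?thesis using D(2) by blast
qed

end
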